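(* Let $k$ be a field of characteristic different from $2$, let $\mathcal{X}$ be a generic $(G,\varepsilon)$-Lie color algebra over $k$, and let $x_1,\ldots,x_m$ be a homogeneous basis of $\mathcal{X}_-$. Let $p=\frac12m(m+1)$, $s(i,j)=\frac12j(j-1)+i$ for $1\le i\le j\le m$, and let $t_1,\ldots,t_p\in\mathcal{X}$ be given by $t_{s(j,j)}=x_j$ and $t_{s(i,j)}=\langle x_i,x_j\rangle$ for $i<j$. For $1\le i\le m$ let $\mathcal{X}_i$ be the generic sub Lie color algebra of $\mathcal{X}$ generated by $\{x_1,\ldots,x_i\}$. Set $U_1=k[t_1]$ and, for $j=2,\ldots,m$, define recursively the iterated Ore extension $$U_j=U_{j-1}\left[t_{s(1,j)};\sigma_{s(1,j)}\right]\cdots\left[t_{s(j-1,j)};\sigma_{s(j-1,j)}\right]\left[t_{s(j,j)};\sigma_{s(j,j)},\delta_{s(j,j)}\right],$$ where the maps $\sigma_r$ and $\delta_{s(j,j)}$ are determined by $\sigma_r(t_i)=\varepsilon(t_r,t_i)t_i$ for $1\le i<r\le p$ and $\delta_{s(j,j)}(t_i)=\langle t_{s(j,j)},t_i\rangle$ for $1\le i<s(j,j)$. Then: 1. $\mathcal{B}=\{\mathbf{t}^\alpha:\alpha\in\mathbb{N}^p\}$ is a basis for $U(\mathcal{X})$; 2. $U(\mathcal{X}_i)\cong U_i$ for $1\leq i\leq m$; and 3. there is a $\mathcal{B}$-admissible ordering $\preceq$ on $U(\mathcal{X})$ such that $t_1\prec t_2\prec\cdots\prec t_p$.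
   Context: Let $G$ be an additively written abelian group and $k^\times=k\setminus\{0\}$. A map $\varepsilon:G\times G\to k^\times$ is a skew-symmetric bicharacter if for all $f,g,h\in G$: $\varepsilon(f,g+h)=\varepsilon(f,g)\varepsilon(f,h)$, $\varepsilon(g+h,f)=\varepsilon(g,f)\varepsilon(h,f)$, and $\varepsilon(g,h)\varepsilon(h,g)=1$. For nonzero homogeneous $x$, $\partial x$ denotes its degree, and $\varepsilon(x,y)$ means $\varepsilon(\partial x,\partial y)$. A $(G,\varepsilon)$-Lie color algebra is a $G$-graded vector space $\mathcal{L}$ with a graded bilinear map $\langle\,,\rangle:\mathcal{L}\times\mathcal{L}\to\mathcal{L}$ such that for all homogeneous $x,y,z$: $\langle x,y\rangle=-\varepsilon(x,y)\langle y,x\rangle$ and $\varepsilon(z,x)\langle x,\langle y,z\rangle\rangle+\varepsilon(y,z)\langle z,\langle x,y\rangle\rangle+\varepsilon(x,y)\langle y,\langle z,x\rangle\rangle=0$. Put $G_\pm=\{g\in G:\varepsilon(g,g)=\pm1\}$ and $\mathcal{L}_\pm=\bigoplus_{g\in G_\pm}\mathcal{L}_g$. The universal enveloping algebra $U(\mathcal{L})$ is the quotient of the tensor algebra of $\mathcal{L}$ by the two-sided ideal generated by all $x\otimes y-\varepsilon(x,y)\,y\otimes x-\langle x,y\rangle$ with $x,y\in\mathcal{L}$ homogeneous. A Lie color algebra $\mathcal{X}$ is generic if $m=\dim\mathcal{X}_-<\infty$, $\dim\mathcal{X}_+=\frac12m(m+1)$, $\mathcal{X}_+=\langle\mathcal{X}_-,\mathcal{X}_-\rangle$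 (the span of all brackets of elements of $\mathcal{X}_-$), and $\mathcal{X}_+$ is color central: $\langle x,y\rangle=0$ for all $x\in\mathcal{X}_+$, $y\in\mathcal{X}$. For a graded subspace $V\subseteq\mathcal{X}_-$, the subspace $V\oplus\langle V,V\rangle$ is again a generic Lie color algebra; $\mathcal{X}_i$ is this algebra for $V=\mathrm{span}\{x_1,\ldots,x_i\}$. An Ore extension $A[\theta;\sigma,\delta]$, for a $k$-algebra $A$, an automorphism $\sigma$ and a $\sigma$-derivation $\delta$, is the free left $A$-module on powers of $\theta$ with $\theta a=\sigma(a)\theta+\delta(a)$ for $a\in A$; $A[\theta;\sigma]$ means $\delta=0$. In $U_j$ the $t_i$ are regarded as the Ore variables, and $\delta_{s(j,j)}(t_i)=\langle t_{s(j,j)},t_i\rangle$ is read as follows: it is $0$ if $t_i\in\mathcal{X}_+$, and if $t_i=x_b$ with $b<j$ it is $\langle x_j,x_b\rangle=-\varepsilon(x_j,x_b)\,t_{s(b,j)}$. For $\alpha=(\alpha_1,\ldots,\alpha_p)\in\mathbb{N}^p$ ($\mathbb{N}$ includes $0$) write $\mathbf{t}^\alpha=t_1^{\alpha_1}\cdots t_p^{\alpha_p}\in U(\mathcal{X})$. When $\mathcal{B}=\{\mathbf{t}^\alpha\}$ is a basis and $\preceq$ is a total order on $\mathbb{N}^p$, the exponent $\exp(u)$ of nonzero $u=\sum_\alpha c_\alpha\mathbf{t}^\alpha$ is the $\preceq$-maximum of $\{\alpha:c_\alpha\ne0\}$. A $\mathcal{B}$-admissible ordering on $U(\mathcal{X})$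 is a total order $\preceq$ on $\mathbb{N}^p$ such that $0\preceq\alpha$ for all $\alpha$, $\alpha\prec\beta$ implies $\alpha+\gamma\prec\beta+\gamma$, and $\exp(\mathbf{t}^\alpha\mathbf{t}^\beta)=\alpha+\beta$ for all $\alpha,\beta$. For nonzero $u,v\in U(\mathcal{X})$, $u\prec v$ means $\exp(u)\prec\exp(v)$. *)

theory Defs
  imports
    "HOL.Vector_Spaces"
    "HOL-Algebra.QuotRing"
    "HOL-Algebra.Module"
    "HOL-Library.Poly_Mapping"
begin

section \<open>Algebras over a field\<close>

definition base_ring :: "'k::field ring" where
  "base_ring = \<lparr>carrier = UNIV, monoid.mult = (*), one = 1, zero = 0, add = (+)\<rparr>"

text \<open>
  The locale \<^locale>\<open>algebra\<close> of the library is restricted to commutative rings, so associative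
  unital algebras are introduced here; they use the same record type.
\<close>

definition assoc_algebra :: "('k::field, 'a) module \<Rightarrow> bool" where
  "assoc_algebra A \<longleftrightarrow> ring A \<and> Module.module base_ring A \<and>
     (\<forall>c. \<forall>a\<in>carrier A. \<forall>b\<in>carrier A.
        (c \<odot>\<^bsub>A\<^esub> a) \<otimes>\<^bsub>A\<^esub> b = c \<odot>\<^bsub>A\<^esub> (a \<otimes>\<^bsub>A\<^esub> b) \<and>
        a \<otimes>\<^bsub>A\<^esub> (c \<odot>\<^bsub>A\<^esub> b) = c \<odot>\<^bsub>A\<^esub> (a \<otimes>\<^bsub>A\<^esub> b))"

definition algebra_iso :: "('k::field, 'a) module \<Rightarrow> ('k, 'b) module \<Rightarrow> ('a \<Rightarrow> 'b) set" where
  "algebra_iso A B =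
     {h \<in> ring_iso A B. \<forall>c. \<forall>a\<in>carrier A. h (c \<odot>\<^bsub>A\<^esub> a) = c \<odot>\<^bsub>B\<^esub> h a}"

definition is_algebra_iso :: "('k::field, 'a) module \<Rightarrow> ('k, 'b) module \<Rightarrow> bool"
    (infix \<open>\<cong>\<^sub>a\<close> 60) where
  "A \<cong>\<^sub>a B \<longleftrightarrow> algebra_iso A B \<noteq> {}"

definition quotient_algebra :: "('k::field, 'a) module \<Rightarrow> 'a set \<Rightarrow> ('k, 'a set) module" where
  "quotient_algebra A I =
     ring.extend (A Quot I) (module.fields (\<lambda>c C. \<Union>a\<in>C. I +>\<^bsub>A\<^esub> (c \<odot>\<^bsub>A\<^esub> a)))"

text \<open>Families indexed by a set \<open>J\<close> that form a basis of the underlying vector space.\<close>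

definition lin_comb :: "('k::field, 'a) module \<Rightarrow> ('i \<Rightarrow> 'a) \<Rightarrow> ('i \<Rightarrow>\<^sub>0 'k) \<Rightarrow> 'a" where
  "lin_comb A b c = (\<Oplus>\<^bsub>A\<^esub>i\<in>Poly_Mapping.keys c. Poly_Mapping.lookup c i \<odot>\<^bsub>A\<^esub> b i)"

definition basis_family :: "('k::field, 'a) module \<Rightarrow> 'i set \<Rightarrow> ('i \<Rightarrow> 'a) \<Rightarrow> bool" where
  "basis_family A J b \<longleftrightarrow>
     b ` J \<subseteq> carrier A \<and>
     (\<forall>u\<in>carrier A. \<exists>c. Poly_Mapping.keys c \<subseteq> J \<and> u = lin_comb A b c) \<and>
     (\<forall>c. Poly_Mapping.keys c \<subseteq> J \<longrightarrow> lin_comb A b c = \<zero>\<^bsub>A\<^esub> \<longrightarrow> c = 0)"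

definition coordinates :: "('k::field, 'a) module \<Rightarrow> 'i set \<Rightarrow> ('i \<Rightarrow> 'a) \<Rightarrow> 'a \<Rightarrow> ('i \<Rightarrow>\<^sub>0 'k)" where
  "coordinates A J b u = (THE c. Poly_Mapping.keys c \<subseteq> J \<and> u = lin_comb A b c)"


section \<open>The tensor algebra\<close>

text \<open>
  Lists under concatenation are the free monoid, so \<open>'v list \<Rightarrow>\<^sub>0 'k\<close> with the convolution product
  of \<^theory>\<open>HOL-Library.Poly_Mapping\<close> is the free associative algebra on the set \<open>'v\<close>.
\<close>

instantiation list :: (type) monoid_add
begin

definition zero_list :: "'a list" where "zero_list = []"

definition plus_list :: "'a list \<Rightarrow> 'a list \<Rightarrow> 'a list" where "plus_list = (@)"

instance
  by standard (simp_all add: zero_list_def plus_list_def)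

end

definition free_algebra :: "'v set \<Rightarrow> ('k::field, 'v list \<Rightarrow>\<^sub>0 'k) module" where
  "free_algebra V =
     \<lparr>carrier = {f. Poly_Mapping.keys f \<subseteq> lists V}, monoid.mult = (*), one = 1, zero = 0, add = (+),
      smult = (\<lambda>c. Poly_Mapping.map ((*) c))\<rparr>"

text \<open>
  The tensor algebra of a vector space \<open>V\<close> is the free algebra on the set \<open>V\<close>, modulo the relations
  that make the inclusion of the generators linear.
\<close>

definition linearity_ideal ::
    "('k::field \<Rightarrow> 'v::ab_group_add \<Rightarrow> 'v) \<Rightarrow> 'v set \<Rightarrow> ('v list \<Rightarrow>\<^sub>0 'k) set" where
  "linearity_ideal scale V =
     Idl\<^bsub>free_algebra V :: ('k, _) module\<^esub>
       ({Poly_Mapping.single [x + y] 1 - Poly_Mapping.single [x] 1 - Poly_Mapping.single [y] 1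
          | x y. x \<in> V \<and> y \<in> V} \<union>
        {Poly_Mapping.single [scale c x] 1 - Poly_Mapping.single [x] c | c x. x \<in> V})"

definition tensor_algebra ::
    "('k::field \<Rightarrow> 'v::ab_group_add \<Rightarrow> 'v) \<Rightarrow> 'v set \<Rightarrow> ('k, ('v list \<Rightarrow>\<^sub>0 'k) set) module" where
  "tensor_algebra scale V = quotient_algebra (free_algebra V) (linearity_ideal scale V)"

definition tensor_incl ::
    "('k::field \<Rightarrow> 'v::ab_group_add \<Rightarrow> 'v) \<Rightarrow> 'v set \<Rightarrow> 'v \<Rightarrow> ('v list \<Rightarrow>\<^sub>0 'k) set" where
  "tensor_incl scale V x =
     linearity_ideal scale V +>\<^bsub>free_algebra V :: ('k, _) module\<^esub> Poly_Mapping.single [x] 1"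


section \<open>Lie color algebras\<close>

definition skew_bicharacter :: "('g::ab_group_add \<Rightarrow> 'g \<Rightarrow> 'k::field) \<Rightarrow> bool" where
  "skew_bicharacter \<epsilon> \<longleftrightarrow>
     (\<forall>f g. \<epsilon> f g \<noteq> 0) \<and>
     (\<forall>f g h. \<epsilon> f (g + h) = \<epsilon> f g * \<epsilon> f h) \<and>
     (\<forall>f g h. \<epsilon> (g + h) f = \<epsilon> g f * \<epsilon> h f) \<and>
     (\<forall>g h. \<epsilon> g h * \<epsilon> h g = 1)"

text \<open>
  A Lie color algebra is carried by a subspace \<open>L\<close> of an ambient vector space, so that subalgebras
  are again instances; \<open>gr g\<close> is the homogeneous component of degree \<open>g\<close>. Conditions on homogeneous
  elements quantify over the degrees; for a zero argument, which lies in every component, they hold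
  trivially.
\<close>

locale lie_color_algebra = vector_space scale
  for scale :: "'k::field \<Rightarrow> 'v::ab_group_add \<Rightarrow> 'v" +
  fixes \<epsilon> :: "'g::ab_group_add \<Rightarrow> 'g \<Rightarrow> 'k"
    and L :: "'v set"
    and gr :: "'g \<Rightarrow> 'v set"
    and br :: "'v \<Rightarrow> 'v \<Rightarrow> 'v"
  assumes bicharacter: "skew_bicharacter \<epsilon>"
    and subspace_gr: "subspace (gr g)"
    and span_gr: "span (\<Union>g. gr g) = L"
    and direct_gr: "\<lbrakk>finite S; \<And>g. g \<in> S \<Longrightarrow> v g \<in> gr g; (\<Sum>g\<in>S. v g) = 0; h \<in> S\<rbrakk> \<Longrightarrow> v h = 0"
    and br_graded: "\<lbrakk>x \<in> gr g; y \<in> gr h\<rbrakk> \<Longrightarrow> br x y \<in> gr (g + h)"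
    and br_add_left: "\<lbrakk>x \<in> L; y \<in> L; z \<in> L\<rbrakk> \<Longrightarrow> br (x + y) z = br x z + br y z"
    and br_add_right: "\<lbrakk>x \<in> L; y \<in> L; z \<in> L\<rbrakk> \<Longrightarrow> br x (y + z) = br x y + br x z"
    and br_scale_left: "\<lbrakk>x \<in> L; y \<in> L\<rbrakk> \<Longrightarrow> br (scale c x) y = scale c (br x y)"
    and br_scale_right: "\<lbrakk>x \<in> L; y \<in> L\<rbrakk> \<Longrightarrow> br x (scale c y) = scale c (br x y)"
    and br_skew: "\<lbrakk>x \<in> gr g; y \<in> gr h\<rbrakk> \<Longrightarrow> br x y = - scale (\<epsilon> g h) (br y x)"
    and br_jacobi: "\<lbrakk>x \<in> gr f; y \<in> gr g; z \<in> gr h\<rbrakk> \<Longrightarrow>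
      scale (\<epsilon> h f) (br x (br y z)) + scale (\<epsilon> g h) (br z (br x y))
        + scale (\<epsilon> f g) (br y (br z x)) = 0"

text \<open>The sum of the components of degree \<open>g\<close> with \<open>\<epsilon> g g = c\<close>; only \<open>c = 1, -1\<close> occur.\<close>

definition sign_part ::
    "('k::field \<Rightarrow> 'v::ab_group_add \<Rightarrow> 'v) \<Rightarrow> ('g \<Rightarrow> 'g \<Rightarrow> 'k) \<Rightarrow> ('g \<Rightarrow> 'v set) \<Rightarrow> 'k \<Rightarrow> 'v set" where
  "sign_part scale \<epsilon> gr c = module.span scale (\<Union>g\<in>{g. \<epsilon> g g = c}. gr g)"

locale generic_lie_color_algebra = lie_color_algebra +
  assumes fin_dim_minus: "\<exists>B. finite B \<and> span B = sign_part scale \<epsilon> gr (-1)"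
    and dim_plus: "dim (sign_part scale \<epsilon> gr 1) =
      dim (sign_part scale \<epsilon> gr (-1)) * (dim (sign_part scale \<epsilon> gr (-1)) + 1) div 2"
    and plus_eq: "sign_part scale \<epsilon> gr 1 =
      span {br x y | x y. x \<in> sign_part scale \<epsilon> gr (-1) \<and> y \<in> sign_part scale \<epsilon> gr (-1)}"
    and color_central: "\<lbrakk>x \<in> sign_part scale \<epsilon> gr 1; y \<in> L\<rbrakk> \<Longrightarrow> br x y = 0"

text \<open>Meaningful only for a nonzero homogeneous element.\<close>

definition deg :: "('g \<Rightarrow> 'v set) \<Rightarrow> 'v \<Rightarrow> 'g" where
  "deg gr v = (THE g. v \<in> gr g)"

text \<open>The subspace \<open>V \<oplus> \<langle>V, V\<rangle>\<close>, where \<open>V\<close> is the span of \<open>S\<close>.\<close>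

definition sub_generated ::
    "('k::field \<Rightarrow> 'v::ab_group_add \<Rightarrow> 'v) \<Rightarrow> ('v \<Rightarrow> 'v \<Rightarrow> 'v) \<Rightarrow> 'v set \<Rightarrow> 'v set" where
  "sub_generated scale br S =
     {v + w | v w. v \<in> module.span scale S \<and>
        w \<in> module.span scale {br a b | a b. a \<in> module.span scale S \<and> b \<in> module.span scale S}}"


section \<open>The universal enveloping algebra\<close>

definition uea_ideal ::
    "('k::field \<Rightarrow> 'v::ab_group_add \<Rightarrow> 'v) \<Rightarrow> ('g \<Rightarrow> 'g \<Rightarrow> 'k) \<Rightarrow> 'v set \<Rightarrow> ('g \<Rightarrow> 'v set) \<Rightarrow>
     ('v \<Rightarrow> 'v \<Rightarrow> 'v) \<Rightarrow> ('v list \<Rightarrow>\<^sub>0 'k) set set" where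
  "uea_ideal scale \<epsilon> L gr br =
     (let T = tensor_algebra scale L; \<iota> = tensor_incl scale L in
      Idl\<^bsub>T\<^esub> {(\<iota> x \<otimes>\<^bsub>T\<^esub> \<iota> y) \<ominus>\<^bsub>T\<^esub> (\<epsilon> g h \<odot>\<^bsub>T\<^esub> (\<iota> y \<otimes>\<^bsub>T\<^esub> \<iota> x)) \<ominus>\<^bsub>T\<^esub> \<iota> (br x y)
               | x y g h. x \<in> gr g \<and> y \<in> gr h})"

definition uea ::
    "('k::field \<Rightarrow> 'v::ab_group_add \<Rightarrow> 'v) \<Rightarrow> ('g \<Rightarrow> 'g \<Rightarrow> 'k) \<Rightarrow> 'v set \<Rightarrow> ('g \<Rightarrow> 'v set) \<Rightarrow>
     ('v \<Rightarrow> 'v \<Rightarrow> 'v) \<Rightarrow> ('k, ('v list \<Rightarrow>\<^sub>0 'k) set set) module" where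
  "uea scale \<epsilon> L gr br = quotient_algebra (tensor_algebra scale L) (uea_ideal scale \<epsilon> L gr br)"

definition uea_incl ::
    "('k::field \<Rightarrow> 'v::ab_group_add \<Rightarrow> 'v) \<Rightarrow> ('g \<Rightarrow> 'g \<Rightarrow> 'k) \<Rightarrow> 'v set \<Rightarrow> ('g \<Rightarrow> 'v set) \<Rightarrow>
     ('v \<Rightarrow> 'v \<Rightarrow> 'v) \<Rightarrow> 'v \<Rightarrow> ('v list \<Rightarrow>\<^sub>0 'k) set set" where
  "uea_incl scale \<epsilon> L gr br x =
     uea_ideal scale \<epsilon> L gr br +>\<^bsub>tensor_algebra scale L\<^esub> tensor_incl scale L x"


section \<open>Ore extensions\<close>

definition algebra_derivation ::
    "('k::field, 'a) module \<Rightarrow> ('a \<Rightarrow> 'a) \<Rightarrow> ('a \<Rightarrow> 'a) \<Rightarrow> bool" where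
  "algebra_derivation A \<sigma> \<delta> \<longleftrightarrow>
     \<delta> \<in> carrier A \<rightarrow> carrier A \<and>
     (\<forall>c. \<forall>a\<in>carrier A. \<delta> (c \<odot>\<^bsub>A\<^esub> a) = c \<odot>\<^bsub>A\<^esub> \<delta> a) \<and>
     (\<forall>a\<in>carrier A. \<forall>b\<in>carrier A.
        \<delta> (a \<oplus>\<^bsub>A\<^esub> b) = \<delta> a \<oplus>\<^bsub>A\<^esub> \<delta> b \<and>
        \<delta> (a \<otimes>\<^bsub>A\<^esub> b) = (\<sigma> a \<otimes>\<^bsub>A\<^esub> \<delta> b) \<oplus>\<^bsub>A\<^esub> (\<delta> a \<otimes>\<^bsub>A\<^esub> b))"

definition subalgebra_of :: "('k::field, 'a) module \<Rightarrow> ('k, 'a) module \<Rightarrow> bool" where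
  "subalgebra_of A B \<longleftrightarrow>
     carrier A \<subseteq> carrier B \<and> \<one>\<^bsub>A\<^esub> = \<one>\<^bsub>B\<^esub> \<and> \<zero>\<^bsub>A\<^esub> = \<zero>\<^bsub>B\<^esub> \<and>
     (\<forall>a\<in>carrier A. \<forall>b\<in>carrier A. a \<oplus>\<^bsub>A\<^esub> b = a \<oplus>\<^bsub>B\<^esub> b \<and> a \<otimes>\<^bsub>A\<^esub> b = a \<otimes>\<^bsub>B\<^esub> b) \<and>
     (\<forall>c. \<forall>a\<in>carrier A. c \<odot>\<^bsub>A\<^esub> a = c \<odot>\<^bsub>B\<^esub> a)"

text \<open>\<open>B = A[\<theta>; \<sigma>, \<delta>]\<close>\<close>

definition ore_extension ::
    "('k::field, 'a) module \<Rightarrow> 'a \<Rightarrow> ('a \<Rightarrow> 'a) \<Rightarrow> ('a \<Rightarrow> 'a) \<Rightarrow> ('k, 'a) module \<Rightarrow> bool" where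
  "ore_extension A \<theta> \<sigma> \<delta> B \<longleftrightarrow>
     assoc_algebra A \<and> \<sigma> \<in> algebra_iso A A \<and> algebra_derivation A \<sigma> \<delta> \<and>
     assoc_algebra B \<and> subalgebra_of A B \<and> \<theta> \<in> carrier B \<and>
     (\<forall>a\<in>carrier A. \<theta> \<otimes>\<^bsub>B\<^esub> a = (\<sigma> a \<otimes>\<^bsub>B\<^esub> \<theta>) \<oplus>\<^bsub>B\<^esub> \<delta> a) \<and>
     (\<forall>b\<in>carrier B. \<exists>!f::nat \<Rightarrow> 'a. range f \<subseteq> carrier A \<and> finite {n. f n \<noteq> \<zero>\<^bsub>A\<^esub>} \<and>
        b = (\<Oplus>\<^bsub>B\<^esub>n\<in>{n. f n \<noteq> \<zero>\<^bsub>A\<^esub>}. f n \<otimes>\<^bsub>B\<^esub> (\<theta> [^]\<^bsub>B\<^esub> n)))"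

definition s_index :: "nat \<Rightarrow> nat \<Rightarrow> nat" where
  "s_index i j = j * (j - 1) div 2 + i"

text \<open>
  \<open>ore_tower \<epsilon> d t r A\<close>: the algebra \<open>A\<close> is obtained from \<open>k\<close> by adjoining, one Ore extension at a
  time, the variables \<open>t 1, \<dots>, t r\<close> of degrees \<open>d 1, \<dots>, d r\<close>. The algebra \<open>U\<^sub>j\<close> is the stage
  \<open>r = s_index j j\<close>. The tower starts with \<open>k\<close> rather than with \<open>U\<^sub>1 = k[t\<^sub>1]\<close>: an algebra automorphism
  of \<open>k\<close> is the identity and a linear derivation of \<open>k\<close> is zero, so the first step yields \<open>k[t\<^sub>1]\<close>.
\<close>

inductive ore_tower ::
    "('g \<Rightarrow> 'g \<Rightarrow> 'k::field) \<Rightarrow> (nat \<Rightarrow> 'g) \<Rightarrow> (nat \<Rightarrow> 'a) \<Rightarrow> nat \<Rightarrow> ('k, 'a) module \<Rightarrow> bool"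
  for \<epsilon> :: "'g \<Rightarrow> 'g \<Rightarrow> 'k::field" and d :: "nat \<Rightarrow> 'g" and t :: "nat \<Rightarrow> 'a" where
  base: "\<lbrakk>assoc_algebra A; \<one>\<^bsub>A\<^esub> \<noteq> \<zero>\<^bsub>A\<^esub>; carrier A = range (\<lambda>c. c \<odot>\<^bsub>A\<^esub> \<one>\<^bsub>A\<^esub>)\<rbrakk> \<Longrightarrow> ore_tower \<epsilon> d t 0 A"
| off_diagonal:
    "\<lbrakk>1 \<le> i; i < j; r = s_index i j; ore_tower \<epsilon> d t (r - 1) A;
      ore_extension A (t r) \<sigma> (\<lambda>_. \<zero>\<^bsub>A\<^esub>) B;
      \<And>l. \<lbrakk>1 \<le> l; l < r\<rbrakk> \<Longrightarrow> \<sigma> (t l) = \<epsilon> (d r) (d l) \<odot>\<^bsub>A\<^esub> t l\<rbrakk>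
     \<Longrightarrow> ore_tower \<epsilon> d t r B"
| diagonal:
    "\<lbrakk>1 \<le> j; r = s_index j j; ore_tower \<epsilon> d t (r - 1) A;
      ore_extension A (t r) \<sigma> \<delta> B;
      \<And>l. \<lbrakk>1 \<le> l; l < r\<rbrakk> \<Longrightarrow> \<sigma> (t l) = \<epsilon> (d r) (d l) \<odot>\<^bsub>A\<^esub> t l;
      \<And>a b. \<lbrakk>1 \<le> a; a < b; b \<le> j\<rbrakk> \<Longrightarrow> \<delta> (t (s_index a b)) = \<zero>\<^bsub>A\<^esub>;
      \<And>b. \<lbrakk>1 \<le> b; b < j\<rbrakk> \<Longrightarrow>
        \<delta> (t (s_index b b)) = (- \<epsilon> (d r) (d (s_index b b))) \<odot>\<^bsub>A\<^esub> t (s_index b j)\<rbrakk>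
     \<Longrightarrow> ore_tower \<epsilon> d t r B"


section \<open>Standard monomials and admissible orderings\<close>

definition exponents :: "nat \<Rightarrow> (nat \<Rightarrow>\<^sub>0 nat) set" where
  "exponents p = {\<alpha>. Poly_Mapping.keys \<alpha> \<subseteq> {1..p}}"

definition std_monomial ::
    "('k::field, 'a) module \<Rightarrow> nat \<Rightarrow> (nat \<Rightarrow> 'a) \<Rightarrow> (nat \<Rightarrow>\<^sub>0 nat) \<Rightarrow> 'a" where
  "std_monomial A p t \<alpha> = foldr (\<lambda>i u. (t i [^]\<^bsub>A\<^esub> Poly_Mapping.lookup \<alpha> i) \<otimes>\<^bsub>A\<^esub> u) [1..<Suc p] \<one>\<^bsub>A\<^esub>"

text \<open>
  The notions below presuppose that the standard monomials form a basis; \<open>R\<close> is a total order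
  on \<open>exponents p\<close>, given as a set of pairs.
\<close>

definition lead_exp ::
    "('k::field, 'a) module \<Rightarrow> nat \<Rightarrow> (nat \<Rightarrow> 'a) \<Rightarrow> (nat \<Rightarrow>\<^sub>0 nat) rel \<Rightarrow> 'a \<Rightarrow> (nat \<Rightarrow>\<^sub>0 nat)" where
  "lead_exp A p t R u =
     (let S = Poly_Mapping.keys (coordinates A (exponents p) (std_monomial A p t) u)
      in THE \<alpha>. \<alpha> \<in> S \<and> (\<forall>\<beta>\<in>S. (\<beta>, \<alpha>) \<in> R))"

definition lead_less ::
    "('k::field, 'a) module \<Rightarrow> nat \<Rightarrow> (nat \<Rightarrow> 'a) \<Rightarrow> (nat \<Rightarrow>\<^sub>0 nat) rel \<Rightarrow> 'a \<Rightarrow> 'a \<Rightarrow> bool" where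
  "lead_less A p t R u v \<longleftrightarrow>
     u \<noteq> \<zero>\<^bsub>A\<^esub> \<and> v \<noteq> \<zero>\<^bsub>A\<^esub> \<and> (lead_exp A p t R u, lead_exp A p t R v) \<in> R - Id"

definition admissible_order ::
    "('k::field, 'a) module \<Rightarrow> nat \<Rightarrow> (nat \<Rightarrow> 'a) \<Rightarrow> (nat \<Rightarrow>\<^sub>0 nat) rel \<Rightarrow> bool" where
  "admissible_order A p t R \<longleftrightarrow>
     linear_order_on (exponents p) R \<and>
     (\<forall>\<alpha>\<in>exponents p. (0, \<alpha>) \<in> R) \<and>
     (\<forall>\<alpha>\<in>exponents p. \<forall>\<beta>\<in>exponents p. \<forall>\<gamma>\<in>exponents p.
        (\<alpha>, \<beta>) \<in> R - Id \<longrightarrow> (\<alpha> + \<gamma>, \<beta> + \<gamma>) \<in> R - Id) \<and>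
     (\<forall>\<alpha>\<in>exponents p. \<forall>\<beta>\<in>exponents p.
        std_monomial A p t \<alpha> \<otimes>\<^bsub>A\<^esub> std_monomial A p t \<beta> \<noteq> \<zero>\<^bsub>A\<^esub> \<and>
        lead_exp A p t R (std_monomial A p t \<alpha> \<otimes>\<^bsub>A\<^esub> std_monomial A p t \<beta>) = \<alpha> + \<beta>)"

end

theory Submission
  imports Defs
begin

text \<open>
  In \<open>U(X)\<close> the \<open>t\<^sub>i\<close> satisfy \<open>t\<^sub>r t\<^sub>l = \<epsilon>(t\<^sub>r, t\<^sub>l) t\<^sub>l t\<^sub>r + c t\<^sub>k\<close> for \<open>l < r\<close>, with a scalar \<open>c\<close> and some \<open>k < r\<close>. In any algebra
  with such relations the standard monomials span a subalgebra, and \<open>t\<^sup>\<alpha> t\<^sup>\<beta>\<close> is a nonzero multiple of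
  \<open>t\<^sup>\<alpha>\<^sup>+\<^sup>\<beta>\<close> modulo smaller monomials, in an order that compares degrees first; this is the admissible order.

  The dimension hypothesis makes the \<open>x\<^sub>a\<close> and the \<open>\<langle>x\<^sub>a, x\<^sub>b\<rangle>\<close>, \<open>a \<le> b\<close>, a basis of \<open>X\<close>, and \<open>\<langle>x\<^sub>a, x\<^sub>a\<rangle> = 2 x\<^sub>a\<^sup>2\<close> in \<open>U(X)\<close>.
  Hence \<open>U(X\<^sub>i)\<close> is universal for these relations. An algebra of operators on functions of the exponents
  satisfies them with linearly independent standard monomials, so these form a basis of \<open>U(X)\<close>.

  An iterated Ore extension satisfies the relations and has the standard monomials as a basis, so
  the universal map from \<open>U(X\<^sub>i)\<close> is an isomorphism. Conversely the subalgebras of \<open>U(X)\<close> spanned by the monomials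
  in \<open>t\<^sub>1, \<dots>, t\<^sub>r\<close> form such a tower: \<open>\<sigma>\<^sub>r\<close> multiplies an element of degree \<open>g\<close> by \<open>\<epsilon>(t\<^sub>r, g)\<close>, and
  \<open>\<delta>\<^sub>r(u) = t\<^sub>r u - \<sigma>\<^sub>r(u) t\<^sub>r\<close>.
\<close>

text \<open>The relations alone give only that the standard monomials span; that they do not
  collapse needs a model. An iterated Ore extension is awkward as a model, because the existence of
  its maps \<sigma> and \<delta> already presupposes that the relations are compatible. The
  operators avoid this circle: their relations are checked by direct computation. Once U(X) has its
  basis, the tower is found inside it, where \<sigma> comes from the universal property and
  \<delta>, being a skew commutator, is a \<sigma>-derivation for free.

  The space X has dimension m + p, but there are only p variables: the m brackets <x_a, x_a> are
  absorbed by the powers of x_a, which are therefore unrestricted. That x_a is odd shows elsewhere: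
  the brackets that arise from moving x_i past two factors x_j cancel, which is the origin of the
  parity test in \<open>dop\<close>.

  Degree comes first in the order because the bracket term of a relation has one variable in place
  of two.\<close>

abbreviation "lookup \<equiv> Poly_Mapping.lookup"
abbreviation "keys \<equiv> Poly_Mapping.keys"

section \<open>Associative algebras\<close>

lemma base_ring_simps [simp]:
  "carrier base_ring = UNIV" "a \<otimes>\<^bsub>base_ring\<^esub> b = a * b" "\<one>\<^bsub>base_ring\<^esub> = 1"
  "\<zero>\<^bsub>base_ring\<^esub> = 0" "a \<oplus>\<^bsub>base_ring\<^esub> b = a + b"
  by (simp_all add: base_ring_def)

lemma cring_base_ring: "cring (base_ring :: 'k::field ring)"
proof -
  have "abelian_group (base_ring :: 'k ring)"
  proof (rule abelian_groupI, simp_all add: ac_simps)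
    show "\<exists>y. x + y = 0" for x :: 'k
      by (rule exI[of _ "- x"]) simp
  qed
  moreover have "Group.comm_monoid (base_ring :: 'k ring)"
    by (rule Group.comm_monoidI) (simp_all add: ac_simps)
  ultimately show ?thesis
    by (rule cringI) (simp add: distrib_right)
qed

text \<open>Flattened form of \<open>assoc_algebra\<close>: the scalar laws are stated directly, so
  that the library's module over \<open>base_ring\<close> is not carried through every
  interpretation.\<close>

locale assoc_alg = ring A for A :: "('k::field, 'a) module" (structure) +
  assumes smult_cl [simp, intro]: "x \<in> carrier A \<Longrightarrow> c \<odot> x \<in> carrier A"
    and smult_add_left: "x \<in> carrier A \<Longrightarrow> (c + d) \<odot> x = c \<odot> x \<oplus> d \<odot> x"
    and smult_add_right: "\<lbrakk>x \<in> carrier A; y \<in> carrier A\<rbrakk> \<Longrightarrow> c \<odot> (x \<oplus> y) = c \<odot> x \<oplus> c \<odot> y"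
    and smult_smult: "x \<in> carrier A \<Longrightarrow> c \<odot> (d \<odot> x) = (c * d) \<odot> x"
    and smult_1 [simp]: "x \<in> carrier A \<Longrightarrow> 1 \<odot> x = x"
    and smult_mult_left: "\<lbrakk>x \<in> carrier A; y \<in> carrier A\<rbrakk> \<Longrightarrow> (c \<odot> x) \<otimes> y = c \<odot> (x \<otimes> y)"
    and smult_mult_right: "\<lbrakk>x \<in> carrier A; y \<in> carrier A\<rbrakk> \<Longrightarrow> x \<otimes> (c \<odot> y) = c \<odot> (x \<otimes> y)"

lemma assoc_algebra_iff: "assoc_algebra A \<longleftrightarrow> assoc_alg A"
proof
  assume a: "assoc_algebra A"
  then interpret ring A by (simp add: assoc_algebra_def)
  interpret M: Module.module base_ring A using a by (simp add: assoc_algebra_def)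
  show "assoc_alg A"
    by unfold_locales
      (use a M.smult_closed M.smult_l_distr M.smult_r_distr M.smult_assoc1 M.smult_one
        in \<open>auto simp: assoc_algebra_def\<close>)
next
  assume "assoc_alg A"
  then interpret assoc_alg A .
  have "Module.module base_ring A"
    by (rule moduleI[OF cring_base_ring])
      (simp_all add: is_abelian_group smult_add_left smult_add_right smult_smult)
  then show "assoc_algebra A"
    by (simp add: assoc_algebra_def ring_axioms smult_mult_left smult_mult_right)
qed

context assoc_alg
begin

lemma minus_eq_0_iff:
  assumes "x \<in> carrier A" "y \<in> carrier A" shows "x \<ominus> y = \<zero> \<longleftrightarrow> x = y"
  using assms minus_equality[of x "\<ominus> y"] by (auto simp: minus_eq r_neg)

lemma smult_0_left [simp]: assumes "x \<in> carrier A" shows "0 \<odot> x = \<zero>"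
proof -
  have "0 \<odot> x \<oplus> 0 \<odot> x = 0 \<odot> x"
    using assms by (simp flip: smult_add_left)
  then show ?thesis
    using assms by (metis add.r_cancel_one' smult_cl)
qed

lemma smult_0_right [simp]: "c \<odot> \<zero> = \<zero>"
  using smult_smult[of \<zero> c 0] by simp

lemma smult_minus_left: assumes "x \<in> carrier A" shows "(- c) \<odot> x = \<ominus> (c \<odot> x)"
proof -
  have "(- c) \<odot> x \<oplus> c \<odot> x = \<zero>"
    using assms by (simp flip: smult_add_left)
  then show ?thesis
    using assms by (metis add.inv_equality smult_cl)
qed

lemma smult_eq_0_iff:
  assumes "x \<in> carrier A" shows "c \<odot> x = \<zero> \<longleftrightarrow> c = 0 \<or> x = \<zero>"
proof -
  have "x = \<zero>" if "c \<odot> x = \<zero>" "c \<noteq> 0"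
  proof -
    have "x = (inverse c * c) \<odot> x"
      using that assms by simp
    also have "\<dots> = inverse c \<odot> (c \<odot> x)"
      using assms by (simp only: smult_smult)
    also have "\<dots> = \<zero>"
      using that by simp
    finally show ?thesis .
  qed
  then show ?thesis
    using assms by auto
qed

lemma smult_minus_right: assumes "x \<in> carrier A" shows "c \<odot> (\<ominus> x) = \<ominus> (c \<odot> x)"
  using assms smult_minus_left[of x 1] smult_minus_left[of x c] smult_smult[of x c "-1"] by simp

end

lemma assoc_algI:
  assumes "abelian_group A" "Group.monoid A"
    and "\<And>x y z. \<lbrakk>x \<in> carrier A; y \<in> carrier A; z \<in> carrier A\<rbrakk> \<Longrightarrow>
      (x \<oplus>\<^bsub>A\<^esub> y) \<otimes>\<^bsub>A\<^esub> z = x \<otimes>\<^bsub>A\<^esub> z \<oplus>\<^bsub>A\<^esub> y \<otimes>\<^bsub>A\<^esub> z"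
    and "\<And>x y z. \<lbrakk>x \<in> carrier A; y \<in> carrier A; z \<in> carrier A\<rbrakk> \<Longrightarrow>
      z \<otimes>\<^bsub>A\<^esub> (x \<oplus>\<^bsub>A\<^esub> y) = z \<otimes>\<^bsub>A\<^esub> x \<oplus>\<^bsub>A\<^esub> z \<otimes>\<^bsub>A\<^esub> y"
    and "\<And>c x. x \<in> carrier A \<Longrightarrow> c \<odot>\<^bsub>A\<^esub> x \<in> carrier A"
    and "\<And>c d x. x \<in> carrier A \<Longrightarrow> (c + d) \<odot>\<^bsub>A\<^esub> x = c \<odot>\<^bsub>A\<^esub> x \<oplus>\<^bsub>A\<^esub> d \<odot>\<^bsub>A\<^esub> x"
    and "\<And>c x y. \<lbrakk>x \<in> carrier A; y \<in> carrier A\<rbrakk> \<Longrightarrow> c \<odot>\<^bsub>A\<^esub> (x \<oplus>\<^bsub>A\<^esub> y) = c \<odot>\<^bsub>A\<^esub> x \<oplus>\<^bsub>A\<^esub> c \<odot>\<^bsub>A\<^esub> y"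
    and "\<And>c d x. x \<in> carrier A \<Longrightarrow> c \<odot>\<^bsub>A\<^esub> (d \<odot>\<^bsub>A\<^esub> x) = (c * d) \<odot>\<^bsub>A\<^esub> x"
    and "\<And>x. x \<in> carrier A \<Longrightarrow> 1 \<odot>\<^bsub>A\<^esub> x = x"
    and "\<And>c x y. \<lbrakk>x \<in> carrier A; y \<in> carrier A\<rbrakk> \<Longrightarrow> (c \<odot>\<^bsub>A\<^esub> x) \<otimes>\<^bsub>A\<^esub> y = c \<odot>\<^bsub>A\<^esub> (x \<otimes>\<^bsub>A\<^esub> y)"
    and "\<And>c x y. \<lbrakk>x \<in> carrier A; y \<in> carrier A\<rbrakk> \<Longrightarrow> x \<otimes>\<^bsub>A\<^esub> (c \<odot>\<^bsub>A\<^esub> y) = c \<odot>\<^bsub>A\<^esub> (x \<otimes>\<^bsub>A\<^esub> y)"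
  shows "assoc_alg A"
  using assms by (intro assoc_alg.intro ringI assoc_alg_axioms.intro)

subsection \<open>Linear combinations\<close>

abbreviation (input) pm_smult :: "'k::field \<Rightarrow> ('i \<Rightarrow>\<^sub>0 'k) \<Rightarrow> ('i \<Rightarrow>\<^sub>0 'k)" where
  "pm_smult c \<equiv> Poly_Mapping.map ((*) c)"

lemma lookup_pm_smult [simp]: "lookup (pm_smult c f) i = c * lookup f i"
  by (simp add: map.rep_eq when_def)

lemma keys_pm_smult: "keys (pm_smult c f) \<subseteq> keys f"
  by (auto simp: in_keys_iff)

text \<open>\<open>update_induct\<close> rephrased with addition, the form in which additive maps
  can be evaluated; the bound \<open>J\<close> on the keys is kept along the induction.\<close>

lemma poly_mapping_add_induct [consumes 1, case_names zero add]:
  assumes "keys f \<subseteq> J" "P 0"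
    and add: "\<And>v c f. \<lbrakk>v \<in> J; keys f \<subseteq> J; P f\<rbrakk> \<Longrightarrow> P (Poly_Mapping.single v c + f)"
  shows "P f"
  using assms(1)
proof (induction f rule: update_induct)
  case const
  show ?case by fact
next
  case (update f v c)
  have e: "Poly_Mapping.update v c f = Poly_Mapping.single v c + f"
    by (rule poly_mapping_eqI)
      (use update(1) in \<open>auto simp: lookup_update lookup_add lookup_single in_keys_iff\<close>)
  have "v \<in> J" and f: "keys f \<subseteq> J"
    using update by (auto simp: keys_update split: if_splits)
  then show ?case
    unfolding e using update.IH[OF f] by (rule add)
qed

context assoc_alg
begin

lemma lin_comb_superset:
  assumes "finite S" "keys c \<subseteq> S" "b \<in> S \<rightarrow> carrier A"
  shows "lin_comb A b c = (\<Oplus>i\<in>S. lookup c i \<odot> b i)"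
  unfolding lin_comb_def
  by (rule add.finprod_mono_neutral_cong_left)
    (use assms in \<open>auto simp: in_keys_iff Pi_iff subset_iff\<close>)

lemma lin_comb_closed [intro]: "b \<in> keys c \<rightarrow> carrier A \<Longrightarrow> lin_comb A b c \<in> carrier A"
  unfolding lin_comb_def by (rule finsum_closed) (auto simp: Pi_iff)

lemma lin_comb_0 [simp]: "lin_comb A b 0 = \<zero>"
  by (simp add: lin_comb_def)

lemma lin_comb_single [simp]:
  assumes "b i \<in> carrier A" shows "lin_comb A b (Poly_Mapping.single i c) = c \<odot> b i"
proof -
  have "lin_comb A b (Poly_Mapping.single i c) = (\<Oplus>j\<in>{i}. lookup (Poly_Mapping.single i c) j \<odot> b j)"
    by (rule lin_comb_superset) (use assms in auto)
  then show ?thesis using assms by simp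
qed

lemma lin_comb_add:
  assumes "b \<in> J \<rightarrow> carrier A" "keys c \<subseteq> J" "keys d \<subseteq> J"
  shows "lin_comb A b (c + d) = lin_comb A b c \<oplus> lin_comb A b d"
proof -
  let ?S = "keys c \<union> keys d"
  have b: "b \<in> ?S \<rightarrow> carrier A"
    using assms by auto
  have k: "keys (c + d) \<subseteq> ?S"
    by (rule keys_add)
  have "lin_comb A b (c + d) = (\<Oplus>i\<in>?S. lookup c i \<odot> b i \<oplus> lookup d i \<odot> b i)"
    unfolding lin_comb_superset[OF _ k b, simplified]
    by (rule finsum_cong') (use b in \<open>auto simp: lookup_add smult_add_left Pi_iff\<close>)
  also have "\<dots> = (\<Oplus>i\<in>?S. lookup c i \<odot> b i) \<oplus> (\<Oplus>i\<in>?S. lookup d i \<odot> b i)"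
    by (rule finsum_addf) (use b in auto)
  also have "\<dots> = lin_comb A b c \<oplus> lin_comb A b d"
    using lin_comb_superset[of ?S c b] lin_comb_superset[of ?S d b] b by simp
  finally show ?thesis .
qed

lemma finsum_smult:
  assumes "finite S" "f \<in> S \<rightarrow> carrier A"
  shows "c \<odot> (\<Oplus>i\<in>S. f i) = (\<Oplus>i\<in>S. c \<odot> f i)"
  using assms by (induction S) (auto simp: smult_add_right Pi_iff)

lemma lin_comb_smult:
  assumes "b \<in> keys c \<rightarrow> carrier A"
  shows "lin_comb A b (pm_smult a c) = a \<odot> lin_comb A b c"
proof -
  have "lin_comb A b (pm_smult a c) = (\<Oplus>i\<in>keys c. a \<odot> (lookup c i \<odot> b i))"
    unfolding lin_comb_superset[OF finite_keys keys_pm_smult assms]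
    by (rule finsum_cong') (use assms in \<open>auto simp: smult_smult Pi_iff\<close>)
  also have "\<dots> = a \<odot> lin_comb A b c"
    unfolding lin_comb_def using assms by (subst finsum_smult) (auto simp: Pi_iff)
  finally show ?thesis .
qed

lemma lin_comb_uminus:
  assumes "b \<in> keys c \<rightarrow> carrier A"
  shows "lin_comb A b (- c) = \<ominus> lin_comb A b c"
proof -
  have "- c = pm_smult (- 1) c"
    by (rule poly_mapping_eqI) simp
  then show ?thesis
    using lin_comb_smult[OF assms, of "- 1"] lin_comb_closed[OF assms] by (simp add: smult_minus_left)
qed

lemma lin_comb_diff:
  assumes "b \<in> J \<rightarrow> carrier A" "keys c \<subseteq> J" "keys d \<subseteq> J"
  shows "lin_comb A b (c - d) = lin_comb A b c \<ominus> lin_comb A b d"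
proof -
  have "b \<in> keys d \<rightarrow> carrier A"
    using assms by auto
  then show ?thesis
    using lin_comb_add[of b J c "- d"] assms by (simp add: lin_comb_uminus minus_eq keys_minus)
qed

lemma lin_comb_cong:
  assumes "\<And>i. i \<in> keys c \<Longrightarrow> b i = b' i" "b' \<in> keys c \<rightarrow> carrier A"
  shows "lin_comb A b c = lin_comb A b' c"
  unfolding lin_comb_def by (rule finsum_cong') (use assms in \<open>auto simp: Pi_iff\<close>)

text \<open>Serves as linear induction: with \<open>H\<close> the set of elements satisfying a
  linear condition, the condition passes from the family to all its combinations.\<close>

lemma lin_comb_mem:
  assumes "b \<in> keys c \<rightarrow> H" "H \<subseteq> carrier A" "\<zero> \<in> H" "\<And>x y. \<lbrakk>x \<in> H; y \<in> H\<rbrakk> \<Longrightarrow> x \<oplus> y \<in> H"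
    "\<And>a x. x \<in> H \<Longrightarrow> a \<odot> x \<in> H"
  shows "lin_comb A b c \<in> H"
proof -
  have "(\<Oplus>i\<in>S. lookup c i \<odot> b i) \<in> H" if "S \<subseteq> keys c" for S
    using finite_subset[OF that finite_keys] that
  proof (induction S)
    case (insert i S)
    then have "(\<Oplus>i\<in>insert i S. lookup c i \<odot> b i) = lookup c i \<odot> b i \<oplus> (\<Oplus>i\<in>S. lookup c i \<odot> b i)"
      by (subst finsum_insert) (use assms in \<open>auto simp: Pi_iff subset_iff\<close>)
    with insert show ?case using assms by (auto simp: Pi_iff)
  qed (use assms in auto)
  then show ?thesis by (simp add: lin_comb_def)
qed

text \<open>Universal property of a monoid algebra: convolution multiplies single terms by adding
  their keys, so a family that is multiplicative on \<open>J\<close> extends to a multiplicative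
  map. Both factors are reduced to single terms by additivity.\<close>

lemma lin_comb_mult:
  fixes b :: "'i::monoid_add \<Rightarrow> 'a"
  assumes b: "b \<in> J \<rightarrow> carrier A" and J: "\<And>u v. \<lbrakk>u \<in> J; v \<in> J\<rbrakk> \<Longrightarrow> u + v \<in> J"
    and bm: "\<And>u v. \<lbrakk>u \<in> J; v \<in> J\<rbrakk> \<Longrightarrow> b (u + v) = b u \<otimes> b v"
    and f: "keys f \<subseteq> J" and g: "keys g \<subseteq> J"
  shows "lin_comb A b (f * g) = lin_comb A b f \<otimes> lin_comb A b g"
proof -
  have clo: "keys (f * g) \<subseteq> J" if "keys f \<subseteq> J" "keys g \<subseteq> J" for f g :: "'i \<Rightarrow>\<^sub>0 'k"
    using keys_mult[of f g] J that by blast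
  have 1: "lin_comb A b (Poly_Mapping.single u a * g) = (a \<odot> b u) \<otimes> lin_comb A b g"
    if u: "u \<in> J" and g: "keys g \<subseteq> J" for u a and g :: "'i \<Rightarrow>\<^sub>0 'k"
    using g
  proof (induction g rule: poly_mapping_add_induct)
    case zero
    have "b u \<in> carrier A" using u b by auto
    then show ?case by simp
  next
    case (add v c g)
    note v = add(1) and g = add(2)
    have s: "keys (Poly_Mapping.single u a) \<subseteq> J" "keys (Poly_Mapping.single v c) \<subseteq> J"
      "keys (Poly_Mapping.single (u+v) (a*c)) \<subseteq> J"
      using u v J by auto
    have bc: "b u \<in> carrier A" "b v \<in> carrier A" "b (u + v) \<in> carrier A" "b \<in> keys g \<rightarrow> carrier A"
      using b u v J g by auto
    have "lin_comb A b (Poly_Mapping.single u a * (Poly_Mapping.single v c + g)) =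
      lin_comb A b (Poly_Mapping.single (u + v) (a * c) + Poly_Mapping.single u a * g)"
      by (simp add: ring_distribs mult_single)
    also have "\<dots> = (a * c) \<odot> b (u + v) \<oplus> (a \<odot> b u) \<otimes> lin_comb A b g"
      using lin_comb_add[OF b s(3) clo[OF s(1) g]] add bc by simp
    also have "\<dots> = (a \<odot> b u) \<otimes> (c \<odot> b v \<oplus> lin_comb A b g)"
      using bc bm[OF u v]
      by (simp add: r_distr lin_comb_closed smult_mult_left smult_mult_right smult_smult mult.commute[of c a])
    also have "c \<odot> b v \<oplus> lin_comb A b g = lin_comb A b (Poly_Mapping.single v c + g)"
      using lin_comb_add[OF b s(2) g] bc by simp
    finally show ?case .
  qed
  show ?thesis
    using f
  proof (induction f rule: poly_mapping_add_induct)
    case zero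
    have "lin_comb A b g \<in> carrier A" using b g by auto
    then show ?case by simp
  next
    case (add v c f)
    note v = add(1) and f = add(2)
    have s: "keys (Poly_Mapping.single v c) \<subseteq> J" using v by auto
    have bc: "b v \<in> carrier A" "b \<in> keys f \<rightarrow> carrier A" "b \<in> keys g \<rightarrow> carrier A"
      using b v g f by auto
    have "lin_comb A b ((Poly_Mapping.single v c + f) * g) =
        (c \<odot> b v) \<otimes> lin_comb A b g \<oplus> lin_comb A b f \<otimes> lin_comb A b g"
      using lin_comb_add[OF b clo[OF s g] clo[OF f g]] 1[OF v g] add by (simp add: ring_distribs)
    also have "\<dots> = (c \<odot> b v \<oplus> lin_comb A b f) \<otimes> lin_comb A b g"
      using bc by (simp add: l_distr lin_comb_closed)
    also have "c \<odot> b v \<oplus> lin_comb A b f = lin_comb A b (Poly_Mapping.single v c + f)"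
      using lin_comb_add[OF b s f] bc by simp
    finally show ?case .
  qed
qed

end

subsection \<open>Homomorphisms and quotients\<close>

definition algebra_hom :: "('k::field, 'a) module \<Rightarrow> ('k, 'b) module \<Rightarrow> ('a \<Rightarrow> 'b) set" where
  "algebra_hom A B = {h \<in> ring_hom A B. \<forall>c. \<forall>a\<in>carrier A. h (c \<odot>\<^bsub>A\<^esub> a) = c \<odot>\<^bsub>B\<^esub> h a}"

lemma algebra_homI:
  assumes "\<And>x. x \<in> carrier A \<Longrightarrow> h x \<in> carrier B"
    "\<And>x y. \<lbrakk>x \<in> carrier A; y \<in> carrier A\<rbrakk> \<Longrightarrow> h (x \<otimes>\<^bsub>A\<^esub> y) = h x \<otimes>\<^bsub>B\<^esub> h y"
    "\<And>x y. \<lbrakk>x \<in> carrier A; y \<in> carrier A\<rbrakk> \<Longrightarrow> h (x \<oplus>\<^bsub>A\<^esub> y) = h x \<oplus>\<^bsub>B\<^esub> h y"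
    "h \<one>\<^bsub>A\<^esub> = \<one>\<^bsub>B\<^esub>" "\<And>c x. x \<in> carrier A \<Longrightarrow> h (c \<odot>\<^bsub>A\<^esub> x) = c \<odot>\<^bsub>B\<^esub> h x"
  shows "h \<in> algebra_hom A B"
  using assms by (auto simp: algebra_hom_def intro: ring_hom_memI)

lemma algebra_homD:
  assumes "h \<in> algebra_hom A B"
  shows "x \<in> carrier A \<Longrightarrow> h x \<in> carrier B"
    "\<lbrakk>x \<in> carrier A; y \<in> carrier A\<rbrakk> \<Longrightarrow> h (x \<otimes>\<^bsub>A\<^esub> y) = h x \<otimes>\<^bsub>B\<^esub> h y"
    "\<lbrakk>x \<in> carrier A; y \<in> carrier A\<rbrakk> \<Longrightarrow> h (x \<oplus>\<^bsub>A\<^esub> y) = h x \<oplus>\<^bsub>B\<^esub> h y"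
    "h \<one>\<^bsub>A\<^esub> = \<one>\<^bsub>B\<^esub>" "x \<in> carrier A \<Longrightarrow> h (c \<odot>\<^bsub>A\<^esub> x) = c \<odot>\<^bsub>B\<^esub> h x"
  using assms by (auto simp: algebra_hom_def ring_hom_closed ring_hom_mult ring_hom_add ring_hom_one)

lemma algebra_hom_comp:
  "\<lbrakk>h \<in> algebra_hom A B; g \<in> algebra_hom B C\<rbrakk> \<Longrightarrow> (\<lambda>x. g (h x)) \<in> algebra_hom A C"
  by (rule algebra_homI) (simp_all add: algebra_homD)

locale alg_hom = A: assoc_alg A + B: assoc_alg B
  for A :: "('k::field, 'a) module" and B :: "('k, 'b) module" and h +
  assumes hom: "h \<in> algebra_hom A B"
begin

lemmas closed [simp, intro] = algebra_homD(1)[OF hom]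
lemmas mult = algebra_homD(2)[OF hom]
lemmas add = algebra_homD(3)[OF hom]
lemmas one [simp] = algebra_homD(4)[OF hom]
lemmas smult = algebra_homD(5)[OF hom]

lemma zero [simp]: "h \<zero>\<^bsub>A\<^esub> = \<zero>\<^bsub>B\<^esub>"
  using smult[of "\<zero>\<^bsub>A\<^esub>" 0] by simp

lemma uminus: "x \<in> carrier A \<Longrightarrow> h (\<ominus>\<^bsub>A\<^esub> x) = \<ominus>\<^bsub>B\<^esub> h x"
  using smult[of x "- 1"] by (simp add: A.smult_minus_left B.smult_minus_left)

lemma minus: "\<lbrakk>x \<in> carrier A; y \<in> carrier A\<rbrakk> \<Longrightarrow> h (x \<ominus>\<^bsub>A\<^esub> y) = h x \<ominus>\<^bsub>B\<^esub> h y"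
  by (simp add: A.minus_eq B.minus_eq add uminus)

lemma finsum:
  assumes "finite S" "f \<in> S \<rightarrow> carrier A" shows "h (\<Oplus>\<^bsub>A\<^esub>i\<in>S. f i) = (\<Oplus>\<^bsub>B\<^esub>i\<in>S. h (f i))"
  using assms by (induction S) (auto simp: Pi_iff add)

lemma pow: "x \<in> carrier A \<Longrightarrow> h (x [^]\<^bsub>A\<^esub> (n::nat)) = h x [^]\<^bsub>B\<^esub> n"
  by (induction n) (auto simp: mult)

lemma lin_comb:
  assumes "b \<in> keys c \<rightarrow> carrier A" shows "h (lin_comb A b c) = lin_comb B (\<lambda>i. h (b i)) c"
proof -
  have "h (lin_comb A b c) = (\<Oplus>\<^bsub>B\<^esub>i\<in>keys c. h (lookup c i \<odot>\<^bsub>A\<^esub> b i))"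
    unfolding lin_comb_def by (rule finsum) (use assms in \<open>auto simp: Pi_iff\<close>)
  also have "\<dots> = lin_comb B (\<lambda>i. h (b i)) c"
    unfolding lin_comb_def by (rule B.finsum_cong') (use assms in \<open>auto simp: Pi_iff smult\<close>)
  finally show ?thesis .
qed

end

lemma alg_homI: "\<lbrakk>assoc_alg A; assoc_alg B; h \<in> algebra_hom A B\<rbrakk> \<Longrightarrow> alg_hom A B h"
  by (intro alg_hom.intro alg_hom_axioms.intro)

lemma is_algebra_isoI:
  "\<lbrakk>h \<in> algebra_hom A B; bij_betw h (carrier A) (carrier B)\<rbrakk> \<Longrightarrow> A \<cong>\<^sub>a B"
  by (auto simp: is_algebra_iso_def algebra_iso_def algebra_hom_def ring_iso_def)

lemma quotient_algebra_simps [simp]: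
  "carrier (quotient_algebra A I) = a_rcosets\<^bsub>A\<^esub> I"
  "mult (quotient_algebra A I) = rcoset_mult A I"
  "one (quotient_algebra A I) = I +>\<^bsub>A\<^esub> \<one>\<^bsub>A\<^esub>"
  "zero (quotient_algebra A I) = I"
  "add (quotient_algebra A I) = set_add A"
  "smult (quotient_algebra A I) = (\<lambda>c C. \<Union>a\<in>C. I +>\<^bsub>A\<^esub> (c \<odot>\<^bsub>A\<^esub> a))"
  by (simp_all add: quotient_algebra_def FactRing_def ring.defs module.defs)

locale alg_ideal = assoc_alg A + ideal I A for A :: "('k::field, 'a) module" (structure) and I
begin

abbreviation "Q \<equiv> quotient_algebra A I"

lemma coset_eq_iff: "\<lbrakk>x \<in> carrier A; y \<in> carrier A\<rbrakk> \<Longrightarrow> I +> x = I +> y \<longleftrightarrow> x \<ominus> y \<in> I"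
  using quotient_eq_iff_same_a_r_cos[OF ideal_axioms] by simp

text \<open>Since \<open>c \<odot> x\<close> is the product of \<open>c \<odot> \<one>\<close> and
  \<open>x\<close>, ring ideals need no separate closure under scalars.\<close>

lemma smult_mem: assumes "x \<in> I" shows "c \<odot> x \<in> I"
proof -
  have "c \<odot> x = (c \<odot> \<one>) \<otimes> x"
    using assms Icarr[of x] by (simp add: smult_mult_left)
  then show ?thesis
    using assms I_l_closed by simp
qed

text \<open>The union in the definition runs over all representatives; they all give the same coset,
  since \<open>I\<close> is closed under scalars.\<close>

lemma quotient_smult:
  assumes x: "x \<in> carrier A" shows "c \<odot>\<^bsub>Q\<^esub> (I +> x) = I +> (c \<odot> x)"
proof -
  have const: "I +> (c \<odot> a) = I +> (c \<odot> x)" if a: "a \<in> I +> x" for a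
  proof -
    have ac: "a \<in> carrier A"
      using a x a_r_coset_subset_G[OF a_subset x] by auto
    have "I +> a = I +> x"
      using a_repr_independence'[OF a x] by simp
    then have "a \<ominus> x \<in> I"
      using coset_eq_iff ac x by simp
    then have "c \<odot> (a \<ominus> x) \<in> I"
      by (rule smult_mem)
    moreover have "c \<odot> (a \<ominus> x) = c \<odot> a \<ominus> c \<odot> x"
      using ac x by (simp add: minus_eq smult_add_right smult_minus_right)
    ultimately show ?thesis
      using coset_eq_iff ac x by simp
  qed
  show ?thesis
    unfolding quotient_algebra_simps using a_rcos_self[OF x] const by (intro UN_constant_eq ballI)
qed

lemma quotient_carrier: "carrier Q = (\<lambda>x. I +> x) ` carrier A"
  by (auto simp: A_RCOSETS_def')

lemma quotient_mult:
  "\<lbrakk>x \<in> carrier A; y \<in> carrier A\<rbrakk> \<Longrightarrow> (I +> x) \<otimes>\<^bsub>Q\<^esub> (I +> y) = I +> (x \<otimes> y)"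
  by (simp add: rcoset_mult_add)

lemma quotient_add:
  "\<lbrakk>x \<in> carrier A; y \<in> carrier A\<rbrakk> \<Longrightarrow> (I +> x) \<oplus>\<^bsub>Q\<^esub> (I +> y) = I +> (x \<oplus> y)"
  by (simp add: a_rcos_sum)

lemma quotient_assoc_alg: "assoc_alg Q"
proof -
  have z: "\<zero>\<^bsub>Q\<^esub> = I +> \<zero>"
    using a_coset_add_zero[OF a_subset] by simp
  note rules = quotient_carrier quotient_smult quotient_mult quotient_add z
  have "abelian_group Q"
  proof (rule abelian_groupI)
    show "\<exists>y\<in>carrier Q. y \<oplus>\<^bsub>Q\<^esub> x = \<zero>\<^bsub>Q\<^esub>" if x: "x \<in> carrier Q" for x
    proof -
      obtain a where a: "a \<in> carrier A" "x = I +> a"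
        using x unfolding quotient_carrier by blast
      then have "(I +> \<ominus> a) \<oplus>\<^bsub>Q\<^esub> x = \<zero>\<^bsub>Q\<^esub>"
        unfolding z by (simp add: quotient_add l_neg del: quotient_algebra_simps)
      moreover have "I +> \<ominus> a \<in> carrier Q"
        unfolding quotient_carrier using a by blast
      ultimately show ?thesis by blast
    qed
  qed (auto simp: rules a_ac simp del: quotient_algebra_simps)
  moreover have "Group.monoid Q"
    by (rule Group.monoidI) (auto simp: quotient_carrier quotient_mult m_assoc
      simp del: quotient_algebra_simps(1,2,4-6))
  ultimately have t: "ring Q"
    by (rule ringI)
      (auto simp: rules l_distr r_distr simp del: quotient_algebra_simps)
  have ax: "assoc_alg_axioms Q"
    by (rule assoc_alg_axioms.intro; unfold quotient_carrier; elim imageE; hypsubst;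
        simp only: quotient_smult quotient_mult quotient_add smult_cl m_closed add.m_closed smult_add_left
          smult_add_right smult_smult smult_mult_left smult_mult_right smult_1 imageI)
  show ?thesis
    using t ax by (rule assoc_alg.intro)
qed

lemma quotient_hom: "(\<lambda>x. I +> x) \<in> algebra_hom A Q"
  by (rule algebra_homI)
    (simp_all only: quotient_carrier quotient_smult quotient_mult quotient_add imageI
      quotient_algebra_simps(3))

lemma quotient_zero: "x \<in> I \<Longrightarrow> I +> x = \<zero>\<^bsub>Q\<^esub>"
  using coset_eq_iff[of x \<zero>] a_coset_add_zero[OF a_subset] Icarr[of x] by (simp add: minus_eq)

lemma quotient_of_zero: "I +> \<zero> = \<zero>\<^bsub>Q\<^esub>"
  using a_coset_add_zero[OF a_subset] by simp

lemma quotient_lift: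
  assumes B: "assoc_alg B" and h: "h \<in> algebra_hom A B" and I: "\<And>x. x \<in> I \<Longrightarrow> h x = \<zero>\<^bsub>B\<^esub>"
  shows "\<exists>g\<in>algebra_hom Q B. \<forall>x\<in>carrier A. g (I +> x) = h x"
proof -
  interpret h: alg_hom A B h
    using assoc_alg_axioms B h by (rule alg_homI)
  \<comment> \<open>The choice of the representative is harmless: two of them differ by an element
    of \<open>I\<close>, on which \<open>h\<close> vanishes.\<close>
  define g where "g C = h (SOME x. x \<in> carrier A \<and> C = I +> x)" for C
  have g: "g (I +> x) = h x" if x: "x \<in> carrier A" for x
  proof -
    define y where "y = (SOME y. y \<in> carrier A \<and> I +> x = I +> y)"
    have "y \<in> carrier A \<and> I +> x = I +> y"
      unfolding y_def by (rule someI[of _ x], rule conjI[OF x refl])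
    then have y: "y \<in> carrier A" and xy: "I +> x = I +> y"
      by (rule conjunct1, rule conjunct2)
    have "h (x \<ominus> y) = \<zero>\<^bsub>B\<^esub>"
      by (rule I, rule iffD1[OF coset_eq_iff[OF x y] xy])
    then have "h x = h y"
      unfolding h.minus[OF x y] h.B.minus_eq_0_iff[OF h.closed[OF x] h.closed[OF y]] .
    then show ?thesis
      by (simp only: g_def y_def[symmetric])
  qed
  have "g \<in> algebra_hom Q B"
    by (rule algebra_homI; (unfold quotient_carrier, elim imageE, hypsubst)?;
      simp only: quotient_smult quotient_mult quotient_add quotient_algebra_simps(3) g h.mult h.add
        h.smult h.closed h.one m_closed add.m_closed smult_cl one_closed)
  with g show ?thesis by (intro bexI[of _ g]) simp_all
qed

end

lemma (in alg_hom) kernel_ideal: "ideal {x \<in> carrier A. h x = \<zero>\<^bsub>B\<^esub>} A"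
proof (rule idealI[OF A.ring_axioms])
  show "subgroup {x \<in> carrier A. h x = \<zero>\<^bsub>B\<^esub>} (add_monoid A)"
    by (rule A.add.subgroupI)
      (auto simp: add uminus intro: exI[of _ "\<zero>\<^bsub>A\<^esub>"] simp flip: a_inv_def)
qed (auto simp: mult)

text \<open>The kernel is an ideal containing \<open>S\<close>, hence contains the generated ideal.
  Vanishing on the ideals that define U(L) is checked on generators through this.\<close>

lemma (in alg_hom) genideal_kernel:
  assumes "S \<subseteq> carrier A" "\<And>x. x \<in> S \<Longrightarrow> h x = \<zero>\<^bsub>B\<^esub>" "x \<in> Idl\<^bsub>A\<^esub> S"
  shows "h x = \<zero>\<^bsub>B\<^esub>"
  using A.genideal_minimal[OF kernel_ideal, of S] assms by auto

subsection \<open>The free algebra\<close>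

lemma free_algebra_simps [simp]:
  "carrier (free_algebra V) = {f. keys f \<subseteq> lists V}"
  "mult (free_algebra V) = (*)" "one (free_algebra V) = 1" "zero (free_algebra V) = 0"
  "add (free_algebra V) = (+)" "smult (free_algebra V) = pm_smult"
  by (simp_all add: free_algebra_def)

lemma keys_mult_lists:
  fixes f g :: "'v list \<Rightarrow>\<^sub>0 'k::field"
  assumes "keys f \<subseteq> lists V" "keys g \<subseteq> lists V" shows "keys (f * g) \<subseteq> lists V"
proof
  fix w assume "w \<in> keys (f * g)"
  then obtain u v where "u \<in> keys f" "v \<in> keys g" "w = u + v"
    using keys_mult[of f g] by blast
  then show "w \<in> lists V"
    using assms by (auto simp: plus_list_def)
qed

lemma pm_smult_conv: "pm_smult c f = Poly_Mapping.single 0 c * f"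
  by (rule mult_map_scale_conv_mult)

lemma free_algebra_assoc_alg: "assoc_alg (free_algebra V)"
proof (rule assoc_algI)
  show "abelian_group (free_algebra V)"
  proof (rule abelian_groupI)
    show "\<exists>y\<in>carrier (free_algebra V). y \<oplus>\<^bsub>free_algebra V\<^esub> x = \<zero>\<^bsub>free_algebra V\<^esub>"
      if "x \<in> carrier (free_algebra V)" for x
      by (rule bexI[of _ "- x"]) (use that in \<open>auto simp: keys_minus\<close>)
  qed (use keys_add in \<open>fastforce simp: ac_simps\<close>)+
  show "Group.monoid (free_algebra V)"
    by (rule Group.monoidI) (auto simp: keys_mult_lists mult.assoc zero_list_def)
next
  fix c :: 'b and x :: "'a list \<Rightarrow>\<^sub>0 'b"
  assume "x \<in> carrier (free_algebra V)"
  then show "c \<odot>\<^bsub>free_algebra V\<^esub> x \<in> carrier (free_algebra V)"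
    using keys_pm_smult[of c x] by auto
next
  fix c :: 'b and x y :: "'a list \<Rightarrow>\<^sub>0 'b"
  show "x \<otimes>\<^bsub>free_algebra V\<^esub> (c \<odot>\<^bsub>free_algebra V\<^esub> y) = c \<odot>\<^bsub>free_algebra V\<^esub> (x \<otimes>\<^bsub>free_algebra V\<^esub> y)"
  proof -
    have "x * Poly_Mapping.single 0 c = Poly_Mapping.single 0 c * x"
      using subset_UNIV
    proof (induction x rule: poly_mapping_add_induct)
      case (add v a f)
      then show ?case by (simp add: ring_distribs mult_single mult.commute)
    qed simp
    then show ?thesis
      by (simp add: pm_smult_conv flip: mult.assoc)
  qed
next
  fix c :: 'b and x y :: "'a list \<Rightarrow>\<^sub>0 'b"
  show "(c \<odot>\<^bsub>free_algebra V\<^esub> x) \<otimes>\<^bsub>free_algebra V\<^esub> y = c \<odot>\<^bsub>free_algebra V\<^esub> (x \<otimes>\<^bsub>free_algebra V\<^esub> y)"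
    by (simp add: pm_smult_conv mult.assoc)
qed (auto simp: ring_distribs poly_mapping_eq_iff lookup_add fun_eq_iff)

definition word_prod :: "('k::field, 'a) module \<Rightarrow> ('v \<Rightarrow> 'a) \<Rightarrow> 'v list \<Rightarrow> 'a" where
  "word_prod A f w = foldr (\<lambda>x u. f x \<otimes>\<^bsub>A\<^esub> u) w \<one>\<^bsub>A\<^esub>"

context assoc_alg
begin

lemma word_prod_closed: "\<lbrakk>f \<in> V \<rightarrow> carrier A; w \<in> lists V\<rbrakk> \<Longrightarrow> word_prod A f w \<in> carrier A"
  by (induction w) (auto simp: word_prod_def Pi_iff)

lemma word_prod_append:
  "\<lbrakk>f \<in> V \<rightarrow> carrier A; v \<in> lists V; w \<in> lists V\<rbrakk> \<Longrightarrow>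
    word_prod A f (v @ w) = word_prod A f v \<otimes> word_prod A f w"
  using word_prod_closed[of f V]
  by (induction v) (auto simp: word_prod_def Pi_iff m_assoc)

text \<open>The lift is \<open>lin_comb\<close> over the products of letters along a word; these are
  multiplicative for concatenation, which is the addition of the list monoid.\<close>

lemma free_algebra_lift:
  assumes f: "f \<in> V \<rightarrow> carrier A"
  shows "\<exists>h\<in>algebra_hom (free_algebra V) A. \<forall>x\<in>V. h (Poly_Mapping.single [x] 1) = f x"
proof (intro bexI ballI)
  let ?b = "word_prod A f"
  have b: "?b \<in> lists V \<rightarrow> carrier A"
    using word_prod_closed[OF f] by auto
  show "lin_comb A ?b (Poly_Mapping.single [x] 1) = f x" if "x \<in> V" for x
    using f that by (subst lin_comb_single) (auto simp: word_prod_def Pi_iff)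
  show "lin_comb A ?b \<in> algebra_hom (free_algebra V) A"
  proof (rule algebra_homI)
    have "lin_comb A ?b (Poly_Mapping.single [] 1) = \<one>"
      by (subst lin_comb_single) (auto simp: word_prod_def)
    then show "lin_comb A ?b \<one>\<^bsub>free_algebra V\<^esub> = \<one>"
      by (simp add: zero_list_def flip: single_one)
  qed (use b f in \<open>auto intro!: lin_comb_closed lin_comb_add[OF b] lin_comb_smult
    lin_comb_mult[OF b] word_prod_append simp: plus_list_def Pi_iff subset_iff\<close>)
qed

end

subsection \<open>The universal enveloping algebra\<close>

context lie_color_algebra
begin

abbreviation "\<F> \<equiv> free_algebra L :: ('k, 'v list \<Rightarrow>\<^sub>0 'k) module"
abbreviation "\<T> \<equiv> tensor_algebra scale L"
abbreviation "\<U> \<equiv> uea scale \<epsilon> L gr br"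
abbreviation "\<iota> \<equiv> uea_incl scale \<epsilon> L gr br"

lemma subspace_L: "subspace L"
  unfolding span_gr[symmetric] by (rule subspace_span)

lemma gr_L: "x \<in> gr g \<Longrightarrow> x \<in> L"
  unfolding span_gr[symmetric] by (rule span_base) blast

lemma br_L: "\<lbrakk>x \<in> gr g; y \<in> gr h\<rbrakk> \<Longrightarrow> br x y \<in> L"
  using br_graded gr_L by blast

definition lin_rels :: "('v list \<Rightarrow>\<^sub>0 'k) set" where
  "lin_rels = {Poly_Mapping.single [x + y] 1 - Poly_Mapping.single [x] 1 - Poly_Mapping.single [y] 1
          | x y. x \<in> L \<and> y \<in> L} \<union>
        {Poly_Mapping.single [scale c x] 1 - Poly_Mapping.single [x] c | c x. x \<in> L}"

lemma lin_rels_carrier: "lin_rels \<subseteq> carrier \<F>"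
proof
  have single: "keys (Poly_Mapping.single [x] c :: 'v list \<Rightarrow>\<^sub>0 'k) \<subseteq> lists L" if "x \<in> L" for x c
    using that by simp
  have diff: "keys (f - g) \<subseteq> lists L" if "keys f \<subseteq> lists L" "keys g \<subseteq> lists L"
    for f g :: "'v list \<Rightarrow>\<^sub>0 'k"
    using that keys_diff[of f g] by blast
  fix f assume "f \<in> lin_rels"
  then consider x y where "x \<in> L" "y \<in> L"
      "f = Poly_Mapping.single [x + y] 1 - Poly_Mapping.single [x] 1 - Poly_Mapping.single [y] 1"
    | c x where "x \<in> L" "f = Poly_Mapping.single [scale c x] 1 - Poly_Mapping.single [x] c"
    unfolding lin_rels_def by blast
  then have "keys f \<subseteq> lists L"
    by cases (simp_all only: diff single subspace_add[OF subspace_L] subspace_scale[OF subspace_L])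
  then show "f \<in> carrier \<F>"
    by simp
qed

lemma linearity_ideal_eq: "linearity_ideal scale L = Idl\<^bsub>\<F>\<^esub> lin_rels"
  by (simp add: linearity_ideal_def lin_rels_def)

lemma alg_ideal_lin: "alg_ideal \<F> (linearity_ideal scale L)"
proof -
  interpret F: assoc_alg \<F> by (rule free_algebra_assoc_alg)
  have "ideal (linearity_ideal scale L) \<F>"
    unfolding linearity_ideal_eq by (rule F.genideal_ideal[OF lin_rels_carrier])
  then show "alg_ideal \<F> (linearity_ideal scale L)"
    by (intro alg_ideal.intro F.assoc_alg_axioms)
qed

lemma tensor_eq: "\<T> = quotient_algebra \<F> (linearity_ideal scale L)"
  by (simp add: tensor_algebra_def)

lemma tensor_assoc_alg: "assoc_alg \<T>"
  unfolding tensor_eq by (rule alg_ideal.quotient_assoc_alg[OF alg_ideal_lin])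

lemma tensor_incl_closed: "x \<in> L \<Longrightarrow> tensor_incl scale L x \<in> carrier \<T>"
  unfolding tensor_eq alg_ideal.quotient_carrier[OF alg_ideal_lin] tensor_incl_def by (rule imageI) simp

definition uea_rels :: "('v list \<Rightarrow>\<^sub>0 'k) set set" where
  "uea_rels = {(tensor_incl scale L x \<otimes>\<^bsub>\<T>\<^esub> tensor_incl scale L y)
     \<ominus>\<^bsub>\<T>\<^esub> (\<epsilon> g h \<odot>\<^bsub>\<T>\<^esub> (tensor_incl scale L y \<otimes>\<^bsub>\<T>\<^esub> tensor_incl scale L x))
     \<ominus>\<^bsub>\<T>\<^esub> tensor_incl scale L (br x y) | x y g h. x \<in> gr g \<and> y \<in> gr h}"

lemma uea_rels_carrier: "uea_rels \<subseteq> carrier \<T>"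
proof -
  interpret T: assoc_alg \<T> by (rule tensor_assoc_alg)
  show ?thesis
    by (auto simp only: uea_rels_def
      intro!: T.minus_closed T.m_closed T.smult_cl tensor_incl_closed intro: br_L gr_L)
qed

lemma uea_ideal_eq: "uea_ideal scale \<epsilon> L gr br = Idl\<^bsub>\<T>\<^esub> uea_rels"
  by (simp only: uea_ideal_def uea_rels_def Let_def)

lemma alg_ideal_uea: "alg_ideal \<T> (uea_ideal scale \<epsilon> L gr br)"
proof -
  interpret T: assoc_alg \<T> by (rule tensor_assoc_alg)
  have "ideal (uea_ideal scale \<epsilon> L gr br) \<T>"
    unfolding uea_ideal_eq by (rule T.genideal_ideal[OF uea_rels_carrier])
  then show "alg_ideal \<T> (uea_ideal scale \<epsilon> L gr br)"
    by (intro alg_ideal.intro T.assoc_alg_axioms)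
qed

lemma uea_eq: "\<U> = quotient_algebra \<T> (uea_ideal scale \<epsilon> L gr br)"
  by (simp only: uea_def)

lemma uea_assoc_alg: "assoc_alg \<U>"
  unfolding uea_eq by (rule alg_ideal.quotient_assoc_alg[OF alg_ideal_uea])

lemma uea_incl_closed: "x \<in> L \<Longrightarrow> \<iota> x \<in> carrier \<U>"
  unfolding uea_eq alg_ideal.quotient_carrier[OF alg_ideal_uea] uea_incl_def by (rule imageI) (rule tensor_incl_closed)

text \<open>U(L) is a quotient of a quotient; the composite projection allows its elements to be
  handled as polynomials in words instead of cosets of cosets.\<close>

definition free_proj :: "('v list \<Rightarrow>\<^sub>0 'k) \<Rightarrow> ('v list \<Rightarrow>\<^sub>0 'k) set set" where
  "free_proj f = uea_ideal scale \<epsilon> L gr br +>\<^bsub>\<T>\<^esub> (linearity_ideal scale L +>\<^bsub>\<F>\<^esub> f)"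

lemma free_proj_hom: "free_proj \<in> algebra_hom \<F> \<U>"
  unfolding free_proj_def[abs_def] uea_eq
  by (rule algebra_hom_comp[OF alg_ideal.quotient_hom[OF alg_ideal_lin, folded tensor_eq]
        alg_ideal.quotient_hom[OF alg_ideal_uea]])

lemma alg_hom_free_proj: "alg_hom \<F> \<U> free_proj"
  by (rule alg_homI[OF free_algebra_assoc_alg uea_assoc_alg free_proj_hom])

lemma free_proj_single: "free_proj (Poly_Mapping.single [x] 1) = \<iota> x"
  by (simp only: free_proj_def uea_incl_def tensor_incl_def)

lemma free_proj_surj: "carrier \<U> = free_proj ` carrier \<F>"
proof -
  have "carrier \<T> = (\<lambda>f. linearity_ideal scale L +>\<^bsub>\<F>\<^esub> f) ` carrier \<F>"
    unfolding tensor_eq by (rule alg_ideal.quotient_carrier[OF alg_ideal_lin])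
  then show ?thesis
    unfolding uea_eq alg_ideal.quotient_carrier[OF alg_ideal_uea] free_proj_def
    by (simp only: image_image)
qed

lemma lin_rels_zero:
  assumes "f \<in> lin_rels" shows "linearity_ideal scale L +>\<^bsub>\<F>\<^esub> f = \<zero>\<^bsub>\<T>\<^esub>"
proof -
  interpret F: assoc_alg \<F> by (rule free_algebra_assoc_alg)
  have "f \<in> linearity_ideal scale L"
    using F.genideal_self[OF lin_rels_carrier] assms by (auto simp only: linearity_ideal_eq)
  then show ?thesis
    unfolding tensor_eq by (rule alg_ideal.quotient_zero[OF alg_ideal_lin])
qed

lemma uea_incl_add: "\<lbrakk>x \<in> L; y \<in> L\<rbrakk> \<Longrightarrow> \<iota> (x + y) = \<iota> x \<oplus>\<^bsub>\<U>\<^esub> \<iota> y"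
proof -
  assume xy: "x \<in> L" "y \<in> L"
  interpret \<pi>: alg_hom \<F> \<U> free_proj by (rule alg_hom_free_proj)
  let ?s = "\<lambda>z. Poly_Mapping.single [z] 1 :: 'v list \<Rightarrow>\<^sub>0 'k"
  have l: "?s (x + y) - ?s x - ?s y \<in> lin_rels"
    using xy unfolding lin_rels_def by blast
  note r = lin_rels_zero[OF l]
  have c: "?s x \<in> carrier \<F>" "?s y \<in> carrier \<F>"
    using xy by auto
  note c = c subsetD[OF lin_rels_carrier l]
  have "free_proj (?s (x + y) - ?s x - ?s y) = \<zero>\<^bsub>\<U>\<^esub>"
    unfolding free_proj_def r uea_eq
    by (rule alg_ideal.quotient_of_zero[OF alg_ideal_uea])
  moreover have "?s (x + y) = (?s x \<oplus>\<^bsub>\<F>\<^esub> ?s y) \<oplus>\<^bsub>\<F>\<^esub> (?s (x + y) - ?s x - ?s y)"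
    by simp
  ultimately show ?thesis
    unfolding free_proj_single[symmetric] using c \<pi>.add by (metis \<pi>.A.add.m_closed \<pi>.B.r_zero \<pi>.closed)
qed

lemma uea_incl_scale: "x \<in> L \<Longrightarrow> \<iota> (scale c x) = c \<odot>\<^bsub>\<U>\<^esub> \<iota> x"
proof -
  assume x: "x \<in> L"
  interpret \<pi>: alg_hom \<F> \<U> free_proj by (rule alg_hom_free_proj)
  let ?s = "\<lambda>z. Poly_Mapping.single [z] 1 :: 'v list \<Rightarrow>\<^sub>0 'k"
  have l: "?s (scale c x) - Poly_Mapping.single [x] c \<in> lin_rels"
    using x unfolding lin_rels_def by blast
  have c: "?s x \<in> carrier \<F>"
    using x by auto
  note c = c subsetD[OF lin_rels_carrier l]
  have "free_proj (?s (scale c x) - Poly_Mapping.single [x] c) = \<zero>\<^bsub>\<U>\<^esub>"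
    unfolding free_proj_def lin_rels_zero[OF l] uea_eq
    by (rule alg_ideal.quotient_of_zero[OF alg_ideal_uea])
  moreover have "?s (scale c x) = (c \<odot>\<^bsub>\<F>\<^esub> ?s x) \<oplus>\<^bsub>\<F>\<^esub> (?s (scale c x) - Poly_Mapping.single [x] c)"
    by simp
  ultimately show ?thesis
    unfolding free_proj_single[symmetric] using c \<pi>.add \<pi>.smult
    by (metis \<pi>.A.smult_cl \<pi>.B.r_zero \<pi>.closed)
qed

lemma uea_rel:
  assumes "x \<in> gr g" "y \<in> gr h"
  shows "\<iota> x \<otimes>\<^bsub>\<U>\<^esub> \<iota> y = \<epsilon> g h \<odot>\<^bsub>\<U>\<^esub> (\<iota> y \<otimes>\<^bsub>\<U>\<^esub> \<iota> x) \<oplus>\<^bsub>\<U>\<^esub> \<iota> (br x y)"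
proof -
  interpret T: assoc_alg \<T> by (rule tensor_assoc_alg)
  interpret U: assoc_alg \<U> by (rule uea_assoc_alg)
  interpret p: alg_hom \<T> \<U> "\<lambda>x. uea_ideal scale \<epsilon> L gr br +>\<^bsub>\<T>\<^esub> x"
    unfolding uea_eq
    by (rule alg_homI[OF tensor_assoc_alg alg_ideal.quotient_assoc_alg[OF alg_ideal_uea]
          alg_ideal.quotient_hom[OF alg_ideal_uea]])
  let ?t = "tensor_incl scale L"
  have c: "?t x \<in> carrier \<T>" "?t y \<in> carrier \<T>" "?t (br x y) \<in> carrier \<T>"
    and c': "\<iota> x \<in> carrier \<U>" "\<iota> y \<in> carrier \<U>" "\<iota> (br x y) \<in> carrier \<U>"
    using assms gr_L br_L by (blast intro: tensor_incl_closed uea_incl_closed)+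
  let ?r = "?t x \<otimes>\<^bsub>\<T>\<^esub> ?t y \<ominus>\<^bsub>\<T>\<^esub> \<epsilon> g h \<odot>\<^bsub>\<T>\<^esub> (?t y \<otimes>\<^bsub>\<T>\<^esub> ?t x) \<ominus>\<^bsub>\<T>\<^esub> ?t (br x y)"
  have "?r \<in> uea_rels"
    using assms unfolding uea_rels_def by blast
  then have "?r \<in> uea_ideal scale \<epsilon> L gr br"
    using T.genideal_self[OF uea_rels_carrier] by (auto simp only: uea_ideal_eq)
  then have "uea_ideal scale \<epsilon> L gr br +>\<^bsub>\<T>\<^esub> ?r = \<zero>\<^bsub>\<U>\<^esub>"
    unfolding uea_eq by (rule alg_ideal.quotient_zero[OF alg_ideal_uea])
  then have "(\<iota> x \<otimes>\<^bsub>\<U>\<^esub> \<iota> y \<ominus>\<^bsub>\<U>\<^esub> \<epsilon> g h \<odot>\<^bsub>\<U>\<^esub> (\<iota> y \<otimes>\<^bsub>\<U>\<^esub> \<iota> x)) \<ominus>\<^bsub>\<U>\<^esub> \<iota> (br x y) = \<zero>\<^bsub>\<U>\<^esub>"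
    using c by (simp only: p.minus p.mult p.smult T.minus_closed T.m_closed T.smult_cl uea_incl_def)
  then have "\<iota> x \<otimes>\<^bsub>\<U>\<^esub> \<iota> y \<ominus>\<^bsub>\<U>\<^esub> \<epsilon> g h \<odot>\<^bsub>\<U>\<^esub> (\<iota> y \<otimes>\<^bsub>\<U>\<^esub> \<iota> x) = \<iota> (br x y)"
    using c' by (simp only: U.minus_eq_0_iff U.minus_closed U.m_closed U.smult_cl)
  then have "\<epsilon> g h \<odot>\<^bsub>\<U>\<^esub> (\<iota> y \<otimes>\<^bsub>\<U>\<^esub> \<iota> x) \<oplus>\<^bsub>\<U>\<^esub> \<iota> (br x y) =
    \<epsilon> g h \<odot>\<^bsub>\<U>\<^esub> (\<iota> y \<otimes>\<^bsub>\<U>\<^esub> \<iota> x) \<oplus>\<^bsub>\<U>\<^esub> (\<iota> x \<otimes>\<^bsub>\<U>\<^esub> \<iota> y \<ominus>\<^bsub>\<U>\<^esub> \<epsilon> g h \<odot>\<^bsub>\<U>\<^esub> (\<iota> y \<otimes>\<^bsub>\<U>\<^esub> \<iota> x))"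
    by (simp only:)
  also have "\<dots> = \<iota> x \<otimes>\<^bsub>\<U>\<^esub> \<iota> y"
    using c' by (simp add: U.minus_eq U.a_lcomm U.r_neg)
  finally show ?thesis by (rule sym)
qed

text \<open>Words arise from the empty word by prefixing letters, so left multiplication by
  generators already reaches all of U(L).\<close>

lemma uea_generated:
  assumes H: "H \<subseteq> carrier \<U>" "\<one>\<^bsub>\<U>\<^esub> \<in> H" "\<And>x y. \<lbrakk>x \<in> H; y \<in> H\<rbrakk> \<Longrightarrow> x \<oplus>\<^bsub>\<U>\<^esub> y \<in> H"
    "\<And>a x. x \<in> H \<Longrightarrow> a \<odot>\<^bsub>\<U>\<^esub> x \<in> H" "\<And>x u. \<lbrakk>x \<in> L; u \<in> H\<rbrakk> \<Longrightarrow> \<iota> x \<otimes>\<^bsub>\<U>\<^esub> u \<in> H"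
  shows "H = carrier \<U>"
proof -
  interpret \<pi>: alg_hom \<F> \<U> free_proj by (rule alg_hom_free_proj)
  have w: "free_proj (Poly_Mapping.single w 1) \<in> H" if "w \<in> lists L" for w
    using that
  proof (induction w)
    case Nil
    then show ?case
      using H(2) \<pi>.one by (simp add: zero_list_def flip: single_one)
  next
    case (Cons x w)
    have "(Poly_Mapping.single (x # w) 1 :: 'v list \<Rightarrow>\<^sub>0 'k) =
        Poly_Mapping.single [x] 1 \<otimes>\<^bsub>\<F>\<^esub> Poly_Mapping.single w 1"
      by (simp add: mult_single plus_list_def)
    moreover have "free_proj (Poly_Mapping.single [x] 1 \<otimes>\<^bsub>\<F>\<^esub> Poly_Mapping.single w 1) =
        \<iota> x \<otimes>\<^bsub>\<U>\<^esub> free_proj (Poly_Mapping.single w 1)"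
      unfolding free_proj_single[symmetric] by (rule \<pi>.mult) (use Cons in auto)
    ultimately show ?case
      using Cons H(5) by simp
  qed
  have "free_proj f \<in> H" if "keys f \<subseteq> lists L" for f
    using that
  proof (induction f rule: poly_mapping_add_induct)
    case zero
    have "0 \<odot>\<^bsub>\<U>\<^esub> \<one>\<^bsub>\<U>\<^esub> \<in> H" using H by blast
    then show ?case using \<pi>.zero by simp
  next
    case (add v c f)
    have e: "Poly_Mapping.single v c + f = (c \<odot>\<^bsub>\<F>\<^esub> Poly_Mapping.single v 1) \<oplus>\<^bsub>\<F>\<^esub> f"
      by simp
    have "free_proj (Poly_Mapping.single v c + f) =
        c \<odot>\<^bsub>\<U>\<^esub> free_proj (Poly_Mapping.single v 1) \<oplus>\<^bsub>\<U>\<^esub> free_proj f"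
      unfolding e using add(1,2) by (subst \<pi>.add, simp, simp, subst \<pi>.smult) simp_all
    then show ?case
      using H(3,4) w[OF add(1)] add by simp
  qed
  then show ?thesis
    using H(1) by (auto simp: free_proj_surj)
qed

text \<open>Universal property of U(L). The map is lifted from the free algebra through the two
  quotients in turn: linearity of \<open>f\<close> kills \<open>lin_rels\<close>, and the bracket
  condition kills \<open>uea_rels\<close>.\<close>

lemma uea_lift:
  assumes B: "assoc_alg B" and f: "f \<in> L \<rightarrow> carrier B"
    and f_add: "\<And>x y. \<lbrakk>x \<in> L; y \<in> L\<rbrakk> \<Longrightarrow> f (x + y) = f x \<oplus>\<^bsub>B\<^esub> f y"
    and f_scale: "\<And>c x. x \<in> L \<Longrightarrow> f (scale c x) = c \<odot>\<^bsub>B\<^esub> f x"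
    and f_br: "\<And>x y g h. \<lbrakk>x \<in> gr g; y \<in> gr h\<rbrakk> \<Longrightarrow>
      f x \<otimes>\<^bsub>B\<^esub> f y = \<epsilon> g h \<odot>\<^bsub>B\<^esub> (f y \<otimes>\<^bsub>B\<^esub> f x) \<oplus>\<^bsub>B\<^esub> f (br x y)"
  shows "\<exists>h\<in>algebra_hom \<U> B. \<forall>x\<in>L. h (\<iota> x) = f x"
proof -
  interpret B: assoc_alg B by (rule B)
  obtain h0 where h0: "h0 \<in> algebra_hom \<F> B" "\<And>x. x \<in> L \<Longrightarrow> h0 (Poly_Mapping.single [x] 1) = f x"
    using B.free_algebra_lift[OF f] by blast
  interpret h0: alg_hom \<F> B h0
    using free_algebra_assoc_alg B h0(1) by (rule alg_homI)
  let ?s = "\<lambda>z. Poly_Mapping.single [z] 1 :: 'v list \<Rightarrow>\<^sub>0 'k"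
  have s: "?s x \<in> carrier \<F>" if "x \<in> L" for x
    using that by simp
  \<comment> \<open>Matches subtraction of polynomial mappings with subtraction in the ring record;
    \<open>h0.minus\<close> speaks of the latter.\<close>
  have F_minus: "a - b = a \<ominus>\<^bsub>\<F>\<^esub> b" if "a \<in> carrier \<F>" "b \<in> carrier \<F>" for a b
  proof -
    have "a \<ominus>\<^bsub>\<F>\<^esub> b = a - b"
      using that h0.A.minus_eq_0_iff h0.A.add.inv_equality[of "- b" b]
      by (simp add: a_minus_def keys_minus flip: a_inv_def)
    then show ?thesis by simp
  qed
  have fc: "f x \<in> carrier B" if "x \<in> L" for x
    using that f by blast
  have "h0 x = \<zero>\<^bsub>B\<^esub>" if x: "x \<in> linearity_ideal scale L" for x
  proof (rule h0.genideal_kernel[OF lin_rels_carrier _ x[unfolded linearity_ideal_eq]])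
    fix r assume "r \<in> lin_rels"
    then consider (add) x y where "x \<in> L" "y \<in> L" "r = ?s (x + y) - ?s x - ?s y"
      | (scale) c x where "x \<in> L" "r = ?s (scale c x) - Poly_Mapping.single [x] c"
      unfolding lin_rels_def by blast
    then show "h0 r = \<zero>\<^bsub>B\<^esub>"
    proof cases
      case add
      have L: "x + y \<in> L" using add subspace_add[OF subspace_L] by blast
      have "r = ?s (x + y) \<ominus>\<^bsub>\<F>\<^esub> (?s x \<oplus>\<^bsub>\<F>\<^esub> ?s y)"
        using s[OF L] h0.A.add.m_closed[OF s[OF add(1)] s[OF add(2)]]
        by (subst F_minus[symmetric]) (simp_all add: add)
      then have "h0 r = f (x + y) \<ominus>\<^bsub>B\<^esub> (f x \<oplus>\<^bsub>B\<^esub> f y)"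
        using s[OF L] s[OF add(1)] s[OF add(2)] h0(2) L add
        by (simp only: h0.minus h0.add h0.A.add.m_closed)
      then show ?thesis
        using add fc f_add by (simp add: B.minus_eq_0_iff)
    next
      case scale
      have L: "scale c x \<in> L" using scale subspace_scale[OF subspace_L] by blast
      have "r = ?s (scale c x) \<ominus>\<^bsub>\<F>\<^esub> (c \<odot>\<^bsub>\<F>\<^esub> ?s x)"
        using s[OF L] h0.A.smult_cl[OF s[OF scale(1)]]
        by (subst F_minus[symmetric]) (simp_all add: scale)
      then have "h0 r = f (scale c x) \<ominus>\<^bsub>B\<^esub> (c \<odot>\<^bsub>B\<^esub> f x)"
        using s[OF L] s[OF scale(1)] h0(2) L scale
        by (simp only: h0.minus h0.smult h0.A.smult_cl)
      then show ?thesis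
        using scale fc f_scale by (simp add: B.minus_eq_0_iff)
    qed
  qed
  from alg_ideal.quotient_lift[OF alg_ideal_lin B h0(1) this]
  obtain h1 where h1: "h1 \<in> algebra_hom \<T> B" "\<And>x. x \<in> carrier \<F> \<Longrightarrow> h1 (linearity_ideal scale L +>\<^bsub>\<F>\<^esub> x) = h0 x"
    unfolding tensor_eq by blast
  interpret h1: alg_hom \<T> B h1
    using tensor_assoc_alg B h1(1) by (rule alg_homI)
  let ?t = "tensor_incl scale L"
  have t: "h1 (?t x) = f x" if "x \<in> L" for x
    unfolding tensor_incl_def using h1(2)[OF s[OF that]] h0(2)[OF that] by simp
  have "h1 x = \<zero>\<^bsub>B\<^esub>" if x: "x \<in> uea_ideal scale \<epsilon> L gr br" for x
  proof (rule h1.genideal_kernel[OF uea_rels_carrier _ x[unfolded uea_ideal_eq]])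
    fix r assume "r \<in> uea_rels"
    then obtain x y g h where xy: "x \<in> gr g" "y \<in> gr h" and
      r: "r = ?t x \<otimes>\<^bsub>\<T>\<^esub> ?t y \<ominus>\<^bsub>\<T>\<^esub> \<epsilon> g h \<odot>\<^bsub>\<T>\<^esub> (?t y \<otimes>\<^bsub>\<T>\<^esub> ?t x) \<ominus>\<^bsub>\<T>\<^esub> ?t (br x y)"
      unfolding uea_rels_def by blast
    have L: "x \<in> L" "y \<in> L" "br x y \<in> L"
      using xy gr_L br_L by blast+
    note c = tensor_incl_closed[OF L(1)] tensor_incl_closed[OF L(2)] tensor_incl_closed[OF L(3)]
    have "h1 r = f x \<otimes>\<^bsub>B\<^esub> f y \<ominus>\<^bsub>B\<^esub> \<epsilon> g h \<odot>\<^bsub>B\<^esub> (f y \<otimes>\<^bsub>B\<^esub> f x) \<ominus>\<^bsub>B\<^esub> f (br x y)"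
      unfolding r using c L
      by (simp only: h1.minus h1.mult h1.smult h1.A.minus_closed h1.A.m_closed h1.A.smult_cl t)
    also have "\<dots> = \<zero>\<^bsub>B\<^esub>"
      unfolding f_br[OF xy] using fc[OF L(1)] fc[OF L(2)] fc[OF L(3)]
      by (simp add: B.minus_eq B.a_ac B.r_neg B.l_neg)
    finally show "h1 r = \<zero>\<^bsub>B\<^esub>" .
  qed
  from alg_ideal.quotient_lift[OF alg_ideal_uea B h1(1) this]
  obtain h2 where h2: "h2 \<in> algebra_hom \<U> B"
    "\<And>x. x \<in> carrier \<T> \<Longrightarrow> h2 (uea_ideal scale \<epsilon> L gr br +>\<^bsub>\<T>\<^esub> x) = h1 x"
    unfolding uea_eq by blast
  have "h2 (\<iota> x) = f x" if "x \<in> L" for x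
    unfolding uea_incl_def using h2(2)[OF tensor_incl_closed[OF that]] t[OF that] by simp
  with h2(1) show ?thesis by blast
qed

end

section \<open>Standard monomials\<close>

abbreviation uexp :: "nat \<Rightarrow> (nat \<Rightarrow>\<^sub>0 nat)" where "uexp l \<equiv> Poly_Mapping.single l 1"

lemma exponents_0 [simp]: "0 \<in> exponents n"
  by (simp add: exponents_def)

lemma exponents_uexp [simp]:
  "uexp l \<in> exponents n \<longleftrightarrow> l \<in> {1..n}"
  "Poly_Mapping.single l (Suc 0) \<in> exponents n \<longleftrightarrow> l \<in> {1..n}"
  by (simp_all add: exponents_def)

lemma exponents_add [simp]: "\<alpha> + \<beta> \<in> exponents n \<longleftrightarrow> \<alpha> \<in> exponents n \<and> \<beta> \<in> exponents n"
  by (auto simp: exponents_def subset_iff in_keys_iff lookup_add)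

lemma exponents_lookup: "\<lbrakk>\<alpha> \<in> exponents n; i \<notin> {1..n}\<rbrakk> \<Longrightarrow> lookup \<alpha> i = 0"
  by (auto simp: exponents_def in_keys_iff)

lemma exponents_mono: "r \<le> n \<Longrightarrow> exponents r \<subseteq> exponents n"
  by (auto simp: exponents_def)

text \<open>The lowest variable of a standard monomial stands leftmost, so splitting it off writes
  the monomial as a variable times a smaller standard monomial. The straightening inductions use
  this.\<close>

lemma least_key:
  assumes "\<alpha> \<in> exponents n" "\<alpha> \<noteq> 0"
  obtains s \<beta> where "s \<in> {1..n}" "\<alpha> = \<beta> + uexp s" "\<beta> \<in> exponents n" "\<And>i. i < s \<Longrightarrow> lookup \<alpha> i = 0"
    "\<And>i. i < s \<Longrightarrow> lookup \<beta> i = 0" "lookup \<alpha> s \<noteq> 0"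
proof -
  define s where "s = Min (keys \<alpha>)"
  have ne: "keys \<alpha> \<noteq> {}" using assms by simp
  have s: "s \<in> keys \<alpha>" unfolding s_def using ne by simp
  have lt: "lookup \<alpha> i = 0" if "i < s" for i
    using that ne Min_le[of "keys \<alpha>" i] by (auto simp: s_def not_in_keys_iff_lookup_eq_zero)
  define \<beta> where "\<beta> = \<alpha> - uexp s"
  have e: "\<alpha> = \<beta> + uexp s"
    by (rule poly_mapping_eqI)
      (use s in \<open>auto simp: \<beta>_def lookup_add lookup_minus lookup_single when_def in_keys_iff\<close>)
  show thesis
  proof (rule that[of s \<beta>])
    show "s \<in> {1..n}" using s assms by (auto simp: exponents_def)
    show "\<beta> \<in> exponents n" using assms(1) e by simp
    show "lookup \<beta> i = 0" if "i < s" for i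
      using lt[OF that] by (simp add: \<beta>_def lookup_minus)
  qed (use e lt s in \<open>auto simp: in_keys_iff\<close>)
qed

definition tdeg :: "nat \<Rightarrow> (nat \<Rightarrow>\<^sub>0 nat) \<Rightarrow> nat" where
  "tdeg n \<alpha> = (\<Sum>i\<in>{1..n}. lookup \<alpha> i)"

lemma tdeg_add [simp]: "tdeg n (\<alpha> + \<beta>) = tdeg n \<alpha> + tdeg n \<beta>"
  by (simp add: tdeg_def lookup_add sum.distrib)

lemma tdeg_uexp [simp]:
  assumes "l \<in> {1..n}" shows "tdeg n (uexp l) = 1" "tdeg n (Poly_Mapping.single l (Suc 0)) = 1"
  using assms by (simp_all add: tdeg_def lookup_single when_def)

text \<open>Degree first; ties are broken by the library's order, which compares the lowest index first
  and has to be reversed to put \<open>t\<^sub>1\<close> below \<open>t\<^sub>2\<close>.\<close>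

definition deglex :: "nat \<Rightarrow> (nat \<Rightarrow>\<^sub>0 nat) \<Rightarrow> (nat \<Rightarrow>\<^sub>0 nat) \<Rightarrow> bool" where
  "deglex n \<alpha> \<beta> \<longleftrightarrow> tdeg n \<alpha> < tdeg n \<beta> \<or> tdeg n \<alpha> = tdeg n \<beta> \<and> \<beta> < \<alpha>"

lemma deglex_trans: "\<lbrakk>deglex n \<alpha> \<beta>; deglex n \<beta> \<gamma>\<rbrakk> \<Longrightarrow> deglex n \<alpha> \<gamma>"
  by (auto simp: deglex_def)

lemma deglex_irrefl [simp]: "\<not> deglex n \<alpha> \<alpha>"
  by (simp add: deglex_def)

lemma deglex_total: "\<alpha> \<noteq> \<beta> \<Longrightarrow> deglex n \<alpha> \<beta> \<or> deglex n \<beta> \<alpha>"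
  by (auto simp: deglex_def)

lemma deglex_add: "deglex n \<alpha> \<beta> \<Longrightarrow> deglex n (\<alpha> + \<gamma>) (\<beta> + \<gamma>)"
  by (auto simp: deglex_def add_strict_right_mono)

lemma deglex_tdeg: "deglex n \<alpha> \<beta> \<Longrightarrow> tdeg n \<alpha> \<le> tdeg n \<beta>"
  by (auto simp: deglex_def)

lemma deglex_0: assumes "\<alpha> \<in> exponents n" "\<alpha> \<noteq> 0" shows "deglex n 0 \<alpha>"
proof -
  obtain s \<beta> where "s \<in> {1..n}" "\<alpha> = \<beta> + uexp s"
    by (rule least_key[OF assms])
  moreover have "tdeg n 0 = 0"
    by (simp add: tdeg_def)
  ultimately show ?thesis
    by (simp add: deglex_def)
qed

lemma deglex_uexp: 
  assumes "i \<in> {1..n}" "j \<in> {1..n}" "i < j" shows "deglex n (uexp i) (uexp j)"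
proof -
  \<comment> \<open>The first index at which the two functions differ is \<open>i\<close>, with
    values 0 and 1.\<close>
  have "uexp j < uexp i"
    unfolding less_poly_mapping.rep_eq less_fun_def
    by (rule exI[of _ i]) (use assms in \<open>auto simp: lookup_single when_def\<close>)
  then show ?thesis
    using assms by (simp add: deglex_def)
qed

context assoc_alg
begin

lemma monomial_tail_cong:
  "(\<And>i. i \<in> set xs \<Longrightarrow> lookup \<alpha> i = lookup \<beta> i) \<Longrightarrow>
    foldr (\<lambda>i u. (T i [^] lookup \<alpha> i) \<otimes> u) xs z = foldr (\<lambda>i u. (T i [^] lookup \<beta> i) \<otimes> u) xs z"
  by (induction xs) auto

lemma monomial_tail_closed:
  "(\<And>i. i \<in> set xs \<Longrightarrow> T i \<in> carrier A) \<Longrightarrow> z \<in> carrier A \<Longrightarrow>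
    foldr (\<lambda>i u. (T i [^] (lookup \<alpha> i :: nat)) \<otimes> u) xs z \<in> carrier A"
  by (induction xs) auto

lemma monomial_tail_zero:
  "(\<And>i. i \<in> set xs \<Longrightarrow> lookup \<alpha> i = 0) \<Longrightarrow> z \<in> carrier A \<Longrightarrow>
    foldr (\<lambda>i u. (T i [^] (lookup \<alpha> i :: nat)) \<otimes> u) xs z = z"
  by (induction xs) auto

lemma std_monomial_closed:
  "(\<And>i. i \<in> {1..n} \<Longrightarrow> T i \<in> carrier A) \<Longrightarrow> std_monomial A n T \<alpha> \<in> carrier A"
  unfolding std_monomial_def by (rule monomial_tail_closed) auto

lemma std_monomial_0 [simp]: "std_monomial A n T 0 = \<one>"
  unfolding std_monomial_def by (rule monomial_tail_zero) auto

lemma std_monomial_mult_left: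
  assumes T: "\<And>i. i \<in> {1..n} \<Longrightarrow> T i \<in> carrier A" and l: "l \<in> {1..n}"
    and z: "\<And>i. i < l \<Longrightarrow> lookup \<alpha> i = 0"
  shows "T l \<otimes> std_monomial A n T \<alpha> = std_monomial A n T (\<alpha> + uexp l)"
proof -
  define F where "F \<beta> xs = foldr (\<lambda>i u. (T i [^] lookup \<beta> i) \<otimes> u) xs \<one>" for \<beta> :: "nat \<Rightarrow>\<^sub>0 nat" and xs
  have split: "[1..<Suc n] = [1..<l] @ l # [Suc l..<Suc n]"
    using l upt_add_eq_append[of 1 l "Suc n - l"] upt_conv_Cons[of l "Suc n"] by simp
  have c: "F \<beta> xs \<in> carrier A" if "set xs \<subseteq> {1..n}" for \<beta> xs
    unfolding F_def by (rule monomial_tail_closed) (use T that in auto)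
  have tail: "std_monomial A n T \<beta> = (T l [^] lookup \<beta> l) \<otimes> F \<beta> [Suc l..<Suc n]"
    if "\<And>i. i < l \<Longrightarrow> lookup \<beta> i = 0" for \<beta>
  proof -
    have "F \<beta> [Suc l..<Suc n] \<in> carrier A"
      by (rule c) (use l in auto)
    then show ?thesis
      unfolding std_monomial_def split foldr_append foldr.simps comp_apply F_def
      by (intro monomial_tail_zero) (use that T l in auto)
  qed
  have "F (\<alpha> + uexp l) [Suc l..<Suc n] = F \<alpha> [Suc l..<Suc n]"
    unfolding F_def by (rule monomial_tail_cong) (auto simp: lookup_add lookup_single when_def)
  moreover have "F \<alpha> [Suc l..<Suc n] \<in> carrier A"
    by (rule c) (use l in auto)
  moreover have "T l [^] lookup (\<alpha> + uexp l) l = T l \<otimes> T l [^] lookup \<alpha> l"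
    using nat_pow_Suc2[OF T[OF l]] by (simp add: lookup_add)
  moreover have "std_monomial A n T (\<alpha> + uexp l) =
      T l [^] lookup (\<alpha> + uexp l) l \<otimes> F (\<alpha> + uexp l) [Suc l..<Suc n]"
    by (rule tail) (use z in \<open>simp add: lookup_add lookup_single when_def\<close>)
  ultimately show ?thesis
    using T[OF l] tail[OF z] by (simp only: m_assoc nat_pow_closed)
qed

lemma std_monomial_uexp:
  assumes "\<And>i. i \<in> {1..n} \<Longrightarrow> T i \<in> carrier A" "l \<in> {1..n}"
  shows "std_monomial A n T (uexp l) = T l"
  using std_monomial_mult_left[of n T l 0] assms by simp

end

lemma (in alg_hom) std_monomial:
  assumes "\<And>i. i \<in> {1..n} \<Longrightarrow> T i \<in> carrier A"
  shows "h (std_monomial A n T \<alpha>) = std_monomial B n (\<lambda>i. h (T i)) \<alpha>"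
proof -
  have "h (foldr (\<lambda>i u. (T i [^]\<^bsub>A\<^esub> lookup \<alpha> i) \<otimes>\<^bsub>A\<^esub> u) xs \<one>\<^bsub>A\<^esub>) =
    foldr (\<lambda>i u. (h (T i) [^]\<^bsub>B\<^esub> lookup \<alpha> i) \<otimes>\<^bsub>B\<^esub> u) xs \<one>\<^bsub>B\<^esub>" if "set xs \<subseteq> {1..n}" for xs
    using that
  proof (induction xs)
    case (Cons x xs)
    then show ?case
      using A.monomial_tail_closed[of xs T "\<one>\<^bsub>A\<^esub>" \<alpha>] assms by (simp add: mult pow subset_iff)
  qed simp
  then show ?thesis
    unfolding std_monomial_def by (rule) auto
qed

section \<open>Straightening\<close>

text \<open>The relations of an iterated Ore extension \<open>k[T\<^sub>1]\<dots>[T\<^sub>n]\<close> in which the derivations send each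
  variable to a scalar multiple of another one.\<close>

locale ore_relations = assoc_alg A for A :: "('k::field, 'a) module" (structure) +
  fixes n :: nat and T :: "nat \<Rightarrow> 'a" and q c :: "nat \<Rightarrow> nat \<Rightarrow> 'k" and \<kappa> :: "nat \<Rightarrow> nat \<Rightarrow> nat"
  assumes T_closed: "i \<in> {1..n} \<Longrightarrow> T i \<in> carrier A"
    and q_nz: "\<lbrakk>1 \<le> l; l < r; r \<le> n\<rbrakk> \<Longrightarrow> q r l \<noteq> 0"
    and \<kappa>: "\<lbrakk>1 \<le> l; l < r; r \<le> n\<rbrakk> \<Longrightarrow> \<kappa> r l \<in> {1..<r}"
    and rel: "\<lbrakk>1 \<le> l; l < r; r \<le> n\<rbrakk> \<Longrightarrow> T r \<otimes> T l = q r l \<odot> (T l \<otimes> T r) \<oplus> c r l \<odot> T (\<kappa> r l)"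
begin

abbreviation "M \<equiv> std_monomial A n T"

lemma M_closed [simp, intro]: "M \<alpha> \<in> carrier A"
  by (rule std_monomial_closed) (rule T_closed)

lemma M_fun [simp, intro]: "M \<in> J \<rightarrow> carrier A"
  by blast

definition Low :: "(nat \<Rightarrow>\<^sub>0 nat) \<Rightarrow> 'a set" where
  "Low \<beta> = {lin_comb A M f | f. keys f \<subseteq> {\<gamma> \<in> exponents n. deglex n \<gamma> \<beta>}}"

lemma Low_mem: "lin_comb A M f \<in> Low \<beta>" if "keys f \<subseteq> {\<gamma> \<in> exponents n. deglex n \<gamma> \<beta>}"
  using that unfolding Low_def by blast

lemma Low_closed: "Low \<beta> \<subseteq> carrier A"
  by (auto simp: Low_def)

lemma Low_0: "\<zero> \<in> Low \<beta>"
  using Low_mem[of 0] by simp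

lemma Low_add: assumes "x \<in> Low \<beta>" "y \<in> Low \<beta>" shows "x \<oplus> y \<in> Low \<beta>"
proof -
  let ?K = "{\<gamma> \<in> exponents n. deglex n \<gamma> \<beta>}"
  obtain f g where f: "x = lin_comb A M f" "keys f \<subseteq> ?K" and g: "y = lin_comb A M g" "keys g \<subseteq> ?K"
    using assms by (auto simp: Low_def)
  have "x \<oplus> y = lin_comb A M (f + g)"
    unfolding f g using lin_comb_add[of M ?K f g] f g by simp
  moreover have "keys (f + g) \<subseteq> ?K"
    using keys_add[of f g] f g by blast
  ultimately show ?thesis by (simp add: Low_mem)
qed

lemma Low_smult: assumes "x \<in> Low \<beta>" shows "a \<odot> x \<in> Low \<beta>"
proof -
  let ?K = "{\<gamma> \<in> exponents n. deglex n \<gamma> \<beta>}"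
  obtain f where f: "x = lin_comb A M f" "keys f \<subseteq> ?K"
    using assms by (auto simp: Low_def)
  then have "a \<odot> x = lin_comb A M (pm_smult a f)"
    by (simp add: lin_comb_smult)
  moreover have "keys (pm_smult a f) \<subseteq> ?K"
    using keys_pm_smult[of a f] f by blast
  ultimately show ?thesis by (simp add: Low_mem)
qed

lemma Low_mon: assumes "\<gamma> \<in> exponents n" "deglex n \<gamma> \<beta>" shows "M \<gamma> \<in> Low \<beta>"
  using Low_mem[of "Poly_Mapping.single \<gamma> 1" \<beta>] assms by simp

lemma Low_mono: "deglex n \<beta> \<gamma> \<Longrightarrow> Low \<beta> \<subseteq> Low \<gamma>"
  unfolding Low_def using deglex_trans by blast

lemma Low_mult:
  assumes x: "x \<in> carrier A" and z: "z \<in> Low \<beta>"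
    and m: "\<And>\<gamma>. \<lbrakk>\<gamma> \<in> exponents n; deglex n \<gamma> \<beta>\<rbrakk> \<Longrightarrow> x \<otimes> M \<gamma> \<in> Low \<delta>"
  shows "x \<otimes> z \<in> Low \<delta>"
proof -
  obtain f where f: "z = lin_comb A M f" "keys f \<subseteq> {\<gamma> \<in> exponents n. deglex n \<gamma> \<beta>}"
    using z by (auto simp: Low_def)
  have "z \<in> {y \<in> carrier A. x \<otimes> y \<in> Low \<delta>}"
    unfolding f by (rule lin_comb_mem)
      (use x m f Low_0 Low_add Low_smult in \<open>auto simp: r_distr smult_mult_right subset_iff\<close>)
  then show ?thesis by simp
qed

text \<open>Replaces \<open>lead_exp\<close> as long as the monomials are not known to be
  independent: existence of a suitable expansion is demanded, not uniqueness.\<close>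

definition leading :: "(nat \<Rightarrow>\<^sub>0 nat) \<Rightarrow> 'a \<Rightarrow> bool" where
  "leading \<beta> u \<longleftrightarrow> (\<exists>a z. a \<noteq> 0 \<and> z \<in> Low \<beta> \<and> u = a \<odot> M \<beta> \<oplus> z)"

lemma leading_mon: "leading \<beta> (M \<beta>)"
  unfolding leading_def using Low_0 by (intro exI[of _ 1] exI[of _ \<zero>]) auto

lemma leading_Low: assumes "leading \<beta> u" "\<beta> \<in> exponents n" "deglex n \<beta> \<gamma>" shows "u \<in> Low \<gamma>"
proof -
  obtain a z where u: "z \<in> Low \<beta>" "u = a \<odot> M \<beta> \<oplus> z"
    using assms(1) unfolding leading_def by blast
  have "a \<odot> M \<beta> \<in> Low \<gamma>" "z \<in> Low \<gamma>"
    using Low_smult Low_mon assms u Low_mono by blast+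
  then show ?thesis unfolding u(2) by (rule Low_add)
qed

lemma leading_add: assumes "leading \<beta> u" "z \<in> Low \<beta>" shows "leading \<beta> (u \<oplus> z)"
proof -
  obtain a y where u: "a \<noteq> 0" "y \<in> Low \<beta>" "u = a \<odot> M \<beta> \<oplus> y"
    using assms(1) unfolding leading_def by blast
  have "u \<oplus> z = a \<odot> M \<beta> \<oplus> (y \<oplus> z)"
    using u assms subsetD[OF Low_closed u(2)] subsetD[OF Low_closed assms(2)] by (simp add: a_assoc)
  then show ?thesis
    unfolding leading_def using u Low_add[OF u(2) assms(2)] by blast
qed

lemma leading_smult: assumes "leading \<beta> u" "b \<noteq> 0" shows "leading \<beta> (b \<odot> u)"
proof -
  obtain a y where u: "a \<noteq> 0" "y \<in> Low \<beta>" "u = a \<odot> M \<beta> \<oplus> y"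
    using assms(1) unfolding leading_def by blast
  have "b \<odot> u = (b * a) \<odot> M \<beta> \<oplus> b \<odot> y"
    using u subsetD[OF Low_closed u(2)] by (simp add: smult_add_right smult_smult)
  then show ?thesis
    unfolding leading_def using u Low_smult[OF u(2)] assms(2) by (metis no_zero_divisors)
qed

text \<open>By linearity in \<open>u\<close>: the leading term acquires the exponent
  \<open>\<delta>\<close>, and the smaller monomials end up below \<open>\<delta>\<close>, where
  they cannot disturb it.\<close>

lemma leading_mult:
  assumes x: "x \<in> carrier A" and u: "leading \<beta> u" and b: "\<beta> \<in> exponents n"
    and m: "leading \<delta> (x \<otimes> M \<beta>)"
    "\<And>\<gamma>. \<lbrakk>\<gamma> \<in> exponents n; deglex n \<gamma> \<beta>\<rbrakk> \<Longrightarrow> x \<otimes> M \<gamma> \<in> Low \<delta>"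
  shows "leading \<delta> (x \<otimes> u)"
proof -
  obtain a z where u: "a \<noteq> 0" "z \<in> Low \<beta>" "u = a \<odot> M \<beta> \<oplus> z"
    using u unfolding leading_def by blast
  have "x \<otimes> u = a \<odot> (x \<otimes> M \<beta>) \<oplus> x \<otimes> z"
    using x u subsetD[OF Low_closed u(2)] by (simp add: r_distr smult_mult_right)
  then show ?thesis
    using leading_add[OF leading_smult[OF m(1) u(1)] Low_mult[OF x u(2) m(2)]] by simp
qed

text \<open>If \<open>s\<close> is the least variable of \<open>\<alpha>\<close> and \<open>s < l\<close>, the relation for \<open>T l \<otimes> T s\<close> leaves products of smaller
  degree, and products with \<open>T s\<close> on the left in the same degree: the induction is on the pair of
  \<open>tdeg n \<alpha>\<close> and \<open>l\<close>.\<close>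

lemma leading_T_mon:
  "\<lbrakk>\<alpha> \<in> exponents n; l \<in> {1..n}\<rbrakk> \<Longrightarrow> leading (\<alpha> + uexp l) (T l \<otimes> M \<alpha>)"
proof (induction "tdeg n \<alpha> * Suc n + l" arbitrary: \<alpha> l rule: less_induct)
  case less
  note \<alpha> = \<open>\<alpha> \<in> exponents n\<close> and l = \<open>l \<in> {1..n}\<close>
  show ?case
  proof (cases "\<forall>i<l. lookup \<alpha> i = 0")
    case True
    then have "T l \<otimes> M \<alpha> = M (\<alpha> + uexp l)"
      using l T_closed by (intro std_monomial_mult_left) auto
    then show ?thesis by (simp add: leading_mon)
  next
    case False
    then have "\<alpha> \<noteq> 0" by auto
    obtain s \<beta> where s: "s \<in> {1..n}" "\<alpha> = \<beta> + uexp s" "\<beta> \<in> exponents n"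
      "\<And>i. i < s \<Longrightarrow> lookup \<alpha> i = 0" "\<And>i. i < s \<Longrightarrow> lookup \<beta> i = 0" "lookup \<alpha> s \<noteq> 0"
      by (rule least_key[OF \<alpha> \<open>\<alpha> \<noteq> 0\<close>]) (rule that)
    have sl: "s < l"
      using False s(4) by (metis leD leI less_trans nat_neq_iff)
    have IH_small: "leading (\<gamma> + uexp r) (T r \<otimes> M \<gamma>)"
      if "\<gamma> \<in> exponents n" "r \<in> {1..n}" "tdeg n \<gamma> < tdeg n \<alpha>" for \<gamma> r
    proof (rule less.hyps[OF _ that(1,2)])
      \<comment> \<open>The weight \<open>Suc n\<close> makes the measure lexicographic: variables
        are at most \<open>n\<close>, so a drop in degree outweighs any change of the
        variable.\<close>
      have "tdeg n \<gamma> * Suc n + Suc n \<le> tdeg n \<alpha> * Suc n"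
        using that(3) by (metis Suc_leI add.commute mult_Suc mult_le_mono1)
      then show "tdeg n \<gamma> * Suc n + r < tdeg n \<alpha> * Suc n + l"
        using that(2) by simp
    qed
    have IH_s: "leading (\<gamma> + uexp s) (T s \<otimes> M \<gamma>)"
      if g: "\<gamma> \<in> exponents n" "tdeg n \<gamma> \<le> tdeg n \<alpha>" for \<gamma>
    proof (cases "tdeg n \<gamma> = tdeg n \<alpha>")
      case True
      then show ?thesis by (intro less.hyps g s) (use sl in simp)
    next
      case False
      then show ?thesis by (intro IH_small g s) (use g in simp)
    qed
    have \<beta>\<alpha>: "tdeg n \<alpha> = Suc (tdeg n \<beta>)"
      using s(1,2) by simp
    have k: "\<kappa> l s \<in> {1..<l}"
      using s(1) sl l by (intro \<kappa>) auto
    have mem: "T l \<in> carrier A" "T s \<in> carrier A" "T (\<kappa> l s) \<in> carrier A"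
      using l s k by (auto intro: T_closed)
    have "T l \<otimes> M \<alpha> = T l \<otimes> (T s \<otimes> M \<beta>)"
      using std_monomial_mult_left[of n T s \<beta>] T_closed s by simp
    also have "\<dots> = (q l s \<odot> (T s \<otimes> T l) \<oplus> c l s \<odot> T (\<kappa> l s)) \<otimes> M \<beta>"
      using mem rel[of s l] s(1) sl l by (simp add: m_assoc[symmetric])
    also have "\<dots> = q l s \<odot> (T s \<otimes> (T l \<otimes> M \<beta>)) \<oplus> c l s \<odot> (T (\<kappa> l s) \<otimes> M \<beta>)"
      using mem by (simp add: l_distr smult_mult_left m_assoc)
    finally have eq: "T l \<otimes> M \<alpha> = \<dots>" .
    have "leading (\<alpha> + uexp l) (T s \<otimes> (T l \<otimes> M \<beta>))"
    proof (rule leading_mult)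
      show "leading (\<beta> + uexp l) (T l \<otimes> M \<beta>)"
        by (rule IH_small) (use s l \<beta>\<alpha> in auto)
      \<comment> \<open>\<open>s\<close> is below \<open>l\<close> and not above any variable of
        \<open>\<beta>\<close>, so \<open>T s\<close> joins at the left end without
        reordering.\<close>
      have "T s \<otimes> M (\<beta> + uexp l) = M (\<beta> + uexp l + uexp s)"
        by (rule std_monomial_mult_left)
          (use s sl T_closed in \<open>auto simp: lookup_add lookup_single when_def\<close>)
      then have "T s \<otimes> M (\<beta> + uexp l) = M (\<alpha> + uexp l)"
        by (simp add: s(2) ac_simps)
      then show "leading (\<alpha> + uexp l) (T s \<otimes> M (\<beta> + uexp l))"
        by (simp add: leading_mon)
      show "T s \<otimes> M \<gamma> \<in> Low (\<alpha> + uexp l)"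
        if g: "\<gamma> \<in> exponents n" "deglex n \<gamma> (\<beta> + uexp l)" for \<gamma>
      proof (rule leading_Low)
        show "leading (\<gamma> + uexp s) (T s \<otimes> M \<gamma>)"
          using g deglex_tdeg[OF g(2)] l \<beta>\<alpha> by (intro IH_s) auto
        show "deglex n (\<gamma> + uexp s) (\<alpha> + uexp l)"
          using deglex_add[OF g(2), of "uexp s"] by (simp add: s(2) ac_simps)
      qed (use g s in simp)
    qed (use mem s l in auto)
    \<comment> \<open>One variable replaces the two exchanged ones, so this term has smaller degree
      than \<open>\<alpha> + uexp l\<close>.\<close>
    moreover have "T (\<kappa> l s) \<otimes> M \<beta> \<in> Low (\<alpha> + uexp l)"
    proof (rule leading_Low)
      show "leading (\<beta> + uexp (\<kappa> l s)) (T (\<kappa> l s) \<otimes> M \<beta>)"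
        by (rule IH_small) (use s l k \<beta>\<alpha> in auto)
      show "deglex n (\<beta> + uexp (\<kappa> l s)) (\<alpha> + uexp l)"
        using s l k \<beta>\<alpha> by (simp add: deglex_def)
    qed (use s k l in auto)
    ultimately show ?thesis
      unfolding eq using q_nz[of s l] s(1) sl l
      by (intro leading_add leading_smult Low_smult) auto
  qed
qed

text \<open>Peels the variables of the left factor off one at a time; \<open>deglex_add\<close>
  keeps the smaller terms smaller at each multiplication.\<close>

theorem leading_mon_mult:
  "\<lbrakk>\<alpha> \<in> exponents n; \<beta> \<in> exponents n\<rbrakk> \<Longrightarrow> leading (\<alpha> + \<beta>) (M \<alpha> \<otimes> M \<beta>)"
proof (induction "tdeg n \<alpha>" arbitrary: \<alpha> rule: less_induct)
  case less
  show ?case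
  proof (cases "\<alpha> = 0")
    case True
    then show ?thesis by (simp add: leading_mon)
  next
    case False
    obtain s \<gamma> where s: "s \<in> {1..n}" "\<alpha> = \<gamma> + uexp s" "\<gamma> \<in> exponents n"
      "\<And>i. i < s \<Longrightarrow> lookup \<alpha> i = 0" "\<And>i. i < s \<Longrightarrow> lookup \<gamma> i = 0" "lookup \<alpha> s \<noteq> 0"
      by (rule least_key[OF less.prems(1) False]) (rule that)
    have "M \<alpha> \<otimes> M \<beta> = T s \<otimes> (M \<gamma> \<otimes> M \<beta>)"
      using std_monomial_mult_left[of n T s \<gamma>] T_closed s by (simp add: m_assoc[symmetric])
    moreover have "leading (\<gamma> + \<beta>) (M \<gamma> \<otimes> M \<beta>)"
      using s less.prems by (intro less.hyps) auto
    then have "leading (\<gamma> + \<beta> + uexp s) (T s \<otimes> (M \<gamma> \<otimes> M \<beta>))"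
    proof (rule leading_mult[rotated])
      show "T s \<otimes> M \<delta> \<in> Low (\<gamma> + \<beta> + uexp s)"
        if "\<delta> \<in> exponents n" "deglex n \<delta> (\<gamma> + \<beta>)" for \<delta>
        by (rule leading_Low[OF leading_T_mon[OF that(1) s(1)]])
          (use that s(1) deglex_add in auto)
    qed (use s less.prems leading_T_mon T_closed in auto)
    ultimately show ?thesis
      by (simp add: s(2) ac_simps)
  qed
qed

definition mon_span :: "'a set" where
  "mon_span = {lin_comb A M f | f. keys f \<subseteq> exponents n}"

lemma mon_span_closed: "mon_span \<subseteq> carrier A"
  by (auto simp: mon_span_def)

lemma mon_span_mon: "\<alpha> \<in> exponents n \<Longrightarrow> M \<alpha> \<in> mon_span"
  unfolding mon_span_def by (intro CollectI exI[of _ "Poly_Mapping.single \<alpha> 1"]) auto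

lemma mon_span_one: "\<one> \<in> mon_span"
  using mon_span_mon[of 0] by simp

lemma mon_span_add: assumes "x \<in> mon_span" "y \<in> mon_span" shows "x \<oplus> y \<in> mon_span"
proof -
  obtain f g where f: "x = lin_comb A M f" "keys f \<subseteq> exponents n" and g: "y = lin_comb A M g" "keys g \<subseteq> exponents n"
    using assms by (auto simp: mon_span_def)
  have "x \<oplus> y = lin_comb A M (f + g)"
    unfolding f g using lin_comb_add[of M "exponents n" f g] f g by simp
  moreover have "keys (f + g) \<subseteq> exponents n"
    using keys_add[of f g] f g by blast
  ultimately show ?thesis unfolding mon_span_def by blast
qed

lemma mon_span_smult: assumes "x \<in> mon_span" shows "a \<odot> x \<in> mon_span"
proof -
  obtain f where f: "x = lin_comb A M f" "keys f \<subseteq> exponents n"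
    using assms by (auto simp: mon_span_def)
  then have "a \<odot> x = lin_comb A M (pm_smult a f)"
    by (simp add: lin_comb_smult)
  moreover have "keys (pm_smult a f) \<subseteq> exponents n"
    using keys_pm_smult[of a f] f by blast
  ultimately show ?thesis unfolding mon_span_def by blast
qed

lemma Low_mon_span: "Low \<beta> \<subseteq> mon_span"
  unfolding Low_def mon_span_def by blast

lemma leading_mon_span: "\<lbrakk>leading \<beta> u; \<beta> \<in> exponents n\<rbrakk> \<Longrightarrow> u \<in> mon_span"
  unfolding leading_def using Low_mon_span mon_span_add mon_span_smult mon_span_mon by blast

lemma mon_span_mult_left:
  assumes "x \<in> carrier A" "\<And>\<alpha>. \<alpha> \<in> exponents n \<Longrightarrow> x \<otimes> M \<alpha> \<in> mon_span" "y \<in> mon_span"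
  shows "x \<otimes> y \<in> mon_span"
proof -
  obtain f where f: "y = lin_comb A M f" "keys f \<subseteq> exponents n"
    using assms by (auto simp: mon_span_def)
  have "y \<in> {y \<in> carrier A. x \<otimes> y \<in> mon_span}"
    unfolding f
    by (rule lin_comb_mem)
      (use assms f mon_span_add mon_span_smult mon_span_smult[OF mon_span_one, of 0] in
        \<open>auto simp: r_distr smult_mult_right subset_iff\<close>)
  then show ?thesis by simp
qed

lemma mon_span_T_mult: "\<lbrakk>l \<in> {1..n}; u \<in> mon_span\<rbrakk> \<Longrightarrow> T l \<otimes> u \<in> mon_span"
  by (rule mon_span_mult_left[OF T_closed leading_mon_span[OF leading_T_mon]]) simp_all

text \<open>Bilinearity reduces this to products of two monomials, which
  \<open>leading_mon_mult\<close> straightens. Hence the span of the standard monomials is a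
  subalgebra.\<close>

lemma mon_span_mult:
  assumes "x \<in> mon_span" "y \<in> mon_span" shows "x \<otimes> y \<in> mon_span"
proof -
  have y: "M \<alpha> \<otimes> y \<in> mon_span" if "\<alpha> \<in> exponents n" for \<alpha>
    by (rule mon_span_mult_left[OF M_closed leading_mon_span[OF leading_mon_mult] assms(2)])
      (use that in simp_all)
  obtain f where f: "x = lin_comb A M f" "keys f \<subseteq> exponents n"
    using assms by (auto simp: mon_span_def)
  have "x \<in> {x \<in> carrier A. x \<otimes> y \<in> mon_span}"
    unfolding f
    by (rule lin_comb_mem)
      (use y assms f mon_span_add mon_span_smult mon_span_smult[OF mon_span_one, of 0] mon_span_closed in
        \<open>auto simp: l_distr smult_mult_left subset_iff\<close>)
  then show ?thesis by simp
qed

lemma mon_span_T: "l \<in> {1..n} \<Longrightarrow> T l \<in> mon_span"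
  using mon_span_T_mult[OF _ mon_span_one] T_closed by simp

end

section \<open>Coordinates, leading exponents and the admissible order\<close>

lemma (in assoc_alg) coordinates_lin_comb:
  assumes b: "basis_family A J b" and f: "keys f \<subseteq> J"
  shows "coordinates A J b (lin_comb A b f) = f"
  unfolding coordinates_def
proof (rule the_equality)
  show "keys f \<subseteq> J \<and> lin_comb A b f = lin_comb A b f"
    using f by simp
  fix g assume g: "keys g \<subseteq> J \<and> lin_comb A b f = lin_comb A b g"
  have bJ: "b \<in> J \<rightarrow> carrier A"
    using b by (auto simp: basis_family_def)
  have "lin_comb A b g \<in> carrier A"
    using bJ g by (intro lin_comb_closed) auto
  then have "lin_comb A b (g - f) = \<zero>"
    using lin_comb_diff[OF bJ, of g f] f g by (simp add: minus_eq r_neg)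
  moreover have "keys (g - f) \<subseteq> J"
    using keys_diff[of g f] f g by blast
  moreover have "c = 0" if "keys c \<subseteq> J" "lin_comb A b c = \<zero>" for c
    using b that unfolding basis_family_def by blast
  ultimately have "g - f = 0"
    by blast
  then show "g = f" by simp
qed

definition deglex_rel :: "nat \<Rightarrow> (nat \<Rightarrow>\<^sub>0 nat) rel" where
  "deglex_rel n = {(\<alpha>, \<beta>). \<alpha> \<in> exponents n \<and> \<beta> \<in> exponents n \<and> (\<alpha> = \<beta> \<or> deglex n \<alpha> \<beta>)}"

context ore_relations
begin

text \<open>The keys of the \<open>Low\<close> part are strictly below \<open>\<beta>\<close>, so
  its terms can neither cancel the coefficient at \<open>\<beta>\<close> nor exceed that exponent;
  with a basis this determines the maximum.\<close>

lemma lead_exp_leading: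
  assumes b: "basis_family A (exponents n) M" and u: "leading \<beta> u" and \<beta>: "\<beta> \<in> exponents n"
  shows "u \<noteq> \<zero>" "lead_exp A n T (deglex_rel n) u = \<beta>"
proof -
  obtain a z where u: "a \<noteq> 0" "z \<in> Low \<beta>" "u = a \<odot> M \<beta> \<oplus> z"
    using u unfolding leading_def by blast
  then obtain g where g: "z = lin_comb A M g" "keys g \<subseteq> {\<gamma> \<in> exponents n. deglex n \<gamma> \<beta>}"
    unfolding Low_def by blast
  define f where "f = Poly_Mapping.single \<beta> a + g"
  have "u = lin_comb A M f"
    unfolding f_def u g using g \<beta>
    by (subst lin_comb_add[of M "exponents n"]) (auto split: if_splits)
  moreover have f: "keys f \<subseteq> insert \<beta> {\<gamma> \<in> exponents n. deglex n \<gamma> \<beta>}"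
    unfolding f_def using keys_add[of "Poly_Mapping.single \<beta> a" g] g
    by (fastforce simp: keys_single split: if_splits)
  ultimately have co: "coordinates A (exponents n) M u = f"
    using coordinates_lin_comb[OF b, of f] \<beta> by auto
  have "lookup g \<beta> = 0"
    using g(2) by (auto simp: not_in_keys_iff_lookup_eq_zero[symmetric])
  then have \<beta>f: "\<beta> \<in> keys f"
    using u(1) by (simp add: f_def in_keys_iff lookup_add)
  show "u \<noteq> \<zero>"
    using \<beta>f co coordinates_lin_comb[OF b, of 0] by auto
  show "lead_exp A n T (deglex_rel n) u = \<beta>"
    unfolding lead_exp_def Let_def co
  proof (rule the_equality)
    show "\<beta> \<in> keys f \<and> (\<forall>\<gamma>\<in>keys f. (\<gamma>, \<beta>) \<in> deglex_rel n)"
      using f \<beta>f \<beta> by (auto simp: deglex_rel_def)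
    show "\<alpha> = \<beta>" if "\<alpha> \<in> keys f \<and> (\<forall>\<gamma>\<in>keys f. (\<gamma>, \<alpha>) \<in> deglex_rel n)" for \<alpha>
    proof -
      have "\<beta> = \<alpha> \<or> deglex n \<beta> \<alpha>" "\<alpha> = \<beta> \<or> deglex n \<alpha> \<beta>"
        using that f \<beta>f by (auto simp: deglex_rel_def)
      then show ?thesis
        using deglex_trans[of n \<beta> \<alpha> \<beta>] by auto
    qed
  qed
qed

lemma admissible_deglex:
  assumes b: "basis_family A (exponents n) M"
  shows "admissible_order A n T (deglex_rel n)"
  unfolding admissible_order_def
proof (intro conjI ballI impI)
  show "linear_order_on (exponents n) (deglex_rel n)"
    unfolding linear_order_on_def partial_order_on_def preorder_on_def
  proof (intro conjI)
    show "trans (deglex_rel n)"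
      using deglex_trans[of n] by (auto simp: trans_def deglex_rel_def)
    show "antisym (deglex_rel n)"
      using deglex_trans[of n] by (force simp: antisym_def deglex_rel_def)
    show "total_on (exponents n) (deglex_rel n)"
      using deglex_total[of _ _ n] by (auto simp: total_on_def deglex_rel_def)
  qed (auto simp: refl_on_def deglex_rel_def)
  show "(0, \<alpha>) \<in> deglex_rel n" if "\<alpha> \<in> exponents n" for \<alpha>
    using that deglex_0[OF that] by (auto simp: deglex_rel_def)
  show "(\<alpha> + \<gamma>, \<beta> + \<gamma>) \<in> deglex_rel n - Id"
    if "\<alpha> \<in> exponents n" "\<beta> \<in> exponents n" "\<gamma> \<in> exponents n" "(\<alpha>, \<beta>) \<in> deglex_rel n - Id" for \<alpha> \<beta> \<gamma>
    using that deglex_add[of n \<alpha> \<beta> \<gamma>] by (auto simp: deglex_rel_def)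
  fix \<alpha> \<beta> assume ab: "\<alpha> \<in> exponents n" "\<beta> \<in> exponents n"
  note l = lead_exp_leading[OF b leading_mon_mult[OF ab]]
  show "M \<alpha> \<otimes> M \<beta> \<noteq> \<zero>" "lead_exp A n T (deglex_rel n) (M \<alpha> \<otimes> M \<beta>) = \<alpha> + \<beta>"
    using l ab by simp_all
qed

lemma lead_less_T:
  assumes b: "basis_family A (exponents n) M" and ij: "i \<in> {1..n}" "j \<in> {1..n}" "i < j"
  shows "lead_less A n T (deglex_rel n) (T i) (T j)"
proof -
  have "M (uexp l) = T l" if "l \<in> {1..n}" for l
    by (rule std_monomial_uexp[OF T_closed that])
  then have "leading (uexp l) (T l)" if "l \<in> {1..n}" for l
    using that leading_mon[of "uexp l"] by metis
  then show ?thesis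
    using lead_exp_leading[OF b, of "uexp i" "T i"] lead_exp_leading[OF b, of "uexp j" "T j"] ij
      deglex_uexp[OF ij]
    by (auto simp: lead_less_def deglex_rel_def)
qed

end

subsection \<open>The numbering of pairs\<close>

text \<open>The columns of the triangle of pairs are numbered consecutively. The formal value
  \<open>s_index 0 j\<close>, not itself the number of a pair, counts the pairs in the columns
  before \<open>j\<close>; comparisons between columns go through it.\<close>

lemma s_index_Suc: "s_index i (Suc j) = s_index j j + i"
proof -
  have "Suc j * j = j * (j - 1) + 2 * j"
    by (cases j) (auto simp: algebra_simps)
  then show ?thesis
    by (simp add: s_index_def)
qed

lemma s_index_add: "s_index i j = s_index 0 j + i"
  by (simp add: s_index_def)

lemma s_index_mono0: "j \<le> k \<Longrightarrow> s_index 0 j \<le> s_index 0 k"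
proof (induction k)
  case (Suc k)
  then show ?case
    using s_index_add[of k k] by (auto simp: s_index_Suc le_Suc_eq)
qed simp

lemma s_index_less:
  assumes "i \<le> j" "j < k" "1 \<le> l" shows "s_index i j < s_index l k"
proof -
  have "s_index i j \<le> s_index 0 (Suc j)"
    using assms s_index_add[of i j] s_index_add[of j j] by (simp add: s_index_Suc)
  also have "\<dots> \<le> s_index 0 k"
    using assms by (intro s_index_mono0) simp
  also have "\<dots> < s_index l k"
    using assms s_index_add[of l k] by simp
  finally show ?thesis .
qed

lemma s_index_less_same [simp]: "s_index i j < s_index l j \<longleftrightarrow> i < l"
  by (simp add: s_index_def)

lemma s_index_inj:
  assumes "1 \<le> i" "i \<le> j" "1 \<le> l" "l \<le> k" "s_index i j = s_index l k" shows "i = l \<and> j = k"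
proof -
  have "j = k"
    using s_index_less[of i j k l] s_index_less[of l k j i] assms by (cases j k rule: linorder_cases) auto
  then show ?thesis
    using assms by (simp add: s_index_def)
qed

lemma s_index_less_iff:
  assumes "1 \<le> i" "i \<le> j" "1 \<le> l" "l \<le> k"
  shows "s_index i j < s_index l k \<longleftrightarrow> j < k \<or> j = k \<and> i < l"
  using s_index_less[of i j k l] s_index_less[of l k j i] assms by (cases j k rule: linorder_cases) auto

lemma s_index_ge_1: "1 \<le> i \<Longrightarrow> 1 \<le> s_index i j"
  by (simp add: s_index_def)

lemma s_index_le:
  assumes "1 \<le> i" "i \<le> j" "j \<le> m" shows "s_index i j \<le> s_index m m"
  using s_index_less_iff[of m m i j] assms by linarith

lemma s_index_surj:
  "r \<in> {1..s_index m m} \<Longrightarrow> \<exists>i j. 1 \<le> i \<and> i \<le> j \<and> j \<le> m \<and> r = s_index i j"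
proof (induction m)
  case 0
  then show ?case by (simp add: s_index_def)
next
  case (Suc m)
  show ?case
  proof (cases "r \<le> s_index m m")
    case True
    then show ?thesis using Suc by (metis atLeastAtMost_iff le_Suc_eq)
  next
    case False
    then have "r = s_index (r - s_index m m) (Suc m)" "1 \<le> r - s_index m m" "r - s_index m m \<le> Suc m"
      using Suc.prems by (auto simp: s_index_Suc)
    then show ?thesis by blast
  qed
qed

lemma s_index_triangle: "s_index m m = m * (m + 1) div 2"
  using s_index_Suc[of 0 m] by (simp add: s_index_def mult.commute)

section \<open>Color commutation\<close>

context assoc_alg
begin

text \<open>For color-commuting homogeneous elements the factor is the bicharacter of their degrees.
  Keeping it explicit lets it multiply along products, as bicharacters do, without a grading on the
  algebra.\<close>

definition qcomm :: "'k \<Rightarrow> 'a \<Rightarrow> 'a \<Rightarrow> bool" where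
  "qcomm x a b \<longleftrightarrow> a \<otimes> b = x \<odot> (b \<otimes> a)"

lemma qcomm_mult_right:
  assumes "qcomm x a b" "qcomm y a c" and [simp]: "a \<in> carrier A" "b \<in> carrier A" "c \<in> carrier A"
  shows "qcomm (x * y) a (b \<otimes> c)"
proof -
  have "a \<otimes> (b \<otimes> c) = (x \<odot> (b \<otimes> a)) \<otimes> c"
    using assms(1) by (simp add: qcomm_def m_assoc[symmetric])
  also have "\<dots> = x \<odot> (b \<otimes> (y \<odot> (c \<otimes> a)))"
    using assms(2) by (simp add: qcomm_def m_assoc smult_mult_left)
  finally show ?thesis
    by (simp add: qcomm_def smult_mult_right smult_smult m_assoc)
qed

lemma qcomm_mult_left:
  assumes "qcomm x a c" "qcomm y b c" and [simp]: "a \<in> carrier A" "b \<in> carrier A" "c \<in> carrier A"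
  shows "qcomm (x * y) (a \<otimes> b) c"
proof -
  have "(a \<otimes> b) \<otimes> c = a \<otimes> (y \<odot> (c \<otimes> b))"
    using assms(2) by (simp add: qcomm_def m_assoc)
  also have "\<dots> = y \<odot> ((x \<odot> (c \<otimes> a)) \<otimes> b)"
    using assms(1) by (simp add: qcomm_def m_assoc[symmetric] smult_mult_right)
  finally show ?thesis
    by (simp add: qcomm_def smult_mult_left smult_smult m_assoc mult.commute)
qed

lemma qcomm_sym:
  assumes "qcomm x a b" "x * y = 1" and [simp]: "a \<in> carrier A" "b \<in> carrier A"
  shows "qcomm y b a"
  using assms(1,2) by (simp add: qcomm_def smult_smult mult.commute)

lemma qcomm_add_right:
  assumes "qcomm x a b" "qcomm x a c" and [simp]: "a \<in> carrier A" "b \<in> carrier A" "c \<in> carrier A"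
  shows "qcomm x a (b \<oplus> c)"
  using assms(1,2) by (simp add: qcomm_def r_distr l_distr smult_add_right)

lemma qcomm_add_left:
  assumes "qcomm x a c" "qcomm x b c" and [simp]: "a \<in> carrier A" "b \<in> carrier A" "c \<in> carrier A"
  shows "qcomm x (a \<oplus> b) c"
  using assms(1,2) by (simp add: qcomm_def r_distr l_distr smult_add_right)

lemma qcomm_zero_right [simp]: "a \<in> carrier A \<Longrightarrow> qcomm x a \<zero>"
  by (simp add: qcomm_def)

lemma qcomm_zero_left [simp]: "a \<in> carrier A \<Longrightarrow> qcomm x \<zero> a"
  by (simp add: qcomm_def)

lemma qcomm_finsum_right:
  assumes "finite S" "a \<in> carrier A" "\<And>i. i \<in> S \<Longrightarrow> f i \<in> carrier A" "\<And>i. i \<in> S \<Longrightarrow> qcomm x a (f i)"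
  shows "qcomm x a (\<Oplus>i\<in>S. f i)"
  using assms by (induction S) (auto intro!: qcomm_add_right simp: Pi_iff)

lemma qcomm_finsum_left:
  assumes "finite S" "a \<in> carrier A" "\<And>i. i \<in> S \<Longrightarrow> f i \<in> carrier A" "\<And>i. i \<in> S \<Longrightarrow> qcomm x (f i) a"
  shows "qcomm x (\<Oplus>i\<in>S. f i) a"
  using assms by (induction S) (auto intro!: qcomm_add_left simp: Pi_iff)

end

subsection \<open>The relations of the enveloping algebra\<close>

abbreviation (input) color_q :: "('g \<Rightarrow> 'g \<Rightarrow> 'k::field) \<Rightarrow> (nat \<Rightarrow> 'g) \<Rightarrow> nat \<Rightarrow> nat \<Rightarrow> 'k" where
  "color_q \<epsilon> d r l \<equiv> \<epsilon> (d r) (d l)"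

text \<open>In \<open>U(X)\<close> the bracket \<open>\<langle>t\<^sub>r, t\<^sub>l\<rangle>\<close>, \<open>l < r\<close>, is \<open>color_c \<epsilon> d r l\<close> times \<open>t\<^sub>k\<close> for \<open>k = color_k r l\<close>; where the
  coefficient vanishes, \<open>k = 1\<close> is a placeholder.\<close>

definition diag_pair :: "nat \<Rightarrow> nat \<Rightarrow> nat \<Rightarrow> nat \<Rightarrow> bool" where
  "diag_pair r l b j \<longleftrightarrow> 1 \<le> b \<and> b < j \<and> r = s_index j j \<and> l = s_index b b"

text \<open>Sign and factor come from skew symmetry: <x_j, x_b> with b < j has to be expressed
  through the variable with index \<open>s_index b j\<close>, which is <x_b, x_j>.\<close>

definition color_c :: "('g \<Rightarrow> 'g \<Rightarrow> 'k::field) \<Rightarrow> (nat \<Rightarrow> 'g) \<Rightarrow> nat \<Rightarrow> nat \<Rightarrow> 'k" where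
  "color_c \<epsilon> d r l = (if \<exists>b j. diag_pair r l b j then - \<epsilon> (d r) (d l) else 0)"

definition color_k :: "nat \<Rightarrow> nat \<Rightarrow> nat" where
  "color_k r l = (if \<exists>b j. diag_pair r l b j then THE k. \<exists>b j. diag_pair r l b j \<and> k = s_index b j else 1)"

lemma diag_pair_unique: "\<lbrakk>diag_pair r l b j; diag_pair r l b' j'\<rbrakk> \<Longrightarrow> b = b' \<and> j = j'"
  using s_index_inj[of j j j' j'] s_index_inj[of b b b' b'] by (auto simp: diag_pair_def)

lemma color_c_diag: "\<lbrakk>1 \<le> b; b < j\<rbrakk> \<Longrightarrow> color_c \<epsilon> d (s_index j j) (s_index b b) = - \<epsilon> (d (s_index j j)) (d (s_index b b))"
  by (auto simp: color_c_def diag_pair_def)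

lemma color_k_diag: assumes "1 \<le> b" "b < j" shows "color_k (s_index j j) (s_index b b) = s_index b j"
proof -
  have dp: "diag_pair (s_index j j) (s_index b b) b j"
    using assms by (simp add: diag_pair_def)
  have "(THE k. \<exists>b' j'. diag_pair (s_index j j) (s_index b b) b' j' \<and> k = s_index b' j') = s_index b j"
    by (rule the_equality) (use dp diag_pair_unique[OF dp] in auto)
  then show ?thesis
    using dp by (auto simp: color_k_def)
qed

lemma color_k_range: assumes "1 \<le> l" "l < r" shows "color_k r l \<in> {1..<r}"
proof (cases "\<exists>b j. diag_pair r l b j")
  case True
  then obtain b j where "1 \<le> b" "b < j" "r = s_index j j" "l = s_index b b"
    by (auto simp: diag_pair_def)
  then show ?thesis
    using color_k_diag[of b j] s_index_ge_1[of b j] by simp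
qed (use assms in \<open>auto simp: color_k_def\<close>)

lemma color_c_off:
  assumes "1 \<le> i" "i < j" shows "color_c \<epsilon> d (s_index i j) l = 0" "color_c \<epsilon> d r (s_index i j) = 0"
proof -
  have "s_index i j \<noteq> s_index k k" if "1 \<le> k" for k
    using s_index_inj[of i j k k] assms that by auto
  then have "s_index i j \<noteq> s_index b b \<and> s_index i j \<noteq> s_index k k" if "1 \<le> b" "b < k" for b k
    using that by simp
  then have "\<not> diag_pair (s_index i j) l b k \<and> \<not> diag_pair r (s_index i j) b k" for b k
    unfolding diag_pair_def by blast
  then show "color_c \<epsilon> d (s_index i j) l = 0" "color_c \<epsilon> d r (s_index i j) = 0"
    by (simp_all add: color_c_def)
qed

abbreviation color_relations where
  "color_relations \<epsilon> d A n T \<equiv> ore_relations A n T (color_q \<epsilon> d) (color_c \<epsilon> d) color_k"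

text \<open>Separates the one family with genuine brackets, the pairs of two different x_a, from the
  pairs that merely color-commute; a model has to be checked only in these two forms.\<close>

lemma color_relationsI:
  assumes A: "assoc_alg A" and T: "\<And>i. i \<in> {1..n} \<Longrightarrow> T i \<in> carrier A"
    and nz: "\<And>a b. \<epsilon> a b \<noteq> 0"
    and diag: "\<And>b j. \<lbrakk>1 \<le> b; b < j; s_index j j \<le> n\<rbrakk> \<Longrightarrow>
      T (s_index j j) \<otimes>\<^bsub>A\<^esub> T (s_index b b) = \<epsilon> (d (s_index j j)) (d (s_index b b)) \<odot>\<^bsub>A\<^esub> (T (s_index b b) \<otimes>\<^bsub>A\<^esub> T (s_index j j))
        \<oplus>\<^bsub>A\<^esub> (- \<epsilon> (d (s_index j j)) (d (s_index b b))) \<odot>\<^bsub>A\<^esub> T (s_index b j)"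
    and other: "\<And>l r. \<lbrakk>1 \<le> l; l < r; r \<le> n; \<nexists>b j. diag_pair r l b j\<rbrakk> \<Longrightarrow>
      T r \<otimes>\<^bsub>A\<^esub> T l = \<epsilon> (d r) (d l) \<odot>\<^bsub>A\<^esub> (T l \<otimes>\<^bsub>A\<^esub> T r)"
  shows "color_relations \<epsilon> d A n T"
proof (intro ore_relations.intro A ore_relations_axioms.intro T nz; assumption?)
  interpret assoc_alg A by (rule A)
  fix l r :: nat assume lr: "1 \<le> l" "l < r" "r \<le> n"
  have c: "T l \<in> carrier A" "T r \<in> carrier A" "T 1 \<in> carrier A"
    using lr T by auto
  show "color_k r l \<in> {1..<r}"
    using lr by (intro color_k_range)
  show "T r \<otimes>\<^bsub>A\<^esub> T l = \<epsilon> (d r) (d l) \<odot>\<^bsub>A\<^esub> (T l \<otimes>\<^bsub>A\<^esub> T r) \<oplus>\<^bsub>A\<^esub> color_c \<epsilon> d r l \<odot>\<^bsub>A\<^esub> T (color_k r l)"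
  proof (cases "\<exists>b j. diag_pair r l b j")
    case True
    then obtain b j where "1 \<le> b" "b < j" "r = s_index j j" "l = s_index b b"
      by (auto simp: diag_pair_def)
    then show ?thesis
      using diag[of b j] lr color_k_diag[of b j] color_c_diag[of b j \<epsilon> d] by simp
  next
    case False
    then have "color_c \<epsilon> d r l = 0" "color_k r l = 1"
      by (auto simp: color_c_def color_k_def)
    then show ?thesis
      using other[OF lr False] c by simp
  qed
qed

lemma color_relations_diag:
  assumes R: "color_relations \<epsilon> d A n T" and b: "1 \<le> b" "b < j" "s_index j j \<le> n"
  shows "T (s_index j j) \<otimes>\<^bsub>A\<^esub> T (s_index b b) = \<epsilon> (d (s_index j j)) (d (s_index b b)) \<odot>\<^bsub>A\<^esub> (T (s_index b b) \<otimes>\<^bsub>A\<^esub> T (s_index j j))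
        \<oplus>\<^bsub>A\<^esub> (- \<epsilon> (d (s_index j j)) (d (s_index b b))) \<odot>\<^bsub>A\<^esub> T (s_index b j)"
  using ore_relations.rel[OF R, of "s_index b b" "s_index j j"] b s_index_less[of b b j j] s_index_ge_1[of b b]
    color_k_diag[of b j] color_c_diag[of b j \<epsilon> d] by simp

lemma color_relations_other:
  assumes R: "color_relations \<epsilon> d A n T" and lr: "1 \<le> l" "l < r" "r \<le> n" "\<nexists>b j. diag_pair r l b j"
  shows "T r \<otimes>\<^bsub>A\<^esub> T l = \<epsilon> (d r) (d l) \<odot>\<^bsub>A\<^esub> (T l \<otimes>\<^bsub>A\<^esub> T r)"
proof -
  interpret ore_relations A n T "color_q \<epsilon> d" "color_c \<epsilon> d" color_k by (rule R)
  have "color_c \<epsilon> d r l = 0" "color_k r l = 1"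
    using lr(4) by (auto simp: color_c_def color_k_def)
  then show ?thesis
    using rel[OF lr(1-3)] lr T_closed by simp
qed

lemma color_relations_subset:
  assumes R: "color_relations \<epsilon> d A n T" and r: "r \<le> n"
  shows "color_relations \<epsilon> d A r T"
proof -
  interpret ore_relations A n T "color_q \<epsilon> d" "color_c \<epsilon> d" color_k by (rule R)
  show ?thesis
    by unfold_locales (use r T_closed q_nz \<kappa> rel in auto)
qed

section \<open>A faithful representation\<close>

text \<open>The functions play the role of linear forms on the span of the monomials, which is why
  no finiteness of supports is imposed on them.\<close>

definition op_algebra :: "('k::field, ('s \<Rightarrow> 'k) \<Rightarrow> ('s \<Rightarrow> 'k)) module" where
  "op_algebra =
     \<lparr>carrier = {F. (\<forall>f g. F (\<lambda>x. f x + g x) = (\<lambda>x. F f x + F g x)) \<and>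
                    (\<forall>c f. F (\<lambda>x. c * f x) = (\<lambda>x. c * F f x))},
      monoid.mult = (\<lambda>F G f. F (G f)), one = (\<lambda>f. f), zero = (\<lambda>f x. 0),
      add = (\<lambda>F G f x. F f x + G f x), smult = (\<lambda>c F f x. c * F f x)\<rparr>"

lemma op_algebra_simps [simp]:
  "monoid.mult op_algebra F G = (\<lambda>f. F (G f))" "one op_algebra = (\<lambda>f. f)"
  "zero op_algebra = (\<lambda>f x. 0)" "add op_algebra F G = (\<lambda>f x. F f x + G f x)"
  "smult op_algebra c F = (\<lambda>f x. c * F f x)"
  by (simp_all add: op_algebra_def)

lemma op_algebra_carrier:
  "F \<in> carrier op_algebra \<longleftrightarrow> (\<forall>f g. F (\<lambda>x. f x + g x) = (\<lambda>x. F f x + F g x)) \<and>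
     (\<forall>c f. F (\<lambda>x. c * f x) = (\<lambda>x. c * F f x))"
  by (simp add: op_algebra_def)

lemma op_algebra_assoc_alg: "assoc_alg op_algebra"
proof (rule assoc_algI)
  show "abelian_group op_algebra"
  proof (rule abelian_groupI)
    show "\<exists>y\<in>carrier op_algebra. y \<oplus>\<^bsub>op_algebra\<^esub> x = \<zero>\<^bsub>op_algebra\<^esub>"
      if "x \<in> carrier op_algebra" for x :: "('s \<Rightarrow> 'k) \<Rightarrow> ('s \<Rightarrow> 'k::field)"
      by (rule bexI[of _ "\<lambda>f y. - x f y"]) (use that in \<open>auto simp: op_algebra_carrier\<close>)
  qed (auto simp: op_algebra_carrier algebra_simps)
  show "Group.monoid op_algebra"
    by (rule Group.monoidI) (auto simp: op_algebra_carrier)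
qed (auto simp: op_algebra_carrier algebra_simps)

lemma op_algebra_finsum:
  assumes "finite S" "\<And>i. i \<in> S \<Longrightarrow> F i \<in> carrier op_algebra"
  shows "(\<Oplus>\<^bsub>op_algebra\<^esub>i\<in>S. F i) f x = (\<Sum>i\<in>S. F i f x)"
proof -
  interpret assoc_alg op_algebra by (rule op_algebra_assoc_alg)
  show ?thesis
    using assms by (induction S) (auto simp: Pi_iff)
qed

text \<open>The operators below are the transposes of right multiplication on the standard monomials:
  \<open>\<theta> r\<close> belongs to the associated graded algebra, where the variables merely commute up to scalars,
  and \<open>X\<^sub>i = \<theta>\<^sub>i + \<Sum>\<^sub>j Z\<^sub>i\<^sub>j \<partial>\<^sub>j\<close> adds the brackets that arise when
  \<open>x\<^sub>i\<close> is moved to the left past an odd power of \<open>x\<^sub>j\<close> for some \<open>j > i\<close>.\<close>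

locale generic_degrees =
  fixes \<epsilon> :: "'g::ab_group_add \<Rightarrow> 'g \<Rightarrow> 'k::field" and m :: nat and d :: "nat \<Rightarrow> 'g"
  assumes bichar: "skew_bicharacter \<epsilon>"
    and d_odd: "j \<in> {1..m} \<Longrightarrow> \<epsilon> (d (s_index j j)) (d (s_index j j)) = - 1"
    and d_pair: "\<lbrakk>1 \<le> i; i < j; j \<le> m\<rbrakk> \<Longrightarrow> d (s_index i j) = d (s_index i i) + d (s_index j j)"
begin

abbreviation "n \<equiv> s_index m m"
abbreviation "D j \<equiv> s_index j j"

lemma \<epsilon>_nz [simp]: "\<epsilon> a b \<noteq> 0"
  using bichar by (simp add: skew_bicharacter_def)

lemma \<epsilon>_add_right: "\<epsilon> a (b + c) = \<epsilon> a b * \<epsilon> a c"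
  using bichar by (simp add: skew_bicharacter_def)

lemma \<epsilon>_add_left: "\<epsilon> (b + c) a = \<epsilon> b a * \<epsilon> c a"
  using bichar by (simp add: skew_bicharacter_def)

lemma \<epsilon>_swap [simp]: "\<epsilon> a b * \<epsilon> b a = 1"
  using bichar by (simp add: skew_bicharacter_def)

text \<open>In the associated graded algebra a factor t_r on the right of a monomial moves left past
  the powers of all t_l with l > r; this is the accumulated scalar. Exponents are plain functions
  here, so that they can be updated pointwise.\<close>

definition \<phi> :: "nat \<Rightarrow> (nat \<Rightarrow> nat) \<Rightarrow> 'k" where
  "\<phi> r \<alpha> = (\<Prod>l\<in>{r<..n}. \<epsilon> (d l) (d r) ^ \<alpha> l)"

definition \<theta> :: "nat \<Rightarrow> ((nat \<Rightarrow> nat) \<Rightarrow> 'k) \<Rightarrow> ((nat \<Rightarrow> nat) \<Rightarrow> 'k)" where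
  "\<theta> r f \<alpha> = \<phi> r \<alpha> * f (\<alpha>(r := Suc (\<alpha> r)))"

text \<open>Undoes \<open>\<theta> b\<close> at odd exponents and vanishes at even ones, because the
  brackets obtained at two successive factors x_j cancel. Thus \<open>dop b\<close> squares to zero
  and satisfies the Clifford-type identity \<open>dop_\<theta>_same\<close>.\<close>

definition dop :: "nat \<Rightarrow> ((nat \<Rightarrow> nat) \<Rightarrow> 'k) \<Rightarrow> ((nat \<Rightarrow> nat) \<Rightarrow> 'k)" where
  "dop b f \<alpha> = (if odd (\<alpha> b) then inverse (\<phi> b \<alpha>) * f (\<alpha>(b := \<alpha> b - 1)) else 0)"

lemma \<phi>_nz [simp]: "\<phi> r \<alpha> \<noteq> 0"
  by (simp add: \<phi>_def)

lemma \<phi>_upd: "l \<le> r \<Longrightarrow> \<phi> r (\<alpha>(l := a)) = \<phi> r \<alpha>"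
  by (auto simp: \<phi>_def intro!: prod.cong)

lemma \<phi>_Suc:
  assumes "r < l" "l \<le> n" shows "\<phi> r (\<alpha>(l := Suc (\<alpha> l))) = \<epsilon> (d l) (d r) * \<phi> r \<alpha>"
proof -
  have "\<phi> r \<beta> = \<epsilon> (d l) (d r) ^ \<beta> l * (\<Prod>k\<in>{r<..n} - {l}. \<epsilon> (d k) (d r) ^ \<beta> k)" for \<beta>
    unfolding \<phi>_def by (rule prod.remove) (use assms in auto)
  then show ?thesis by simp
qed

lemma \<phi>_pred:
  assumes "r < l" "l \<le> n" "\<alpha> l \<noteq> 0"
  shows "\<phi> r (\<alpha>(l := \<alpha> l - Suc 0)) = \<phi> r \<alpha> * \<epsilon> (d r) (d l)"
  using \<phi>_Suc[OF assms(1,2), of "\<alpha>(l := \<alpha> l - Suc 0)"] assms(3) \<epsilon>_swap[of "d l" "d r"]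
  by (simp add: mult.commute mult.left_commute)

lemma \<theta>_comm:
  assumes "l < r" "r \<le> n" shows "\<theta> r (\<theta> l f) = (\<lambda>\<alpha>. \<epsilon> (d r) (d l) * \<theta> l (\<theta> r f) \<alpha>)"
  using assms by (simp add: fun_eq_iff \<theta>_def \<phi>_Suc \<phi>_upd fun_upd_twist)

text \<open>Lowering an exponent has degree \<open>- d b\<close>, so the expected factor is
  \<epsilon>(- d b, d r), which equals \<epsilon>(d r, d b) by skew symmetry.\<close>

lemma dop_\<theta>:
  assumes "r \<noteq> b" "r \<le> n" "b \<le> n" shows "dop b (\<theta> r f) = (\<lambda>\<alpha>. \<epsilon> (d r) (d b) * \<theta> r (dop b f) \<alpha>)"
proof (rule ext)
  fix \<alpha>
  show "dop b (\<theta> r f) \<alpha> = \<epsilon> (d r) (d b) * \<theta> r (dop b f) \<alpha>"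
  proof (cases "r < b")
    case True
    then show ?thesis
      using assms \<phi>_pred[of r b \<alpha>]
      by (auto simp: \<theta>_def dop_def \<phi>_upd fun_upd_twist[of b r] odd_pos)
  next
    case False
    then show ?thesis
      using assms \<phi>_Suc[of b r \<alpha>]
      by (auto simp: \<theta>_def dop_def \<phi>_upd fun_upd_twist[of b r])
  qed
qed

lemma dop_dop:
  assumes "b < c" "b \<le> n" "c \<le> n" shows "dop b (dop c f) = (\<lambda>\<alpha>. \<epsilon> (d b) (d c) * dop c (dop b f) \<alpha>)"
proof (rule ext)
  fix \<alpha>
  show "dop b (dop c f) \<alpha> = \<epsilon> (d b) (d c) * dop c (dop b f) \<alpha>"
    using assms \<phi>_pred[of b c \<alpha>] 
    by (auto simp: dop_def \<phi>_upd fun_upd_twist[of b c] odd_pos field_simps)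
qed

lemma dop_dop_same: "dop b (dop b f) = (\<lambda>\<alpha>. 0)"
  by (auto simp: dop_def fun_eq_iff)

lemma dop_\<theta>_same: "dop b (\<theta> b f) \<alpha> + \<theta> b (dop b f) \<alpha> = f \<alpha>"
  by (auto simp: dop_def \<theta>_def \<phi>_upd odd_pos)

abbreviation \<O> :: "('k, ((nat \<Rightarrow> nat) \<Rightarrow> 'k) \<Rightarrow> ((nat \<Rightarrow> nat) \<Rightarrow> 'k)) module" where
  "\<O> \<equiv> op_algebra"

lemma \<theta>_closed [simp]: "\<theta> r \<in> carrier \<O>"
  by (auto simp: op_algebra_carrier \<theta>_def fun_eq_iff algebra_simps)

lemma dop_closed [simp]: "dop r \<in> carrier \<O>"
  by (auto simp: op_algebra_carrier dop_def fun_eq_iff algebra_simps)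


section \<open>The operators of the generators and their relations\<close>

definition N :: "nat \<Rightarrow> ((nat \<Rightarrow> nat) \<Rightarrow> 'k) \<Rightarrow> ((nat \<Rightarrow> nat) \<Rightarrow> 'k)" where
  "N i = (\<Oplus>\<^bsub>\<O>\<^esub>j\<in>{i<..m}. \<theta> (s_index i j) \<otimes>\<^bsub>\<O>\<^esub> dop (D j))"

definition X :: "nat \<Rightarrow> ((nat \<Rightarrow> nat) \<Rightarrow> 'k) \<Rightarrow> ((nat \<Rightarrow> nat) \<Rightarrow> 'k)" where
  "X i = \<theta> (D i) \<oplus>\<^bsub>\<O>\<^esub> N i"

definition Top :: "nat \<Rightarrow> ((nat \<Rightarrow> nat) \<Rightarrow> 'k) \<Rightarrow> ((nat \<Rightarrow> nat) \<Rightarrow> 'k)" where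
  "Top r = (if \<exists>j\<in>{1..m}. r = D j then X (THE j. j \<in> {1..m} \<and> r = D j) else \<theta> r)"

lemma D_inj: "\<lbrakk>1 \<le> i; 1 \<le> j; D i = D j\<rbrakk> \<Longrightarrow> i = j"
  using s_index_inj[of i i j j] by simp

lemma D_neq: "\<lbrakk>1 \<le> i; i < j; 1 \<le> k\<rbrakk> \<Longrightarrow> s_index i j \<noteq> D k"
  using s_index_inj[of i j k k] by auto

lemma Top_D: assumes "j \<in> {1..m}" shows "Top (D j) = X j"
proof -
  have "(THE i. i \<in> {1..m} \<and> D j = D i) = j"
    by (rule the_equality) (use assms D_inj in auto)
  then show ?thesis using assms by (auto simp: Top_def)
qed

lemma Top_off: "\<lbrakk>1 \<le> i; i < j\<rbrakk> \<Longrightarrow> Top (s_index i j) = \<theta> (s_index i j)"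
  using D_neq by (auto simp: Top_def)

sublocale O: assoc_alg \<O>
  by (rule op_algebra_assoc_alg)

lemma N_closed [simp]: "N i \<in> carrier \<O>"
  unfolding N_def by (intro O.finsum_closed) (auto simp del: op_algebra_simps)

lemma X_closed [simp]: "X i \<in> carrier \<O>"
  unfolding X_def by (intro O.add.m_closed) auto

lemma Top_closed [simp]: "Top r \<in> carrier \<O>"
  by (auto simp: Top_def)

text \<open>The case \<open>r = s\<close> has to be guarded: every operator commutes with itself
  with factor 1, whereas \<epsilon>(x_j, x_j) = -1.\<close>

lemma qcomm_\<theta>:
  assumes "r \<le> n" "s \<le> n" "r \<noteq> s \<or> \<epsilon> (d r) (d r) = 1"
  shows "O.qcomm (\<epsilon> (d r) (d s)) (\<theta> r) (\<theta> s)"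
proof (cases r s rule: linorder_cases)
  case less
  have "O.qcomm (\<epsilon> (d s) (d r)) (\<theta> s) (\<theta> r)"
    using less assms by (auto simp: O.qcomm_def \<theta>_comm)
  then show ?thesis by (rule O.qcomm_sym) auto
qed (use assms in \<open>auto simp: O.qcomm_def \<theta>_comm\<close>)

lemma qcomm_dop_\<theta>:
  assumes "r \<le> n" "b \<le> n" "r \<noteq> b" shows "O.qcomm (\<epsilon> (d r) (d b)) (dop b) (\<theta> r)"
  using assms by (simp add: O.qcomm_def dop_\<theta>)

lemma qcomm_\<theta>_dop:
  assumes "r \<le> n" "b \<le> n" "r \<noteq> b" shows "O.qcomm (\<epsilon> (d b) (d r)) (\<theta> r) (dop b)"
  by (rule O.qcomm_sym[OF qcomm_dop_\<theta>[OF assms]]) auto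

lemma qcomm_dop:
  assumes "b \<le> n" "c \<le> n" "b \<noteq> c" shows "O.qcomm (\<epsilon> (d b) (d c)) (dop b) (dop c)"
proof (cases b c rule: linorder_cases)
  case greater
  have "O.qcomm (\<epsilon> (d c) (d b)) (dop c) (dop b)"
    using greater assms by (auto simp: O.qcomm_def dop_dop)
  then show ?thesis by (rule O.qcomm_sym) auto
qed (use assms in \<open>auto simp: O.qcomm_def dop_dop\<close>)

abbreviation "Z i j \<equiv> \<theta> (s_index i j)"
abbreviation "W i j \<equiv> Z i j \<otimes>\<^bsub>\<O>\<^esub> dop (D j)"

lemma W_closed: "W i j \<in> carrier \<O>"
  by (intro O.m_closed \<theta>_closed dop_closed)

lemma d_pair_even: assumes "1 \<le> i" "i < j" "j \<le> m" shows "\<epsilon> (d (s_index i j)) (d (s_index i j)) = 1"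
  using assms d_odd[of i] d_odd[of j] \<epsilon>_swap[of "d (D i)" "d (D j)"]
  by (simp add: d_pair \<epsilon>_add_left \<epsilon>_add_right mult.commute)

text \<open>\<open>W i j\<close> has degree \<open>d (s_index i j) - d (D j)\<close>, that is
  \<open>d (D i)\<close>. So every summand of \<open>N i\<close> color-commutes as x_i itself would.
  The index \<open>D j\<close> is left out, since \<open>dop (D j)\<close> and
  \<open>\<theta> (D j)\<close> are related by \<open>dop_\<theta>_same\<close> instead.\<close>

lemma qcomm_\<theta>_W:
  assumes ij: "1 \<le> i" "i < j" "j \<le> m"
    and r: "(\<exists>a b. 1 \<le> a \<and> a < b \<and> b \<le> m \<and> r = s_index a b) \<or> (\<exists>k\<in>{1..m}. k \<noteq> j \<and> r = D k)"
  shows "O.qcomm (\<epsilon> (d r) (d (D i))) (\<theta> r) (W i j)"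
proof -
  have le: "s_index i j \<le> n" "D j \<le> n" "r \<le> n"
    using ij r by (auto intro!: s_index_le)
  have neq: "r \<noteq> D j"
    using r
  proof (elim disjE exE bexE conjE)
    fix a b assume "1 \<le> a" "a < b" "r = s_index a b"
    then show ?thesis using D_neq[of a b j] ij by simp
  next
    fix k assume "k \<in> {1..m}" "k \<noteq> j" "r = D k"
    then show ?thesis using D_inj[of k j] ij by auto
  qed
  have neq2: "r \<noteq> s_index i j \<or> \<epsilon> (d r) (d r) = 1"
    using d_pair_even ij by auto
  have "O.qcomm (\<epsilon> (d r) (d (s_index i j)) * \<epsilon> (d (D j)) (d r)) (\<theta> r) (W i j)"
    by (rule O.qcomm_mult_right[OF qcomm_\<theta> qcomm_\<theta>_dop]) (use le neq neq2 in auto)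
  then show ?thesis
    using ij by (simp add: d_pair \<epsilon>_add_right mult.assoc)
qed

lemma qcomm_W_\<theta>:
  assumes "1 \<le> i" "i < j" "j \<le> m"
    "(\<exists>a b. 1 \<le> a \<and> a < b \<and> b \<le> m \<and> r = s_index a b) \<or> (\<exists>k\<in>{1..m}. k \<noteq> j \<and> r = D k)"
  shows "O.qcomm (\<epsilon> (d (D i)) (d r)) (W i j) (\<theta> r)"
  by (rule O.qcomm_sym[OF qcomm_\<theta>_W[OF assms]]) (use W_closed in auto)

lemmas qcomm_Z_W = qcomm_\<theta>_W[OF _ _ _ disjI1, OF _ _ _ exI, OF _ _ _ exI, OF _ _ _ conjI, OF _ _ _ _ conjI,
    OF _ _ _ _ _ conjI, OF _ _ _ _ _ _ refl]
lemmas qcomm_\<theta>D_W = qcomm_\<theta>_W[OF _ _ _ disjI2, OF _ _ _ bexI, OF _ _ _ conjI, OF _ _ _ _ refl]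
lemmas qcomm_W_\<theta>D = qcomm_W_\<theta>[OF _ _ _ disjI2, OF _ _ _ bexI, OF _ _ _ conjI, OF _ _ _ _ refl]

lemma dop_W:
  assumes "1 \<le> i" "i < j" "j \<le> m" shows "dop (D j) \<otimes>\<^bsub>\<O>\<^esub> W i j = \<zero>\<^bsub>\<O>\<^esub>"
proof -
  have "s_index i j \<noteq> D j" "s_index i j \<le> n" "D j \<le> n"
    using assms D_neq[of i j j] by (auto intro!: s_index_le)
  then show ?thesis
    by (simp add: dop_\<theta> dop_dop_same fun_eq_iff \<theta>_def[of _ "\<lambda>\<alpha>. 0"])
qed

text \<open>For \<open>j = l\<close> both products vanish by \<open>dop_W\<close>. Otherwise the
  four factors color-commute pairwise, and the scalars involving \<open>D j\<close> or
  \<open>D l\<close> cancel.\<close>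

lemma qcomm_W_W:
  assumes ij: "1 \<le> i" "i < j" "j \<le> m" and kl: "1 \<le> k" "k < l" "l \<le> m"
  shows "O.qcomm (\<epsilon> (d (D i)) (d (D k))) (W i j) (W k l)"
proof (cases "j = l")
  case True
  have "W i j \<otimes>\<^bsub>\<O>\<^esub> W k l = \<zero>\<^bsub>\<O>\<^esub>" "W k l \<otimes>\<^bsub>\<O>\<^esub> W i j = \<zero>\<^bsub>\<O>\<^esub>"
    using True dop_W[of k j] dop_W[of i j] assms W_closed
    by (simp_all add: O.m_assoc del: op_algebra_simps)
  then show ?thesis
    by (simp add: O.qcomm_def del: op_algebra_simps)
next
  case False
  have le: "s_index k l \<le> n" "D j \<le> n" "D l \<le> n"
    using assms by (auto intro!: s_index_le)
  have neq: "s_index k l \<noteq> D j" "D j \<noteq> D l"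
    using D_neq[of k l j] D_inj[of j l] assms False by auto
  have 1: "O.qcomm (\<epsilon> (d (s_index i j)) (d (D k))) (Z i j) (W k l)"
    by (rule qcomm_\<theta>_W) (use assms in auto)
  have 2: "O.qcomm (\<epsilon> (d (s_index k l)) (d (D j)) * \<epsilon> (d (D j)) (d (D l))) (dop (D j)) (W k l)"
    by (rule O.qcomm_mult_right[OF qcomm_dop_\<theta> qcomm_dop]) (use le neq in auto)
  have "O.qcomm (\<epsilon> (d (s_index i j)) (d (D k)) * (\<epsilon> (d (s_index k l)) (d (D j)) * \<epsilon> (d (D j)) (d (D l)))) (W i j) (W k l)"
    by (rule O.qcomm_mult_left[OF 1 2]) (use W_closed in auto)
  moreover have "\<epsilon> (d (s_index i j)) (d (D k)) * (\<epsilon> (d (s_index k l)) (d (D j)) * \<epsilon> (d (D j)) (d (D l))) =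
    \<epsilon> (d (D i)) (d (D k)) * (\<epsilon> (d (D j)) (d (D k)) * \<epsilon> (d (D k)) (d (D j))) * (\<epsilon> (d (D l)) (d (D j)) * \<epsilon> (d (D j)) (d (D l)))"
    using assms by (simp add: d_pair \<epsilon>_add_left del: \<epsilon>_swap)
  ultimately show ?thesis by simp
qed

lemma qcomm_Z_X:
  assumes "1 \<le> a" "a < b" "b \<le> m" "i \<in> {1..m}"
  shows "O.qcomm (\<epsilon> (d (s_index a b)) (d (D i))) (Z a b) (X i)"
  unfolding X_def
proof (rule O.qcomm_add_right)
  show "O.qcomm (\<epsilon> (d (s_index a b)) (d (D i))) (Z a b) (\<theta> (D i))"
    by (rule qcomm_\<theta>) (use assms D_neq[of a b i] in \<open>auto intro!: s_index_le\<close>)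
  show "O.qcomm (\<epsilon> (d (s_index a b)) (d (D i))) (Z a b) (N i)"
    unfolding N_def by (rule O.qcomm_finsum_right) (use assms W_closed in \<open>auto intro!: qcomm_Z_W simp del: op_algebra_simps\<close>)
qed auto

text \<open>The only source of a bracket: \<open>dop (D j)\<close> and \<open>\<theta> (D j)\<close>
  anticommute up to the identity, and the identity leaves \<open>Z i j\<close>. The minus sign of
  the anticommutation is compensated by \<epsilon>(x_j, x_j) = -1, which is hidden in the factor
  between \<open>Z i j\<close> and \<open>\<theta> (D j)\<close>.\<close>

lemma W_\<theta>_same:
  assumes ij: "1 \<le> i" "i < j" "j \<le> m"
  shows "W i j \<otimes>\<^bsub>\<O>\<^esub> \<theta> (D j) = \<epsilon> (d (D i)) (d (D j)) \<odot>\<^bsub>\<O>\<^esub> (\<theta> (D j) \<otimes>\<^bsub>\<O>\<^esub> W i j) \<oplus>\<^bsub>\<O>\<^esub> Z i j"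
proof -
  have same: "dop (D j) \<otimes>\<^bsub>\<O>\<^esub> \<theta> (D j) \<oplus>\<^bsub>\<O>\<^esub> \<theta> (D j) \<otimes>\<^bsub>\<O>\<^esub> dop (D j) = \<one>\<^bsub>\<O>\<^esub>"
    by (simp add: fun_eq_iff dop_\<theta>_same)
  have "Z i j \<otimes>\<^bsub>\<O>\<^esub> \<theta> (D j) = \<epsilon> (d (s_index i j)) (d (D j)) \<odot>\<^bsub>\<O>\<^esub> (\<theta> (D j) \<otimes>\<^bsub>\<O>\<^esub> Z i j)"
    using qcomm_\<theta>[of "s_index i j" "D j"] D_neq[of i j j] assms s_index_le[of i j m] s_index_le[of j j m]
    by (simp add: O.qcomm_def del: op_algebra_simps)
  moreover have "\<epsilon> (d (s_index i j)) (d (D j)) = - \<epsilon> (d (D i)) (d (D j))"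
    using assms d_odd[of j] by (simp add: d_pair \<epsilon>_add_left)
  ultimately have c: "\<theta> (D j) \<otimes>\<^bsub>\<O>\<^esub> Z i j = (- \<epsilon> (d (D j)) (d (D i))) \<odot>\<^bsub>\<O>\<^esub> (Z i j \<otimes>\<^bsub>\<O>\<^esub> \<theta> (D j))"
    using \<epsilon>_swap[of "d (D j)" "d (D i)"] by (simp add: O.smult_smult del: op_algebra_simps)
  have "Z i j = Z i j \<otimes>\<^bsub>\<O>\<^esub> (dop (D j) \<otimes>\<^bsub>\<O>\<^esub> \<theta> (D j) \<oplus>\<^bsub>\<O>\<^esub> \<theta> (D j) \<otimes>\<^bsub>\<O>\<^esub> dop (D j))"
    unfolding same by (simp del: op_algebra_simps)
  also have "\<dots> = W i j \<otimes>\<^bsub>\<O>\<^esub> \<theta> (D j) \<oplus>\<^bsub>\<O>\<^esub> (Z i j \<otimes>\<^bsub>\<O>\<^esub> \<theta> (D j)) \<otimes>\<^bsub>\<O>\<^esub> dop (D j)"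
    by (simp add: O.r_distr O.m_assoc del: op_algebra_simps)
  finally have z: "Z i j = \<dots>" .
  have "\<epsilon> (d (D i)) (d (D j)) \<odot>\<^bsub>\<O>\<^esub> (\<theta> (D j) \<otimes>\<^bsub>\<O>\<^esub> W i j) =
      \<epsilon> (d (D i)) (d (D j)) \<odot>\<^bsub>\<O>\<^esub> ((\<theta> (D j) \<otimes>\<^bsub>\<O>\<^esub> Z i j) \<otimes>\<^bsub>\<O>\<^esub> dop (D j))"
    by (simp add: O.m_assoc del: op_algebra_simps)
  also have "\<dots> = \<ominus>\<^bsub>\<O>\<^esub> ((Z i j \<otimes>\<^bsub>\<O>\<^esub> \<theta> (D j)) \<otimes>\<^bsub>\<O>\<^esub> dop (D j))"
    unfolding c by (simp add: O.smult_mult_left O.smult_smult O.smult_minus_left O.smult_minus_right O.l_minus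
      del: op_algebra_simps)
  finally have "\<epsilon> (d (D i)) (d (D j)) \<odot>\<^bsub>\<O>\<^esub> (\<theta> (D j) \<otimes>\<^bsub>\<O>\<^esub> W i j) = \<dots>" .
  then have "\<epsilon> (d (D i)) (d (D j)) \<odot>\<^bsub>\<O>\<^esub> (\<theta> (D j) \<otimes>\<^bsub>\<O>\<^esub> W i j) \<oplus>\<^bsub>\<O>\<^esub> Z i j =
     \<ominus>\<^bsub>\<O>\<^esub> ((Z i j \<otimes>\<^bsub>\<O>\<^esub> \<theta> (D j)) \<otimes>\<^bsub>\<O>\<^esub> dop (D j)) \<oplus>\<^bsub>\<O>\<^esub> (W i j \<otimes>\<^bsub>\<O>\<^esub> \<theta> (D j) \<oplus>\<^bsub>\<O>\<^esub> (Z i j \<otimes>\<^bsub>\<O>\<^esub> \<theta> (D j)) \<otimes>\<^bsub>\<O>\<^esub> dop (D j))"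
    using z by (simp only:)
  also have "\<dots> = W i j \<otimes>\<^bsub>\<O>\<^esub> \<theta> (D j)"
  proof -
    have "\<ominus>\<^bsub>\<O>\<^esub> v \<oplus>\<^bsub>\<O>\<^esub> (u \<oplus>\<^bsub>\<O>\<^esub> v) = u" if "u \<in> carrier \<O>" "v \<in> carrier \<O>" for u v
      using that O.a_lcomm[of "\<ominus>\<^bsub>\<O>\<^esub> v" u v] by (simp add: O.l_neg del: op_algebra_simps)
    then show ?thesis
      using W_closed by (simp del: op_algebra_simps)
  qed
  finally show ?thesis by (rule sym)
qed

text \<open>In the expansion of the product everything color-commutes with the factor of x_i and
  x_j, except \<open>W i j\<close> with \<open>\<theta> (D j)\<close>; that product adds
  \<open>Z i j\<close>.\<close>

lemma X_X:
  assumes ij: "1 \<le> i" "i < j" "j \<le> m"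
  shows "X i \<otimes>\<^bsub>\<O>\<^esub> X j = \<epsilon> (d (D i)) (d (D j)) \<odot>\<^bsub>\<O>\<^esub> (X j \<otimes>\<^bsub>\<O>\<^esub> X i) \<oplus>\<^bsub>\<O>\<^esub> Z i j"
proof -
  let ?e = "\<epsilon> (d (D i)) (d (D j))"
  have 1: "O.qcomm ?e (\<theta> (D i)) (\<theta> (D j))"
    by (rule qcomm_\<theta>) (use assms D_inj[of i j] in \<open>auto intro!: s_index_le\<close>)
  have 2: "O.qcomm ?e (\<theta> (D i)) (N j)"
    unfolding N_def by (rule O.qcomm_finsum_right)
      (use assms W_closed in \<open>auto intro!: qcomm_\<theta>D_W simp del: op_algebra_simps\<close>)
  have 3: "O.qcomm ?e (N i) (N j)"
    unfolding N_def
    by (rule O.qcomm_finsum_right; (rule O.qcomm_finsum_left)?)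
      (use assms W_closed in \<open>auto intro!: qcomm_W_W simp del: op_algebra_simps\<close>)
  define R where "R = (\<Oplus>\<^bsub>\<O>\<^esub>l\<in>{i<..m} - {j}. W i l)"
  have R [simp]: "R \<in> carrier \<O>"
    unfolding R_def using W_closed by (intro O.finsum_closed) blast
  have Wc [simp]: "W i j \<in> carrier \<O>" by (rule W_closed)
  have "{i<..m} = insert j ({i<..m} - {j})"
    using assms by auto
  then have N: "N i = W i j \<oplus>\<^bsub>\<O>\<^esub> R"
    unfolding N_def R_def
    using O.finsum_insert[of "{i<..m} - {j}" j "\<lambda>l. W i l"] W_closed by (simp del: op_algebra_simps)
  have "O.qcomm ?e R (\<theta> (D j))"
    unfolding R_def by (rule O.qcomm_finsum_left)
      (use assms W_closed in \<open>auto intro!: qcomm_W_\<theta>D simp del: op_algebra_simps\<close>)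
  then have "N i \<otimes>\<^bsub>\<O>\<^esub> \<theta> (D j) = (?e \<odot>\<^bsub>\<O>\<^esub> (\<theta> (D j) \<otimes>\<^bsub>\<O>\<^esub> W i j) \<oplus>\<^bsub>\<O>\<^esub> Z i j) \<oplus>\<^bsub>\<O>\<^esub> ?e \<odot>\<^bsub>\<O>\<^esub> (\<theta> (D j) \<otimes>\<^bsub>\<O>\<^esub> R)"
    unfolding N using W_\<theta>_same[OF ij]
    by (simp add: O.l_distr O.qcomm_def del: op_algebra_simps)
  also have "\<dots> = ?e \<odot>\<^bsub>\<O>\<^esub> (\<theta> (D j) \<otimes>\<^bsub>\<O>\<^esub> N i) \<oplus>\<^bsub>\<O>\<^esub> Z i j"
    unfolding N by (simp add: O.r_distr O.smult_add_right O.a_ac del: op_algebra_simps)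
  finally have 4: "N i \<otimes>\<^bsub>\<O>\<^esub> \<theta> (D j) = \<dots>" .
  show ?thesis
    unfolding X_def using 1 2 3 4
    by (simp add: O.qcomm_def O.l_distr O.r_distr O.smult_add_right O.a_ac del: op_algebra_simps)
qed

theorem Top_relations: "color_relations \<epsilon> d \<O> n Top"
proof (rule color_relationsI)
  show "assoc_alg \<O>" by (rule op_algebra_assoc_alg)
  show "Top (D j) \<otimes>\<^bsub>\<O>\<^esub> Top (D b) = \<epsilon> (d (D j)) (d (D b)) \<odot>\<^bsub>\<O>\<^esub> (Top (D b) \<otimes>\<^bsub>\<O>\<^esub> Top (D j))
     \<oplus>\<^bsub>\<O>\<^esub> (- \<epsilon> (d (D j)) (d (D b))) \<odot>\<^bsub>\<O>\<^esub> Top (s_index b j)"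
    if "1 \<le> b" "b < j" "D j \<le> n" for b j
  proof -
    have j: "j \<le> m"
      using that s_index_less_iff[of m m j j] by (cases "m = 0") (auto simp: s_index_def not_less[symmetric])
    \<comment> \<open>\<open>X_X\<close> concerns the opposite order of the factors; it is solved
      for this one, the two scalars being inverse to each other.\<close>
    have "X j \<otimes>\<^bsub>\<O>\<^esub> X b = \<epsilon> (d (D j)) (d (D b)) \<odot>\<^bsub>\<O>\<^esub> (X b \<otimes>\<^bsub>\<O>\<^esub> X j) \<oplus>\<^bsub>\<O>\<^esub> (- \<epsilon> (d (D j)) (d (D b))) \<odot>\<^bsub>\<O>\<^esub> Z b j"
      unfolding X_X[OF that(1,2) j]
      by (simp add: O.smult_add_right O.smult_smult O.smult_minus_left O.a_assoc O.r_neg del: op_algebra_simps)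
    then show ?thesis
      using that j Top_D[of j] Top_D[of b] Top_off[of b j] by (simp del: op_algebra_simps)
  qed
  show "Top r \<otimes>\<^bsub>\<O>\<^esub> Top l = \<epsilon> (d r) (d l) \<odot>\<^bsub>\<O>\<^esub> (Top l \<otimes>\<^bsub>\<O>\<^esub> Top r)"
    if lr: "1 \<le> l" "l < r" "r \<le> n" and nd: "\<nexists>b j. diag_pair r l b j" for l r
  proof -
    obtain i j where ij: "1 \<le> i" "i \<le> j" "j \<le> m" "r = s_index i j"
      using s_index_surj[of r m] lr by auto
    obtain a b where ab: "1 \<le> a" "a \<le> b" "b \<le> m" "l = s_index a b"
      using s_index_surj[of l m] lr by auto
    have "O.qcomm (\<epsilon> (d r) (d l)) (Top r) (Top l)"
    proof (cases "i < j")
      case i: True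
      show ?thesis
      proof (cases "a < b")
        case True
        then show ?thesis
          using i ij ab lr Top_off by (auto intro!: qcomm_\<theta> s_index_le)
      next
        case False
        then show ?thesis
          using i ij ab Top_off[of i j] Top_D[of b] qcomm_Z_X[of i j b] by simp
      qed
    next
      case i: False
      show ?thesis
      proof (cases "a < b")
        case True
        then have "O.qcomm (\<epsilon> (d l) (d r)) (Top l) (Top r)"
          using i ij ab Top_off[of a b] Top_D[of j] qcomm_Z_X[of a b j] by simp
        then show ?thesis
          by (rule O.qcomm_sym) auto
      next
        case False
        then have "diag_pair r l b j"
          using i ij ab lr s_index_less_iff[of b b j j] by (auto simp: diag_pair_def)
        then show ?thesis using nd by blast
      qed
    qed
    then show ?thesis by (simp only: O.qcomm_def)
  qed
qed auto


section \<open>Linear independence of the operator monomials\<close>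

lemma Top_eval:
  assumes r: "r \<in> {1..n}" and z: "\<And>l. r < l \<Longrightarrow> \<beta> l = 0"
  shows "Top r f \<beta> = f (\<beta>(r := Suc (\<beta> r)))"
proof -
  \<comment> \<open>In terms of monomials: t_r is appended to a monomial without variables above r,
    so nothing has to be moved. Accordingly \<open>\<phi>\<close> is 1 here, and further down each
    \<open>dop (D j)\<close> meets the even exponent 0.\<close>
  have "\<phi> r \<beta> = 1"
    using z by (simp add: \<phi>_def)
  then have \<theta>: "\<theta> r f \<beta> = f (\<beta>(r := Suc (\<beta> r)))"
    by (simp add: \<theta>_def)
  show ?thesis
  proof (cases "\<exists>j\<in>{1..m}. r = D j")
    case True
    then obtain i where i: "i \<in> {1..m}" "r = D i" by blast
    have "W i j f \<beta> = 0" if j: "j \<in> {i<..m}" for j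
    proof -
      have "s_index i j \<noteq> D j" "D i < D j"
        using i j D_neq[of i j j] s_index_less[of i i j j] by auto
      then show ?thesis
        using z[of "D j"] i by (simp add: \<theta>_def dop_def)
    qed
    then have "N i f \<beta> = 0"
      unfolding N_def using W_closed by (subst op_algebra_finsum) (auto simp del: op_algebra_simps)
    then have "X i f \<beta> = \<theta> r f \<beta>"
      by (simp add: X_def i)
    then show ?thesis
      using \<theta> Top_D[OF i(1)] i by simp
  next
    case False
    then show ?thesis
      using \<theta> by (auto simp: Top_def)
  qed
qed

lemma Top_pow_eval:
  assumes r: "r \<in> {1..n}" and z: "\<And>l. r < l \<Longrightarrow> \<beta> l = 0"
  shows "(Top r [^]\<^bsub>\<O>\<^esub> (a::nat)) f \<beta> = f (\<beta>(r := \<beta> r + a))"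
  using z
proof (induction a arbitrary: f)
  case (Suc a)
  then show ?case
    using Top_eval[OF r, of "\<beta>(r := \<beta> r + a)" f] by (simp add: fun_upd_def cong: if_cong)
qed simp

text \<open>Multiplying 1 from the right by the factors of a standard monomial in their order never
  needs a commutation. Correspondingly the outermost operator is evaluated first, and the exponent
  is filled from low to high indices.\<close>

lemma std_monomial_Top_eval: "std_monomial \<O> n Top \<alpha> f (\<lambda>_. 0) = f (\<lambda>i. if i \<in> {1..n} then lookup \<alpha> i else 0)"
proof -
  have "foldr (\<lambda>i u. (Top i [^]\<^bsub>\<O>\<^esub> lookup \<alpha> i) \<otimes>\<^bsub>\<O>\<^esub> u) [l..<Suc n] \<one>\<^bsub>\<O>\<^esub> f \<beta> =
     f (\<lambda>i. if i \<in> {l..n} then lookup \<alpha> i else \<beta> i)"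
    if "1 \<le> l" "l \<le> Suc n" "\<And>i. l \<le> i \<Longrightarrow> \<beta> i = 0" for l \<beta>
    using that(2,1,3)
  proof (induction arbitrary: \<beta> rule: inc_induct)
    case base
    then show ?case by simp
  next
    case (step l)
    let ?u = "foldr (\<lambda>i u. (Top i [^]\<^bsub>\<O>\<^esub> lookup \<alpha> i) \<otimes>\<^bsub>\<O>\<^esub> u) [Suc l..<Suc n] \<one>\<^bsub>\<O>\<^esub>"
    have "[l..<Suc n] = l # [Suc l..<Suc n]"
      using step by (simp add: upt_conv_Cons del: upt_Suc)
    then have "foldr (\<lambda>i u. (Top i [^]\<^bsub>\<O>\<^esub> lookup \<alpha> i) \<otimes>\<^bsub>\<O>\<^esub> u) [l..<Suc n] \<one>\<^bsub>\<O>\<^esub> f \<beta> =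
        (Top l [^]\<^bsub>\<O>\<^esub> lookup \<alpha> l) (?u f) \<beta>"
      by simp
    also have "\<dots> = ?u f (\<beta>(l := \<beta> l + lookup \<alpha> l))"
      using step by (intro Top_pow_eval) auto
    also have "\<dots> = f (\<lambda>i. if i \<in> {Suc l..n} then lookup \<alpha> i else (\<beta>(l := \<beta> l + lookup \<alpha> l)) i)"
      using step.prems by (intro step.IH) auto
    also have "(\<lambda>i. if i \<in> {Suc l..n} then lookup \<alpha> i else (\<beta>(l := \<beta> l + lookup \<alpha> l)) i) =
      (\<lambda>i. if i \<in> {l..n} then lookup \<alpha> i else \<beta> i)"
      using step by (auto simp: fun_eq_iff)
    finally show ?case .
  qed
  from this[of 1 "\<lambda>_. 0"] show ?thesis
    by (simp add: std_monomial_def)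
qed

theorem Top_independent:
  assumes f: "keys f \<subseteq> exponents n" and z: "lin_comb \<O> (std_monomial \<O> n Top) f = \<zero>\<^bsub>\<O>\<^esub>"
  shows "f = 0"
proof (rule poly_mapping_eqI)
  fix \<alpha> :: "nat \<Rightarrow>\<^sub>0 nat"
  \<comment> \<open>The coordinate form of \<open>\<alpha>\<close>; evaluation at the zero exponent
    then extracts the coefficient at \<open>\<alpha>\<close>.\<close>
  let ?g = "\<lambda>\<beta>. if \<beta> = lookup \<alpha> then 1 else (0 :: 'k)"
  have c: "std_monomial \<O> n Top \<beta> \<in> carrier \<O>" for \<beta>
    by (rule O.std_monomial_closed) simp
  have "lin_comb \<O> (std_monomial \<O> n Top) f ?g (\<lambda>_. 0) =
      (\<Sum>\<beta>\<in>keys f. lookup f \<beta> * std_monomial \<O> n Top \<beta> ?g (\<lambda>_. 0))"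
    unfolding lin_comb_def using O.smult_cl[OF c]
    by (subst op_algebra_finsum) (simp_all del: op_algebra_simps(1-4))
  also have "\<dots> = (\<Sum>\<beta>\<in>keys f. if \<beta> = \<alpha> then lookup f \<beta> else 0)"
  proof (rule sum.cong[OF refl])
    fix \<beta> assume "\<beta> \<in> keys f"
    then have "\<beta> \<in> exponents n"
      using f by blast
    then have "(\<lambda>i. if i \<in> {1..n} then lookup \<beta> i else 0) = lookup \<beta>"
      by (auto simp: exponents_lookup)
    then show "lookup f \<beta> * std_monomial \<O> n Top \<beta> ?g (\<lambda>_. 0) = (if \<beta> = \<alpha> then lookup f \<beta> else 0)"
      by (simp only: std_monomial_Top_eval lookup_inject) simp
  qed
  also have "\<dots> = lookup f \<alpha>"
    by (auto simp: not_in_keys_iff_lookup_eq_zero)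
  finally show "lookup f \<alpha> = lookup 0 \<alpha>"
    by (simp add: z)
qed

end

section \<open>Squares of the generators\<close>

context assoc_alg
begin

lemma qcomm_smult_left: "\<lbrakk>qcomm x a b; a \<in> carrier A; b \<in> carrier A\<rbrakk> \<Longrightarrow> qcomm x (c \<odot> a) b"
  by (simp add: qcomm_def smult_mult_left smult_mult_right smult_smult mult.commute)

lemma qcomm_smult_right: "\<lbrakk>qcomm x a b; a \<in> carrier A; b \<in> carrier A\<rbrakk> \<Longrightarrow> qcomm x a (c \<odot> b)"
  by (simp add: qcomm_def smult_mult_left smult_mult_right smult_smult mult.commute)

text \<open>Moving \<open>v\<close> past \<open>u\<close> twice produces \<open>w\<close> once on
  either side of \<open>u\<close>; the two terms cancel because \<open>u\<close> and
  \<open>w\<close> commute with factor \<open>- e\<close>.\<close>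

lemma square_qcomm:
  assumes uv: "u \<otimes> v = e \<odot> (v \<otimes> u) \<oplus> w" and w: "qcomm (- e) u w"
    and [simp]: "u \<in> carrier A" "v \<in> carrier A" "w \<in> carrier A"
  shows "qcomm (e * e) (u \<otimes> u) v"
proof -
  have uw: "u \<otimes> w = (- e) \<odot> (w \<otimes> u)"
    using w by (simp add: qcomm_def)
  have "(u \<otimes> u) \<otimes> v = u \<otimes> (e \<odot> (v \<otimes> u) \<oplus> w)"
    by (simp add: m_assoc uv)
  also have "\<dots> = e \<odot> ((u \<otimes> v) \<otimes> u) \<oplus> u \<otimes> w"
    by (simp add: r_distr smult_mult_right m_assoc)
  also have "\<dots> = e \<odot> ((e \<odot> (v \<otimes> u) \<oplus> w) \<otimes> u) \<oplus> (- e) \<odot> (w \<otimes> u)"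
    by (simp only: uv uw)
  also have "\<dots> = (e * e) \<odot> (v \<otimes> (u \<otimes> u))"
    by (simp add: l_distr smult_mult_left m_assoc smult_add_right smult_smult smult_minus_left a_assoc r_neg)
  finally show ?thesis by (simp add: qcomm_def)
qed

end

text \<open>Prospective images of the t_r in an arbitrary algebra. The aim is that the remaining
  relations of U(X), those involving <x_a, x_a> and the centrality of the even part, follow from the
  color relations.\<close>

locale color_gens = generic_degrees \<epsilon> m d + ore_relations A "s_index m m" T "color_q \<epsilon> d" "color_c \<epsilon> d" color_k
  for \<epsilon> :: "'g::ab_group_add \<Rightarrow> 'g \<Rightarrow> 'k::field" and m d and A :: "('k, 'a) module" (structure) and T
begin

text \<open>The image of \<open>\<langle>x\<^sub>a, x\<^sub>b\<rangle>\<close>, \<open>a \<le> b\<close>; for \<open>a = b\<close> it is \<open>2 x\<^sub>a\<^sup>2\<close> because \<open>\<epsilon>(x\<^sub>a, x\<^sub>a) = -1\<close>.\<close>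

definition G :: "nat \<Rightarrow> nat \<Rightarrow> 'a" where
  "G a b = (if a < b then T (s_index a b) else 2 \<odot> (T (D a) \<otimes> T (D a)))"

lemma T_mem [simp]: "\<lbrakk>1 \<le> a; a \<le> b; b \<le> m\<rbrakk> \<Longrightarrow> T (s_index a b) \<in> carrier A"
  using s_index_le[of a b m] s_index_ge_1[of a b] by (intro T_closed) auto

lemma G_mem [simp]: "\<lbrakk>1 \<le> a; a \<le> b; b \<le> m\<rbrakk> \<Longrightarrow> G a b \<in> carrier A"
  by (auto simp: G_def)

lemma T_T_other:
  assumes r: "r \<in> {1..n}" and l: "l \<in> {1..n}" and ne: "r \<noteq> l \<or> \<epsilon> (d r) (d r) = 1"
    and nd: "\<nexists>b j. diag_pair r l b j" "\<nexists>b j. diag_pair l r b j"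
  shows "qcomm (\<epsilon> (d r) (d l)) (T r) (T l)"
proof (cases r l rule: linorder_cases)
  case less
  have "qcomm (\<epsilon> (d l) (d r)) (T l) (T r)"
    unfolding qcomm_def by (rule color_relations_other[OF ore_relations_axioms]) (use less r l nd in auto)
  then show ?thesis
    by (rule qcomm_sym) (use T_closed r l in auto)
next
  case equal
  then show ?thesis using ne T_closed r by (simp add: qcomm_def)
next
  case greater
  show ?thesis
    unfolding qcomm_def by (rule color_relations_other[OF ore_relations_axioms]) (use greater r l nd in auto)
qed

lemma Z_T:
  assumes "1 \<le> a" "a < b" "b \<le> m" "r \<in> {1..n}"
  shows "qcomm (\<epsilon> (d (s_index a b)) (d r)) (T (s_index a b)) (T r)"
proof (rule T_T_other)
  show "s_index a b \<in> {1..n}"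
    using assms s_index_le[of a b m] s_index_ge_1[of a b] by auto
  have "s_index a b \<noteq> D k" if "1 \<le> k" for k
    using assms D_neq that by simp
  then have "s_index a b \<noteq> D c \<and> s_index a b \<noteq> D j" if "1 \<le> c" "c < j" for c j
    using that by simp
  then show "\<nexists>c j. diag_pair (s_index a b) r c j" "\<nexists>c j. diag_pair r (s_index a b) c j"
    unfolding diag_pair_def by blast+
qed (use assms d_pair_even in auto)

lemma T_T_diag:
  assumes a: "a \<in> {1..m}" and b: "b \<in> {1..m}"
  shows "T (D a) \<otimes> T (D b) = \<epsilon> (d (D a)) (d (D b)) \<odot> (T (D b) \<otimes> T (D a)) \<oplus>
    (if a \<le> b then G a b else (- \<epsilon> (d (D a)) (d (D b))) \<odot> G b a)"
proof (cases a b rule: linorder_cases)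
  case less
  let ?e = "\<epsilon> (d (D a)) (d (D b))" and ?e' = "\<epsilon> (d (D b)) (d (D a))"
  have r: "T (D b) \<otimes> T (D a) = ?e' \<odot> (T (D a) \<otimes> T (D b)) \<oplus> (- ?e') \<odot> T (s_index a b)"
    using less a b by (intro color_relations_diag[OF ore_relations_axioms]) (auto intro: s_index_le)
  have "T (D a) \<otimes> T (D b) = ?e \<odot> (T (D b) \<otimes> T (D a)) \<oplus> T (s_index a b)"
    unfolding r using less a b
    by (simp add: smult_add_right smult_smult smult_minus_left smult_minus_right a_assoc l_neg)
  then show ?thesis using less by (simp add: G_def)
next
  case equal
  have "T (D a) \<otimes> T (D a) = (-1) \<odot> (T (D a) \<otimes> T (D a)) \<oplus> 2 \<odot> (T (D a) \<otimes> T (D a))"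
    using a by (simp flip: smult_add_left)
  then show ?thesis using equal a d_odd by (simp add: G_def)
next
  case greater
  then show ?thesis
    using a b color_relations_diag[OF ore_relations_axioms, of b a] s_index_le[of a a m] by (simp add: G_def)
qed

lemma d_eq: "\<lbrakk>1 \<le> a; a < b; b \<le> m\<rbrakk> \<Longrightarrow> d (s_index a b) = d (D a) + d (D b)"
  by (rule d_pair)

lemma G_T_off:
  assumes ab: "1 \<le> a" "a \<le> b" "b \<le> m" and ce: "1 \<le> c" "c < e" "e \<le> m"
  shows "qcomm (\<epsilon> (d (D a) + d (D b)) (d (s_index c e))) (G a b) (T (s_index c e))"
proof (cases "a < b")
  case True
  have "s_index c e \<in> {1..n}"
    using ce s_index_le[of c e m] s_index_ge_1[of c e] by auto
  then show ?thesis
    using True Z_T[of a b "s_index c e"] ab by (simp add: G_def d_eq)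
next
  case False
  have r: "D a \<in> {1..n}"
    using ab s_index_le[of a a m] s_index_ge_1[of a a] by auto
  have 1: "qcomm (\<epsilon> (d (D a)) (d (s_index c e))) (T (D a)) (T (s_index c e))"
    by (rule qcomm_sym[OF Z_T[OF ce r]]) (use ab ce in auto)
  have "qcomm (\<epsilon> (d (D a)) (d (s_index c e)) * \<epsilon> (d (D a)) (d (s_index c e))) (T (D a) \<otimes> T (D a)) (T (s_index c e))"
    by (rule qcomm_mult_left[OF 1 1]) (use ab ce in auto)
  then show ?thesis
    using False ab ce by (auto simp: G_def \<epsilon>_add_left intro!: qcomm_smult_left)
qed

text \<open>Color centrality of the even part, recovered from the relations. For
  \<open>a < b\<close> it is one of them; for the square of x_a it holds by
  \<open>square_qcomm\<close>, because the bracket of x_a and x_c itself color-commutes with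
  x_a.\<close>

lemma G_T_diag:
  assumes ab: "1 \<le> a" "a \<le> b" "b \<le> m" and c: "c \<in> {1..m}"
  shows "qcomm (\<epsilon> (d (D a) + d (D b)) (d (D c))) (G a b) (T (D c))"
proof (cases "a < b")
  case True
  have "D c \<in> {1..n}"
    using c s_index_le[of c c m] s_index_ge_1[of c c] by auto
  then show ?thesis
    using True Z_T[of a b "D c"] ab by (simp add: G_def d_eq)
next
  case False
  then have b: "b = a" using ab by simp
  have a: "a \<in> {1..m}" using ab b by simp
  have "qcomm (\<epsilon> (d (D a)) (d (D c)) * \<epsilon> (d (D a)) (d (D c))) (T (D a) \<otimes> T (D a)) (T (D c))"
  proof (cases "a = c")
    case True
    then show ?thesis
      using a d_odd[OF a] by (simp add: qcomm_def m_assoc)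
  next
    case ne: False
    let ?w = "if a \<le> c then G a c else (- \<epsilon> (d (D a)) (d (D c))) \<odot> G c a"
    have w: "?w \<in> carrier A" using a c by auto
    \<comment> \<open>The factor between x_a and the bracket is \<epsilon>(x_a, x_a) \<epsilon>(x_a,
      x_c), and the first of these is -1.\<close>
    have "qcomm (- \<epsilon> (d (D a)) (d (D c))) (T (D a)) ?w"
    proof (cases "a < c")
      case True
      have "D a \<in> {1..n}"
        using a s_index_le[of a a m] s_index_ge_1[of a a] by auto
      from Z_T[OF _ True _ this]
      have "qcomm (\<epsilon> (d (D a)) (d (s_index a c))) (T (D a)) (T (s_index a c))"
        using a c True by (intro qcomm_sym[of _ "T (s_index a c)"]) auto
      then show ?thesis
        using True a c d_odd[OF a] by (simp add: G_def d_eq \<epsilon>_add_right)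
    next
      case False
      then have ca: "c < a" using ne by simp
      have "D a \<in> {1..n}"
        using a s_index_le[of a a m] s_index_ge_1[of a a] by auto
      from Z_T[OF _ ca _ this]
      have "qcomm (\<epsilon> (d (D a)) (d (s_index c a))) (T (D a)) (T (s_index c a))"
        using a c ca by (intro qcomm_sym[of _ "T (s_index c a)"]) auto
      then have "qcomm (- \<epsilon> (d (D a)) (d (D c))) (T (D a)) (T (s_index c a))"
        using ca a c d_odd[OF a] by (simp add: d_eq \<epsilon>_add_right)
      then show ?thesis
        using ca a c by (auto simp: G_def intro!: qcomm_smult_right)
    qed
    then show ?thesis
      using a c w by (intro square_qcomm[OF T_T_diag]) auto
  qed
  then show ?thesis
    using b a c by (auto simp: G_def \<epsilon>_add_left intro!: qcomm_smult_left)
qed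

lemma G_G:
  assumes ab: "1 \<le> a" "a \<le> b" "b \<le> m" and ce: "1 \<le> c" "c \<le> e" "e \<le> m"
  shows "qcomm (\<epsilon> (d (D a) + d (D b)) (d (D c) + d (D e))) (G a b) (G c e)"
proof (cases "c < e")
  case True
  then show ?thesis
    using G_T_off[OF ab, of c e] ce by (simp add: G_def[of c e] d_eq)
next
  case False
  then have e: "e = c" using ce by simp
  have 1: "qcomm (\<epsilon> (d (D a) + d (D b)) (d (D c))) (G a b) (T (D c))"
    by (rule G_T_diag) (use ab ce e in auto)
  have "qcomm (\<epsilon> (d (D a) + d (D b)) (d (D c)) * \<epsilon> (d (D a) + d (D b)) (d (D c))) (G a b) (T (D c) \<otimes> T (D c))"
    by (rule qcomm_mult_right[OF 1 1]) (use ab ce e in auto)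
  then show ?thesis
    unfolding e G_def[of c c] using ab ce e by (auto simp: \<epsilon>_add_right intro!: qcomm_smult_right)
qed

end

section \<open>Homogeneous bases\<close>

context lie_color_algebra
begin

lemma \<epsilon>_nz [simp]: "\<epsilon> a b \<noteq> 0"
  using bicharacter by (simp add: skew_bicharacter_def)

lemma \<epsilon>_self: "\<epsilon> g g = 1 \<or> \<epsilon> g g = - 1"
  using bicharacter square_eq_1_iff[of "\<epsilon> g g"] by (simp add: skew_bicharacter_def)

text \<open>The family is made total, with zeros outside the finite support, so that two
  decompositions can be compared or added over the union of their supports.\<close>

lemma span_gr_decomp:
  assumes "y \<in> span (\<Union>g\<in>H. gr g)"
  shows "\<exists>S v. finite S \<and> S \<subseteq> H \<and> (\<forall>g. v g \<in> gr g) \<and> (\<forall>g. g \<notin> S \<longrightarrow> v g = 0) \<and> y = (\<Sum>g\<in>S. v g)"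
proof -
  let ?P = "\<lambda>y. \<exists>S v. finite S \<and> S \<subseteq> H \<and> (\<forall>g. v g \<in> gr g) \<and> (\<forall>g. g \<notin> S \<longrightarrow> v g = 0) \<and> y = (\<Sum>g\<in>S. v g)"
  have "subspace {y. ?P y}"
  proof (rule subspaceI)
    show "0 \<in> {y. ?P y}"
      using subspace_0[OF subspace_gr] by (auto intro!: exI[of _ "{}"] exI[of _ "\<lambda>_. 0"])
  next
    fix y z assume "y \<in> {y. ?P y}" "z \<in> {y. ?P y}"
    then obtain S v R w where
      "finite S" "S \<subseteq> H" "\<And>g. v g \<in> gr g" "\<And>g. g \<notin> S \<Longrightarrow> v g = 0" "y = (\<Sum>g\<in>S. v g)"
      "finite R" "R \<subseteq> H" "\<And>g. w g \<in> gr g" "\<And>g. g \<notin> R \<Longrightarrow> w g = 0" "z = (\<Sum>g\<in>R. w g)" by blast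
    note a = this
    have "y = (\<Sum>g\<in>S \<union> R. v g)" "z = (\<Sum>g\<in>S \<union> R. w g)"
      unfolding a(5,10) using a by (auto intro!: sum.mono_neutral_left)
    then have "y + z = (\<Sum>g\<in>S \<union> R. v g + w g)"
      by (simp add: sum.distrib)
    moreover have "\<forall>g. g \<notin> S \<union> R \<longrightarrow> v g + w g = 0"
      using a(4,9) by simp
    moreover have "\<forall>g. v g + w g \<in> gr g"
      using a(3,8) by (simp add: subspace_add[OF subspace_gr])
    moreover have "finite (S \<union> R)" "S \<union> R \<subseteq> H"
      using a by auto
    ultimately show "y + z \<in> {y. ?P y}"
      unfolding mem_Collect_eq by (intro exI[of _ "S \<union> R"] exI[of _ "\<lambda>g. v g + w g"] conjI)
  next
    fix c y assume "y \<in> {y. ?P y}"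
    then obtain S v where
      "finite S" "S \<subseteq> H" "\<And>g. v g \<in> gr g" "\<And>g. g \<notin> S \<Longrightarrow> v g = 0" "y = (\<Sum>g\<in>S. v g)" by blast
    then show "scale c y \<in> {y. ?P y}"
      unfolding mem_Collect_eq
      by (intro exI[of _ S] exI[of _ "\<lambda>g. scale c (v g)"])
        (simp add: subspace_scale[OF subspace_gr] scale_sum_right)
  qed
  moreover have "?P y" if "y \<in> gr h" "h \<in> H" for y h
    using that subspace_0[OF subspace_gr]
    by (intro exI[of _ "{h}"] exI[of _ "\<lambda>g. if g = h then y else 0"]) simp
  then have "(\<Union>g\<in>H. gr g) \<subseteq> {y. ?P y}"
    by (intro subsetI, elim UN_E, intro CollectI)
  ultimately have "span (\<Union>g\<in>H. gr g) \<subseteq> {y. ?P y}"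
    by (intro span_minimal)
  then have "y \<in> {y. ?P y}"
    using assms by (rule subsetD)
  then show ?thesis
    by (rule CollectD)
qed

lemma span_gr_disjoint:
  assumes y: "y \<in> span (\<Union>g\<in>H. gr g)" "y \<in> span (\<Union>g\<in>K. gr g)" and HK: "H \<inter> K = {}"
  shows "y = 0"
proof -
  obtain S v where S: "finite S" "S \<subseteq> H" "\<And>g. v g \<in> gr g" "\<And>g. g \<notin> S \<Longrightarrow> v g = 0" "y = (\<Sum>g\<in>S. v g)"
    using span_gr_decomp[OF y(1)] by blast
  obtain R w where R: "finite R" "R \<subseteq> K" "\<And>g. w g \<in> gr g" "\<And>g. g \<notin> R \<Longrightarrow> w g = 0" "y = (\<Sum>g\<in>R. w g)"
    using span_gr_decomp[OF y(2)] by blast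
  have "(\<Sum>g\<in>S. v g) = (\<Sum>g\<in>S \<union> R. v g)" "(\<Sum>g\<in>R. w g) = (\<Sum>g\<in>S \<union> R. w g)"
    using S(1,4) R(1,4) by (auto intro!: sum.mono_neutral_left)
  then have z: "(\<Sum>g\<in>S \<union> R. v g - w g) = 0"
    using S(5) R(5) by (simp add: sum_subtractf)
  have "v g = 0" if "g \<in> S" for g
  proof -
    have "v g - w g = 0"
      by (rule direct_gr[OF _ _ z]) (use S R that subspace_diff[OF subspace_gr] in auto)
    moreover have "w g = 0" using R(2,4) S(2) HK that by blast
    ultimately show ?thesis by simp
  qed
  then show ?thesis using S(5) by simp
qed

lemma gr_in_span_gr:
  assumes "y \<in> gr g" "y \<noteq> 0" "y \<in> span (\<Union>g\<in>H. gr g)" shows "g \<in> H"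
proof (rule ccontr)
  assume "g \<notin> H"
  moreover have "y \<in> span (\<Union>g\<in>{g}. gr g)"
    by (rule span_base) (use assms in simp)
  ultimately show False
    using span_gr_disjoint[of y "{g}" H] assms by simp
qed

lemma gr_unique: assumes "y \<in> gr g" "y \<in> gr h" "y \<noteq> 0" shows "g = h"
proof -
  have "y \<in> span (\<Union>g\<in>{h}. gr g)"
    by (rule span_base) (use assms in simp)
  then show ?thesis
    using gr_in_span_gr[OF assms(1,3)] by blast
qed

lemma deg_eq: "\<lbrakk>y \<in> gr g; y \<noteq> 0\<rbrakk> \<Longrightarrow> deg gr y = g"
  unfolding deg_def by (rule the_equality) (auto intro: gr_unique)

text \<open>The part of \<open>y\<close> coming from elements of other degrees lies both in
  \<open>gr g\<close> and in the sum of the other components, hence is zero. This reduces identities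
  with fixed degrees to basis elements of those degrees.\<close>

lemma gr_span_homogeneous:
  assumes C: "\<And>v. v \<in> C \<Longrightarrow> \<exists>h. v \<in> gr h" and y: "y \<in> gr g" "y \<in> span C"
  shows "y \<in> span (C \<inter> gr g)"
proof -
  have "(C \<inter> gr g) \<union> (C - gr g) = C"
    by blast
  then have "span C = {a + b | a b. a \<in> span (C \<inter> gr g) \<and> b \<in> span (C - gr g)}"
    using span_Un[of "C \<inter> gr g" "C - gr g"] by simp
  then obtain a b where ab: "y = a + b" "a \<in> span (C \<inter> gr g)" "b \<in> span (C - gr g)"
    using y(2) by auto
  have "span (C \<inter> gr g) \<subseteq> gr g"
    by (rule span_minimal) (use subspace_gr in auto)
  then have "b \<in> gr g"
    using ab y(1) subspace_diff[OF subspace_gr, of y g a] by auto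
  moreover have "b \<in> span (\<Union>h\<in>- {g}. gr h)"
  proof -
    have "C - gr g \<subseteq> (\<Union>h\<in>- {g}. gr h)"
    proof
      fix v assume v: "v \<in> C - gr g"
      then obtain h where "v \<in> gr h" using C by blast
      then show "v \<in> (\<Union>h\<in>- {g}. gr h)" using v by (cases "h = g") auto
    qed
    from span_mono[OF this] show ?thesis using ab(3) by blast
  qed
  ultimately have "b = 0"
    using gr_in_span_gr[of b g "- {g}"] by blast
  then show ?thesis using ab by simp
qed

end

section \<open>Generic Lie color algebras\<close>

lemma two_neq_zero: assumes "CHAR('k::field) \<noteq> 2" shows "(2::'k) \<noteq> 0"
proof
  assume "(2::'k) = 0"
  then have "CHAR('k) dvd 2"
    using of_nat_eq_0_iff_char_dvd[where 'a = 'k, of 2] by simp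
  then have "CHAR('k) \<le> 2" "CHAR('k) \<noteq> 0"
    by (auto dest: dvd_imp_le intro!: Nat.gr0I)
  then have "CHAR('k) = 1"
    using assms by linarith
  then show False
    using of_nat_eq_0_iff_char_dvd[where 'a = 'k, of 1] by simp
qed

context lie_color_algebra
begin

lemma br_0_left: "y \<in> L \<Longrightarrow> br 0 y = 0"
  using br_scale_left[of 0 y 0] subspace_0[OF subspace_L] by simp

lemma br_0_right: "y \<in> L \<Longrightarrow> br y 0 = 0"
  using br_scale_right[of y 0 0] subspace_0[OF subspace_L] by simp

lemma br_span:
  assumes W: "subspace W" and A: "A \<subseteq> L" and B: "B \<subseteq> L"
    and AB: "\<And>a b. \<lbrakk>a \<in> A; b \<in> B\<rbrakk> \<Longrightarrow> br a b \<in> W"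
    and u: "u \<in> span A" and v: "v \<in> span B"
  shows "br u v \<in> W"
proof -
  have sA: "span A \<subseteq> L" and sB: "span B \<subseteq> L"
    using A B subspace_L span_minimal by blast+
  have 1: "br a v \<in> W" if a: "a \<in> A" for a
  proof -
    have aL: "a \<in> L" using a A by blast
    have "subspace {v \<in> L. br a v \<in> W}"
      by (rule subspaceI)
        (use subspace_L W aL in \<open>auto simp: br_0_right br_add_right br_scale_right
          subspace_0 subspace_add subspace_scale\<close>)
    moreover have "B \<subseteq> {v \<in> L. br a v \<in> W}"
      using AB a B by blast
    ultimately have "span B \<subseteq> {v \<in> L. br a v \<in> W}"
      by (intro span_minimal)
    then show ?thesis using v by blast
  qed
  have vL: "v \<in> L" using v sB by blast
  have "subspace {u \<in> L. br u v \<in> W}"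
    by (rule subspaceI)
      (use subspace_L W vL in \<open>auto simp: br_0_left br_add_left br_scale_left
        subspace_0 subspace_add subspace_scale\<close>)
  moreover have "A \<subseteq> {u \<in> L. br u v \<in> W}"
    using 1 A by blast
  ultimately have "span A \<subseteq> {u \<in> L. br u v \<in> W}"
    by (intro span_minimal)
  then show ?thesis using u by blast
qed

lemma sign_part_L: "sign_part scale \<epsilon> gr c \<subseteq> L"
  unfolding sign_part_def by (rule span_minimal) (use gr_L subspace_L in auto)

end

context generic_lie_color_algebra
begin

text \<open>Centrality is assumed in the left argument; skew symmetry turns it around for
  homogeneous elements, and bilinearity does the rest.\<close>

lemma color_central_right:
  assumes "x \<in> L" "y \<in> sign_part scale \<epsilon> gr 1" shows "br x y = 0"
proof -
  have "br x y \<in> {0}"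
  proof (rule br_span)
    show "x \<in> span (\<Union>g. gr g)" using assms span_gr by simp
    show "y \<in> span (\<Union>g\<in>{g. \<epsilon> g g = 1}. gr g)" using assms by (simp add: sign_part_def)
    show "br a b \<in> {0}" if ab: "a \<in> (\<Union>g. gr g)" "b \<in> (\<Union>g\<in>{g. \<epsilon> g g = 1}. gr g)" for a b
    proof -
      obtain g h where g: "a \<in> gr g" "b \<in> gr h" "\<epsilon> h h = 1" using ab by blast
      have "b \<in> sign_part scale \<epsilon> gr 1"
        unfolding sign_part_def by (rule span_base) (use g in blast)
      then have "br b a = 0"
        using color_central gr_L g by blast
      then show ?thesis
        using br_skew[OF g(1,2)] by simp
    qed
  qed (use gr_L in \<open>auto simp: subspace_single_0\<close>)
  then show ?thesis by simp
qed

end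

section \<open>A basis of X adapted to the generators\<close>

locale generic_setup = generic_lie_color_algebra scale \<epsilon> L gr br
  for scale :: "'k::field \<Rightarrow> 'v::ab_group_add \<Rightarrow> 'v" and \<epsilon> :: "'g::ab_group_add \<Rightarrow> 'g \<Rightarrow> 'k"
    and L gr br +
  fixes m :: nat and x t :: "nat \<Rightarrow> 'v"
  assumes char2: "CHAR('k) \<noteq> 2"
    and x_hom: "i \<in> {1..m} \<Longrightarrow> \<exists>g. x i \<in> gr g"
    and x_inj: "inj_on x {1..m}"
    and x_indep: "independent (x ` {1..m})"
    and x_span: "span (x ` {1..m}) = sign_part scale \<epsilon> gr (- 1)"
    and t_diag: "j \<in> {1..m} \<Longrightarrow> t (s_index j j) = x j"
    and t_off: "\<lbrakk>1 \<le> i; i < j; j \<le> m\<rbrakk> \<Longrightarrow> t (s_index i j) = br (x i) (x j)"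
begin

abbreviation "Lm \<equiv> sign_part scale \<epsilon> gr (- 1)"
abbreviation "Lp \<equiv> sign_part scale \<epsilon> gr 1"

definition y :: "nat \<Rightarrow> nat \<Rightarrow> 'v" where "y a b = br (x a) (x b)"
definition dx :: "nat \<Rightarrow> 'g" where "dx a = deg gr (x a)"
definition Y :: "nat \<Rightarrow> 'v set" where "Y i = {y a b | a b. 1 \<le> a \<and> a \<le> b \<and> b \<le> i}"
text \<open>Turns out to be a basis of X_i. In contrast to the t_r it includes the brackets <x_a,
  x_a>.\<close>

definition C :: "nat \<Rightarrow> 'v set" where "C i = x ` {1..i} \<union> Y i"

lemma x_nz: "a \<in> {1..m} \<Longrightarrow> x a \<noteq> 0"
  using dependent_zero[of "x ` {1..m}"] x_indep by force

lemma x_gr: assumes "a \<in> {1..m}" shows "x a \<in> gr (dx a)"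
  using x_hom[OF assms] deg_eq x_nz[OF assms] by (auto simp: dx_def)

lemma x_L: "a \<in> {1..m} \<Longrightarrow> x a \<in> L"
  using x_gr gr_L by blast

lemma dx_odd: assumes "a \<in> {1..m}" shows "\<epsilon> (dx a) (dx a) = - 1"
proof -
  have "x a \<in> span (\<Union>g\<in>{g. \<epsilon> g g = - 1}. gr g)"
    using x_span span_base[of "x a" "x ` {1..m}"] assms by (simp add: sign_part_def)
  from gr_in_span_gr[OF x_gr[OF assms] x_nz[OF assms] this] show ?thesis by simp
qed

lemma \<epsilon>_add_left: "\<epsilon> (a + b) c = \<epsilon> a c * \<epsilon> b c" and \<epsilon>_add_right: "\<epsilon> c (a + b) = \<epsilon> c a * \<epsilon> c b"
  and \<epsilon>_swap: "\<epsilon> a b * \<epsilon> b a = 1"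
  using bicharacter by (simp_all add: skew_bicharacter_def)

lemma y_gr: "\<lbrakk>a \<in> {1..m}; b \<in> {1..m}\<rbrakk> \<Longrightarrow> y a b \<in> gr (dx a + dx b)"
  unfolding y_def by (intro br_graded x_gr)

lemma y_Lp: assumes "a \<in> {1..m}" "b \<in> {1..m}" shows "y a b \<in> Lp"
proof -
  have "\<epsilon> (dx a + dx b) (dx a + dx b) = 1"
    using dx_odd[OF assms(1)] dx_odd[OF assms(2)] \<epsilon>_swap[of "dx a" "dx b"]
    by (simp add: \<epsilon>_add_left \<epsilon>_add_right mult.commute)
  then show ?thesis
    unfolding sign_part_def using y_gr[OF assms] by (intro span_base) blast
qed

lemma y_swap: "\<lbrakk>a \<in> {1..m}; b \<in> {1..m}\<rbrakk> \<Longrightarrow> y a b = - scale (\<epsilon> (dx a) (dx b)) (y b a)"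
  unfolding y_def by (intro br_skew x_gr)

lemma span_br:
  assumes i: "i \<le> m"
  shows "span {br a b | a b. a \<in> span (x ` {1..i}) \<and> b \<in> span (x ` {1..i})} = span (Y i)"
proof (rule span_subspace)
  have xL: "x ` {1..i} \<subseteq> L" using i x_L by auto
  show "{br a b | a b. a \<in> span (x ` {1..i}) \<and> b \<in> span (x ` {1..i})} \<subseteq> span (Y i)"
  proof clarify
    fix u v assume uv: "u \<in> span (x ` {1..i})" "v \<in> span (x ` {1..i})"
    show "br u v \<in> span (Y i)"
    proof (rule br_span[OF subspace_span xL xL _ uv])
      fix p q assume "p \<in> x ` {1..i}" "q \<in> x ` {1..i}"
      then obtain a b where ab: "p = x a" "q = x b" "a \<in> {1..i}" "b \<in> {1..i}" by blast
      show "br p q \<in> span (Y i)"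
      proof (cases "a \<le> b")
        case True
        then show ?thesis using ab by (auto simp: Y_def y_def intro!: span_base)
      next
        case False
        then have "y b a \<in> Y i" using ab unfolding Y_def by (intro CollectI exI[of _ b] exI[of _ a]) simp
        then have "y b a \<in> span (Y i)" by (rule span_base)
        then have "y a b \<in> span (Y i)"
          using y_swap[of a b] ab i by (auto intro!: span_neg span_scale)
        then show ?thesis using ab by (simp add: y_def)
      qed
    qed
  qed
  have "Y i \<subseteq> {br a b | a b. a \<in> span (x ` {1..i}) \<and> b \<in> span (x ` {1..i})}"
    by (force simp: Y_def y_def intro: span_base)
  then show "span (Y i) \<subseteq> span {br a b | a b. a \<in> span (x ` {1..i}) \<and> b \<in> span (x ` {1..i})}"
    by (rule span_mono)
qed simp

lemma sub_generated_eq: assumes "i \<le> m" shows "sub_generated scale br (x ` {1..i}) = span (C i)"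
  unfolding sub_generated_def span_br[OF assms] C_def span_Un by simp

lemma Lp_eq: "Lp = span (Y m)"
  unfolding plus_eq x_span[symmetric] by (rule span_br) simp

lemma span_C_m: "span (C m) = L"
proof
  have "C m \<subseteq> L"
    using x_L y_Lp sign_part_L[of 1] by (auto simp: C_def Y_def)
  then show "span (C m) \<subseteq> L"
    by (rule span_minimal[OF _ subspace_L])
  have "gr g \<subseteq> span (C m)" for g
  proof
    fix u assume u: "u \<in> gr g"
    consider "\<epsilon> g g = 1" | "\<epsilon> g g = - 1" using \<epsilon>_self by blast
    then have "u \<in> Lp \<or> u \<in> Lm"
      by cases (use u in \<open>auto simp: sign_part_def intro!: span_base\<close>)
    then show "u \<in> span (C m)"
      unfolding Lp_eq x_span[symmetric] C_def
      using span_mono[of "Y m" "x ` {1..m} \<union> Y m"] span_mono[of "x ` {1..m}" "x ` {1..m} \<union> Y m"] by blast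
  qed
  then show "L \<subseteq> span (C m)"
    unfolding span_gr[symmetric] by (intro span_minimal) auto
qed

definition pairs :: "(nat \<times> nat) set" where "pairs = {(a, b). 1 \<le> a \<and> a \<le> b \<and> b \<le> m}"

lemma Y_eq: "Y m = (\<lambda>(a, b). y a b) ` pairs"
  by (auto simp: Y_def pairs_def)

lemma card_pairs: "finite pairs" "card pairs = m * (m + 1) div 2"
proof -
  have "bij_betw (\<lambda>(a, b). s_index a b) pairs {1..s_index m m}"
    unfolding bij_betw_def
  proof
    show "inj_on (\<lambda>(a, b). s_index a b) pairs"
      using s_index_inj by (fastforce simp: inj_on_def pairs_def)
    show "(\<lambda>(a, b). s_index a b) ` pairs = {1..s_index m m}"
    proof
      show "(\<lambda>(a, b). s_index a b) ` pairs \<subseteq> {1..s_index m m}"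
        using s_index_le s_index_ge_1 by (force simp: pairs_def)
      show "{1..s_index m m} \<subseteq> (\<lambda>(a, b). s_index a b) ` pairs"
        using s_index_surj by (force simp: pairs_def)
    qed
  qed
  then show "finite pairs" "card pairs = m * (m + 1) div 2"
    using bij_betw_finite bij_betw_same_card s_index_triangle by fastforce+
qed

lemma dim_Lm: "dim Lm = m"
proof -
  have "dim Lm = card (x ` {1..m})"
    unfolding x_span[symmetric] by (rule dim_span_eq_card_independent[OF x_indep])
  then show ?thesis using card_image[OF x_inj] by simp
qed

text \<open>By hypothesis the \<open>\<onehalf>m(m + 1)\<close> brackets are exactly as many as the dimension of the space they span.\<close>

lemma y_indep: "independent (Y m)" and y_inj: "inj_on (\<lambda>(a, b). y a b) pairs"
proof -
  have fin: "finite (Y m)" "card (Y m) \<le> card pairs"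
    unfolding Y_eq using card_pairs(1) by (auto intro: card_image_le)
  obtain B where B: "B \<subseteq> Y m" "independent B" "Y m \<subseteq> span B"
    using maximal_independent_subset[of "Y m"] by blast
  have "span B = Lp"
    unfolding Lp_eq using B by (metis span_mono span_span subset_antisym)
  then have "dim Lp = card B"
    using dim_span_eq_card_independent[OF B(2)] by simp
  then have "card B = card pairs"
    using dim_plus dim_Lm card_pairs by simp
  then have "B = Y m" "card (Y m) = card pairs"
    using fin B(1) card_mono[OF fin(1) B(1)] card_subset_eq[OF fin(1) B(1)] by auto
  then show "independent (Y m)" "inj_on (\<lambda>(a, b). y a b) pairs"
    using B(2) card_pairs(1) eq_card_imp_inj_on[of pairs "\<lambda>(a, b). y a b"] by (auto simp: Y_eq)
qed

lemma y_nz: "\<lbrakk>1 \<le> a; a \<le> b; b \<le> m\<rbrakk> \<Longrightarrow> y a b \<noteq> 0"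
  using dependent_zero[of "Y m"] y_indep unfolding Y_def by force

text \<open>Characteristic different from 2 enters here: it separates 1 from -1, so that no degree
  contributes to both parts.\<close>

lemma Lp_Lm: "\<lbrakk>u \<in> Lp; u \<in> Lm\<rbrakk> \<Longrightarrow> u = 0"
  unfolding sign_part_def
  by (erule span_gr_disjoint, assumption) (use two_neq_zero[OF char2] in \<open>auto simp: eq_neg_iff_add_eq_0\<close>)

lemma x_neq_y: assumes "a \<in> {1..m}" "b \<in> {1..m}" "c \<in> {1..m}" shows "x a \<noteq> y b c"
  using Lp_Lm[of "x a"] y_Lp[OF assms(2,3)] x_span span_base[of "x a" "x ` {1..m}"] x_nz[OF assms(1)] assms
  by auto

lemma finite_C: "finite (C m)"
  using card_pairs(1) by (simp add: C_def Y_eq)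

lemma C_indep: "independent (C m)"
proof
  assume "dependent (C m)"
  then obtain u where u: "\<exists>v\<in>C m. u v \<noteq> 0" "(\<Sum>v\<in>C m. scale (u v) v) = 0"
    using dependent_finite[OF finite_C] by blast
  have fin: "finite (x ` {1..m})" "finite (Y m)" "x ` {1..m} \<inter> Y m = {}"
    using finite_C x_neq_y by (auto simp: C_def Y_def)
  have s: "(\<Sum>v\<in>x ` {1..m}. scale (u v) v) + (\<Sum>v\<in>Y m. scale (u v) v) = 0"
    using u(2) fin by (simp add: C_def sum.union_disjoint)
  have m: "(\<Sum>v\<in>x ` {1..m}. scale (u v) v) \<in> Lm" and p: "(\<Sum>v\<in>Y m. scale (u v) v) \<in> Lp"
    unfolding x_span[symmetric] Lp_eq by (auto intro!: span_sum span_scale intro: span_base)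
  have "(\<Sum>v\<in>Y m. scale (u v) v) \<in> Lm"
    using s m x_span subspace_neg[OF subspace_span[of "x ` {1..m}"], of "\<Sum>v\<in>x ` {1..m}. scale (u v) v"]
    by (simp add: eq_neg_iff_add_eq_0 add.commute minus_unique)
  then have "(\<Sum>v\<in>Y m. scale (u v) v) = 0"
    using Lp_Lm p by blast
  with s have "(\<Sum>v\<in>x ` {1..m}. scale (u v) v) = 0" by simp
  then have "\<forall>v\<in>x ` {1..m}. u v = 0"
    using x_indep dependent_finite[OF fin(1)] by blast
  moreover have "\<forall>v\<in>Y m. u v = 0"
    using y_indep dependent_finite[OF fin(2)] \<open>(\<Sum>v\<in>Y m. scale (u v) v) = 0\<close> by blast
  ultimately show False
    using u(1) by (auto simp: C_def)
qed

lemma C_mono: "i \<le> m \<Longrightarrow> C i \<subseteq> C m"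
  by (fastforce simp: C_def Y_def)

lemma C_indep_i: "i \<le> m \<Longrightarrow> independent (C i)"
  using independent_mono[OF C_indep C_mono] .

lemma span_C_L: "i \<le> m \<Longrightarrow> span (C i) \<subseteq> L"
  using span_mono[OF C_mono] span_C_m by blast

lemma C_cases:
  assumes "v \<in> C i"
  obtains (x) a where "a \<in> {1..i}" "v = x a" | (y) a b where "1 \<le> a" "a \<le> b" "b \<le> i" "v = y a b"
  using assms unfolding C_def Y_def by blast

lemma C_hom: assumes "i \<le> m" "v \<in> C i" shows "\<exists>h. v \<in> gr h"
  using assms(2)
proof (cases rule: C_cases)
  case (x a)
  then show ?thesis using x_gr[of a] assms(1) by auto
next
  case (y a b)
  then show ?thesis using y_gr[of a b] assms(1) by auto
qed

text \<open>Brackets of two x_a lie in the span of \<open>Y i\<close>, and brackets with an element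
  of \<open>Y i\<close> vanish by centrality, so one layer of brackets is enough.\<close>

lemma br_C: assumes i: "i \<le> m" and uv: "u \<in> span (C i)" "v \<in> span (C i)" shows "br u v \<in> span (C i)"
proof (rule br_span[OF subspace_span _ _ _ uv])
  have CL: "C i \<subseteq> L"
    using span_C_L[OF i] span_superset[of "C i"] by blast
  then show "C i \<subseteq> L" "C i \<subseteq> L" by blast+
  fix p q assume pq: "p \<in> C i" "q \<in> C i"
  have YLp: "Y i \<subseteq> Lp"
    unfolding Y_def using i by (auto intro!: y_Lp)
  show "br p q \<in> span (C i)"
  proof (cases "p \<in> Y i \<or> q \<in> Y i")
    case True
    then have "br p q = 0"
      using color_central color_central_right pq CL YLp by blast
    then show ?thesis by (simp add: span_zero)
  next
    case False
    then have "p \<in> span (x ` {1..i})" "q \<in> span (x ` {1..i})"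
      using pq by (auto simp: C_def intro: span_base)
    then have "br p q \<in> span {br a b | a b. a \<in> span (x ` {1..i}) \<and> b \<in> span (x ` {1..i})}"
      by (intro span_base) blast
    then show ?thesis
      unfolding span_br[OF i] C_def using span_mono[of "Y i" "x ` {1..i} \<union> Y i"] by blast
  qed
qed

text \<open>Since \<open>C i\<close> consists of homogeneous elements, intersecting the components
  with its span grades the subalgebra; the remaining axioms are inherited.\<close>

lemma sub_lie:
  assumes i: "i \<le> m"
  shows "lie_color_algebra scale \<epsilon> (span (C i)) (\<lambda>g. gr g \<inter> span (C i)) br"
proof (intro lie_color_algebra.intro lie_color_algebra_axioms.intro bicharacter)
  show "vector_space scale" by (rule vector_space_axioms)
  show "subspace (gr g \<inter> span (C i))" for g
    by (intro subspace_inter subspace_gr subspace_span)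
  show "span (\<Union>g. gr g \<inter> span (C i)) = span (C i)"
  proof (rule span_subspace)
    have "C i \<subseteq> (\<Union>g. gr g \<inter> span (C i))"
    proof
      fix v assume v: "v \<in> C i"
      then obtain h where "v \<in> gr h" using C_hom[OF i] by blast
      moreover have "v \<in> span (C i)" using v by (rule span_base)
      ultimately show "v \<in> (\<Union>g. gr g \<inter> span (C i))" by blast
    qed
    then show "span (C i) \<subseteq> span (\<Union>g. gr g \<inter> span (C i))" by (rule span_mono)
  qed auto
next
  fix S :: "'g set" and v h
  assume S: "finite S" "\<And>g. g \<in> S \<Longrightarrow> v g \<in> gr g \<inter> span (C i)" "(\<Sum>g\<in>S. v g) = 0" "h \<in> S"
  show "v h = 0"
    by (rule direct_gr[OF S(1) _ S(3,4)]) (use S(2) in blast)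
next
  note L = subsetD[OF span_C_L[OF i]]
  show "br u w \<in> gr (g + h) \<inter> span (C i)" if "u \<in> gr g \<inter> span (C i)" "w \<in> gr h \<inter> span (C i)" for u w g h
    using that br_graded br_C[OF i] by simp
  show "br (u + v) w = br u w + br v w" "br u (v + w) = br u v + br u w"
    if "u \<in> span (C i)" "v \<in> span (C i)" "w \<in> span (C i)" for u v w
    using that by (simp_all add: br_add_left br_add_right L)
  show "br (scale c u) v = scale c (br u v)" "br u (scale c v) = scale c (br u v)"
    if "u \<in> span (C i)" "v \<in> span (C i)" for c u v
    using that by (simp_all add: br_scale_left br_scale_right L)
  show "br u v = - scale (\<epsilon> g h) (br v u)"
    if "u \<in> gr g \<inter> span (C i)" "v \<in> gr h \<inter> span (C i)" for u v g h
    using that by (intro br_skew) auto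
  show "scale (\<epsilon> h f) (br u (br v w)) + scale (\<epsilon> g h) (br w (br u v)) + scale (\<epsilon> f g) (br v (br w u)) = 0"
    if "u \<in> gr f \<inter> span (C i)" "v \<in> gr g \<inter> span (C i)" "w \<in> gr h \<inter> span (C i)" for u v w f g h
    using that by (intro br_jacobi) auto
qed

abbreviation "d r \<equiv> deg gr (t r)"

lemma d_diag: "a \<in> {1..m} \<Longrightarrow> d (s_index a a) = dx a"
  by (simp add: t_diag dx_def)

lemma t_off_y: "\<lbrakk>1 \<le> a; a < b; b \<le> m\<rbrakk> \<Longrightarrow> t (s_index a b) = y a b"
  by (simp add: t_off y_def)

lemma d_off: "\<lbrakk>1 \<le> a; a < b; b \<le> m\<rbrakk> \<Longrightarrow> d (s_index a b) = dx a + dx b"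
  using deg_eq[OF y_gr[of a b] y_nz[of a b]] by (simp add: t_off_y)

lemma generic_degrees: "i \<le> m \<Longrightarrow> generic_degrees \<epsilon> i (\<lambda>r. d r)"
  by unfold_locales (auto simp: bicharacter d_diag d_off dx_odd)

end

lemma (in assoc_alg) basis_family_eqD:
  assumes b: "basis_family A J b" and f: "keys f \<subseteq> J" and g: "keys g \<subseteq> J"
    and eq: "lin_comb A b f = lin_comb A b g"
  shows "f = g"
  by (rule trans[OF coordinates_lin_comb[OF b f, unfolded eq, symmetric] coordinates_lin_comb[OF b g]])

section \<open>The enveloping algebras of the subalgebras X_i\<close>

context generic_setup
begin

abbreviation "n i \<equiv> s_index i i"
abbreviation "L\<^sub>i i \<equiv> span (C i)"
abbreviation "gr\<^sub>i i \<equiv> \<lambda>g. gr g \<inter> span (C i)"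
abbreviation "U\<^sub>i i \<equiv> uea scale \<epsilon> (L\<^sub>i i) (gr\<^sub>i i) br"
abbreviation "T\<^sub>i i \<equiv> \<lambda>r. uea_incl scale \<epsilon> (L\<^sub>i i) (gr\<^sub>i i) br (t r)"

lemma t_cases:
  assumes "r \<in> {1..n i}" "i \<le> m"
  obtains (diag) a where "a \<in> {1..i}" "r = s_index a a" "t r = x a" "d r = dx a"
  | (off) a b where "1 \<le> a" "a < b" "b \<le> i" "r = s_index a b" "t r = y a b" "d r = dx a + dx b"
proof -
  obtain a b where ab: "1 \<le> a" "a \<le> b" "b \<le> i" "r = s_index a b"
    using s_index_surj assms(1) by blast
  show thesis
  proof (cases "a < b")
    case True
    then show ?thesis using ab assms(2) off[of a b] t_off_y[of a b] d_off[of a b] by simp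
  next
    case False
    then show ?thesis using ab assms(2) diag[of a] t_diag[of a] d_diag[of a] by simp
  qed
qed

lemma t_C: assumes "r \<in> {1..n i}" "i \<le> m" shows "t r \<in> C i"
  using assms
proof (cases rule: t_cases)
  case (off a b)
  then have "t r \<in> Y i" unfolding Y_def by (intro CollectI exI[of _ a] exI[of _ b]) simp
  then show ?thesis by (simp add: C_def)
qed (auto simp: C_def)

lemma t_gr: assumes "r \<in> {1..n i}" "i \<le> m" shows "t r \<in> gr (d r)"
  using assms
proof (cases rule: t_cases)
  case (diag a)
  then show ?thesis using x_gr[of a] assms by simp
next
  case (off a b)
  then show ?thesis using y_gr[of a b] assms by simp
qed

lemma t_off_Lp: "\<lbrakk>1 \<le> a; a < b; b \<le> m\<rbrakk> \<Longrightarrow> t (s_index a b) \<in> Lp"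
  using y_Lp[of a b] by (simp add: t_off_y)

lemma uea_relations:
  assumes i: "i \<le> m" shows "color_relations \<epsilon> (\<lambda>r. d r) (U\<^sub>i i) (n i) (T\<^sub>i i)"
proof (rule color_relationsI)
  interpret S: lie_color_algebra scale \<epsilon> "L\<^sub>i i" "gr\<^sub>i i" br
    by (rule sub_lie[OF i])
  show U: "assoc_alg (U\<^sub>i i)" by (rule S.uea_assoc_alg)
  interpret U: assoc_alg "U\<^sub>i i" by (rule U)
  have t: "t r \<in> gr\<^sub>i i (d r)" if "r \<in> {1..n i}" for r
    using t_gr[OF that i] span_base[OF t_C[OF that i]] by blast
  show T: "T\<^sub>i i r \<in> carrier (U\<^sub>i i)" if "r \<in> {1..n i}" for r
    using t[OF that] by (intro S.uea_incl_closed) blast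
  have mem: "s_index a b \<in> {1..n i}" if "1 \<le> a" "a \<le> b" "b \<le> i" for a b
    using that s_index_le[of a b i] s_index_ge_1[of a b] by auto
  have zero: "uea_incl scale \<epsilon> (L\<^sub>i i) (gr\<^sub>i i) br 0 = \<zero>\<^bsub>U\<^sub>i i\<^esub>"
    using S.uea_incl_scale[of 0 0] S.uea_incl_closed[of 0] span_zero[of "C i"] by simp
  show "T\<^sub>i i (s_index j j) \<otimes>\<^bsub>U\<^sub>i i\<^esub> T\<^sub>i i (s_index b b) =
     \<epsilon> (d (s_index j j)) (d (s_index b b)) \<odot>\<^bsub>U\<^sub>i i\<^esub> (T\<^sub>i i (s_index b b) \<otimes>\<^bsub>U\<^sub>i i\<^esub> T\<^sub>i i (s_index j j))
        \<oplus>\<^bsub>U\<^sub>i i\<^esub> (- \<epsilon> (d (s_index j j)) (d (s_index b b))) \<odot>\<^bsub>U\<^sub>i i\<^esub> T\<^sub>i i (s_index b j)"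
    if bj: "1 \<le> b" "b < j" "s_index j j \<le> n i" for b j
  proof -
    have j: "j \<le> i"
      using bj s_index_less[of i i j j] by (cases "i < j") auto
    let ?e = "\<epsilon> (d (s_index j j)) (d (s_index b b))"
    have "br (t (s_index j j)) (t (s_index b b)) = y j b"
      using bj j i by (simp add: t_diag y_def)
    also have "\<dots> = scale (- ?e) (t (s_index b j))"
      using bj j i y_swap[of j b] by (simp add: d_diag t_off_y)
    finally have e: "br (t (s_index j j)) (t (s_index b b)) = \<dots>" .
    have "t (s_index b j) \<in> L\<^sub>i i"
      using t[OF mem[of b j]] bj j by auto
    then show ?thesis
      using S.uea_rel[OF t[OF mem[of j j]] t[OF mem[of b b]]] bj j
      by (simp add: e S.uea_incl_scale del: scale_minus_left)
  qed
  show "T\<^sub>i i r \<otimes>\<^bsub>U\<^sub>i i\<^esub> T\<^sub>i i l = \<epsilon> (d r) (d l) \<odot>\<^bsub>U\<^sub>i i\<^esub> (T\<^sub>i i l \<otimes>\<^bsub>U\<^sub>i i\<^esub> T\<^sub>i i r)"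
    if lr: "1 \<le> l" "l < r" "r \<le> n i" and nd: "\<nexists>b j. diag_pair r l b j" for l r
  proof -
    have r: "r \<in> {1..n i}" and l: "l \<in> {1..n i}" using lr by auto
    obtain a b where ab: "1 \<le> a" "a \<le> b" "b \<le> i" "r = s_index a b"
      using s_index_surj r by blast
    obtain a' b' where ab': "1 \<le> a'" "a' \<le> b'" "b' \<le> i" "l = s_index a' b'"
      using s_index_surj l by blast
    have tL: "t r \<in> L" "t l \<in> L"
      using t[OF r] t[OF l] gr_L by blast+
    have "br (t r) (t l) = 0"
    proof (cases "a < b \<or> a' < b'")
      case True
      then have "t r \<in> Lp \<or> t l \<in> Lp"
        using ab ab' t_off_Lp[of a b] t_off_Lp[of a' b'] i by auto
      then show ?thesis
        using color_central color_central_right tL by blast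
    next
      case False
      then have "diag_pair r l a' a"
        using ab ab' lr s_index_less_iff[of a' a' a a] by (auto simp: diag_pair_def)
      then show ?thesis using nd by blast
    qed
    then show ?thesis
      using S.uea_rel[OF t[OF r] t[OF l]] T[OF r] T[OF l] by (simp add: zero)
  qed
qed (rule \<epsilon>_nz)

text \<open>The span of the standard monomials is closed under products, so it suffices that it
  contains the image of \<open>C i\<close>. The elements of \<open>C i\<close> are variables, except
  <x_a, x_a>, which becomes the double of a square.\<close>

lemma uea_mon_span:
  assumes i: "i \<le> m"
  shows "carrier (U\<^sub>i i) = {lin_comb (U\<^sub>i i) (std_monomial (U\<^sub>i i) (n i) (T\<^sub>i i)) f | f. keys f \<subseteq> exponents (n i)}"
proof -
  interpret S: lie_color_algebra scale \<epsilon> "L\<^sub>i i" "gr\<^sub>i i" br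
    by (rule sub_lie[OF i])
  interpret R: ore_relations "U\<^sub>i i" "n i" "T\<^sub>i i" "color_q \<epsilon> (\<lambda>r. d r)" "color_c \<epsilon> (\<lambda>r. d r)" color_k
    by (rule uea_relations[OF i])
  let ?\<iota> = "uea_incl scale \<epsilon> (L\<^sub>i i) (gr\<^sub>i i) br"
  have Tab: "T\<^sub>i i (s_index a b) \<in> R.mon_span" if "1 \<le> a" "a \<le> b" "b \<le> i" for a b
    using that s_index_le[of a b i] s_index_ge_1[of a b] by (intro R.mon_span_T) auto
  have gen: "?\<iota> v \<in> R.mon_span" if v: "v \<in> C i" for v
    using v
  proof (cases rule: C_cases)
    case (x a)
    then show ?thesis using Tab[of a a] i by (simp add: t_diag)
  next
    case (y a b)
    show ?thesis
    proof (cases "a < b")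
      case True
      then show ?thesis using Tab[of a b] y i by (simp add: t_off_y)
    next
      case False
      then have ba: "b = a" "a \<in> {1..i}" "a \<in> {1..m}" using y i by auto
      have xg: "x a \<in> gr\<^sub>i i (dx a)"
        using x_gr[OF ba(3)] ba by (auto simp: C_def intro!: span_base)
      have c: "?\<iota> (x a) \<in> carrier (U\<^sub>i i)"
        using xg by (intro S.uea_incl_closed) blast
      have cy: "?\<iota> (y a a) \<in> carrier (U\<^sub>i i)"
        using v y ba by (intro S.uea_incl_closed span_base) simp
      let ?q = "?\<iota> (x a) \<otimes>\<^bsub>U\<^sub>i i\<^esub> ?\<iota> (x a)"
      \<comment> \<open>The defining relation for x_a with itself, where \<epsilon> is -1; solving
        it expresses <x_a, x_a> by the square.\<close>
      have "?q = (- 1) \<odot>\<^bsub>U\<^sub>i i\<^esub> ?q \<oplus>\<^bsub>U\<^sub>i i\<^esub> ?\<iota> (y a a)"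
        using S.uea_rel[OF xg xg] dx_odd[OF ba(3)] by (simp add: y_def)
      then have "?q \<oplus>\<^bsub>U\<^sub>i i\<^esub> ?q = ?q \<oplus>\<^bsub>U\<^sub>i i\<^esub> ((- 1) \<odot>\<^bsub>U\<^sub>i i\<^esub> ?q \<oplus>\<^bsub>U\<^sub>i i\<^esub> ?\<iota> (y a a))"
        by (rule arg_cong)
      also have "\<dots> = ?\<iota> (y a a)"
        using c cy by (simp add: R.smult_minus_left R.a_assoc[symmetric] R.r_neg)
      finally have "?\<iota> (y a a) = ?q \<oplus>\<^bsub>U\<^sub>i i\<^esub> ?q" by (rule sym)
      moreover have "?\<iota> (x a) \<in> R.mon_span"
        using Tab[of a a] ba by (simp add: t_diag)
      ultimately show ?thesis
        using y ba R.mon_span_mult R.mon_span_add by simp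
    qed
  qed
  have "subspace {v \<in> L\<^sub>i i. ?\<iota> v \<in> R.mon_span}"
  proof (rule subspaceI)
    have "?\<iota> 0 = 0 \<odot>\<^bsub>U\<^sub>i i\<^esub> ?\<iota> 0"
      using S.uea_incl_scale[of 0 0] span_zero[of "C i"] by simp
    also have "\<dots> = 0 \<odot>\<^bsub>U\<^sub>i i\<^esub> \<one>\<^bsub>U\<^sub>i i\<^esub>"
      using S.uea_incl_closed[OF span_zero[of "C i"]] by simp
    finally show "0 \<in> {v \<in> L\<^sub>i i. ?\<iota> v \<in> R.mon_span}"
      using R.mon_span_smult[OF R.mon_span_one, of 0] span_zero[of "C i"] by simp
  qed (simp_all add: span_add span_scale S.uea_incl_add S.uea_incl_scale R.mon_span_add R.mon_span_smult)
  then have "L\<^sub>i i \<subseteq> {v \<in> L\<^sub>i i. ?\<iota> v \<in> R.mon_span}"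
    by (intro span_minimal) (use gen span_base in blast)
  then have "R.mon_span = carrier (U\<^sub>i i)"
    by (intro S.uea_generated R.mon_span_closed R.mon_span_one R.mon_span_add R.mon_span_smult R.mon_span_mult) auto
  then show ?thesis
    unfolding R.mon_span_def by (rule sym)
qed

text \<open>The color relations present U(X_i): a linear map is prescribed on the basis
  \<open>C i\<close>, with \<open>G\<close> supplying the images of the brackets, and the bracket
  condition of \<open>uea_lift\<close> on pairs of basis elements follows from the facts of
  \<open>color_gens\<close>.\<close>

lemma uea_lift_relations:
  assumes i: "i \<le> m" and R: "color_relations \<epsilon> (\<lambda>r. d r) A (n i) \<tau>"
  shows "\<exists>h\<in>algebra_hom (U\<^sub>i i) A. \<forall>r\<in>{1..n i}. h (T\<^sub>i i r) = \<tau> r"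
proof -
  interpret S: lie_color_algebra scale \<epsilon> "L\<^sub>i i" "gr\<^sub>i i" br
    by (rule sub_lie[OF i])
  interpret cg: color_gens \<epsilon> i "\<lambda>r. d r" A \<tau>
    using generic_degrees[OF i] R by (rule color_gens.intro)
  have dD: "d (s_index a a) = dx a" if "a \<in> {1..i}" for a
    using that i by (intro d_diag) auto
  \<comment> \<open>The indices are read off from a basis vector by inverting \<open>x\<close> and
    \<open>y\<close>; injectivity of both families and \<open>x_neq_y\<close> make this
    unambiguous.\<close>
  define F where "F v = (if v \<in> x ` {1..i} then \<tau> (s_index (inv_into {1..m} x v) (inv_into {1..m} x v))
    else case_prod cg.G (inv_into pairs (\<lambda>(a, b). y a b) v))" for v
  have Fx: "F (x a) = \<tau> (s_index a a)" if "a \<in> {1..i}" for a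
    using that i inv_into_f_f[OF x_inj, of a] by (simp add: F_def)
  have Fy: "F (y a b) = cg.G a b" if "1 \<le> a" "a \<le> b" "b \<le> i" for a b
  proof -
    have "y a b \<notin> x ` {1..i}"
      using x_neq_y[of _ a b] that i by fastforce
    moreover have "inv_into pairs (\<lambda>(a, b). y a b) (y a b) = (a, b)"
      using inv_into_f_f[OF y_inj, of "(a, b)"] that i by (simp add: pairs_def)
    ultimately show ?thesis by (simp add: F_def)
  qed
  have F_mem: "F v \<in> carrier A" if "v \<in> C i" for v
    using that by (cases rule: C_cases) (auto simp: Fx Fy)
  have fin: "finite (C i)"
    using finite_subset[OF C_mono[OF i] finite_C] .
  note ind = C_indep_i[OF i]
  define f where "f z = (\<Oplus>\<^bsub>A\<^esub>v\<in>C i. representation (C i) z v \<odot>\<^bsub>A\<^esub> F v)" for z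
  have f_mem [simp]: "f z \<in> carrier A" for z
    unfolding f_def by (rule cg.finsum_closed) (use F_mem in auto)
  have f_add: "f (u + v) = f u \<oplus>\<^bsub>A\<^esub> f v" if "u \<in> L\<^sub>i i" "v \<in> L\<^sub>i i" for u v
  proof -
    have "f (u + v) = (\<Oplus>\<^bsub>A\<^esub>w\<in>C i. representation (C i) u w \<odot>\<^bsub>A\<^esub> F w \<oplus>\<^bsub>A\<^esub> representation (C i) v w \<odot>\<^bsub>A\<^esub> F w)"
      unfolding f_def representation_add[OF ind that(2,1)] 
      by (rule cg.finsum_cong') (use F_mem in \<open>auto simp: cg.smult_add_left\<close>)
    also have "\<dots> = f u \<oplus>\<^bsub>A\<^esub> f v"
      unfolding f_def by (rule cg.finsum_addf) (use F_mem in auto)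
    finally show ?thesis .
  qed
  have f_scale: "f (scale c u) = c \<odot>\<^bsub>A\<^esub> f u" if "u \<in> L\<^sub>i i" for c u
  proof -
    have "f (scale c u) = (\<Oplus>\<^bsub>A\<^esub>w\<in>C i. c \<odot>\<^bsub>A\<^esub> (representation (C i) u w \<odot>\<^bsub>A\<^esub> F w))"
      unfolding f_def representation_scale[OF ind that]
      by (rule cg.finsum_cong') (use F_mem in \<open>auto simp: cg.smult_smult\<close>)
    also have "\<dots> = c \<odot>\<^bsub>A\<^esub> f u"
      unfolding f_def by (rule cg.finsum_smult[symmetric, OF fin]) (use F_mem in auto)
    finally show ?thesis .
  qed
  have f_base: "f v = F v" if v: "v \<in> C i" for v
  proof -
    have "f v = (\<Oplus>\<^bsub>A\<^esub>w\<in>C i. if v = w then F w else \<zero>\<^bsub>A\<^esub>)"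
      unfolding f_def representation_basis[OF ind v]
      by (rule cg.finsum_cong') (use F_mem in auto)
    also have "\<dots> = F v"
      by (rule cg.finsum_singleton[OF v fin]) (use F_mem in auto)
    finally show ?thesis .
  qed
  have f_0: "f 0 = \<zero>\<^bsub>A\<^esub>"
    using f_scale[of 0 0] span_zero[of "C i"] by simp
  have YLp: "y a b \<in> Lp" "y a b \<in> L" if "1 \<le> a" "a \<le> b" "b \<le> i" for a b
    using y_Lp[of a b] y_gr[of a b] gr_L that i by auto
  have xL: "x a \<in> L" if "a \<in> {1..i}" for a
    using x_L that i by auto
  have deg_u: "g = g'" if "v \<in> gr g" "v \<in> gr g'" "v \<in> C i" for v g g'
    using gr_unique[OF that(1,2)] dependent_zero[of "C i"] ind that(3) by blast
  have base: "f u \<otimes>\<^bsub>A\<^esub> f w = \<epsilon> g h \<odot>\<^bsub>A\<^esub> (f w \<otimes>\<^bsub>A\<^esub> f u) \<oplus>\<^bsub>A\<^esub> f (br u w)"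
    if u: "u \<in> C i" "u \<in> gr g" and w: "w \<in> C i" "w \<in> gr h" for u w g h
    using u(1)
  proof (cases rule: C_cases)
    case ux: (x a)
    then have g: "g = dx a" using deg_u[OF u(2) _ u(1)] x_gr[of a] i by auto
    show ?thesis
      using w(1)
    proof (cases rule: C_cases)
      case wx: (x b)
      then have h: "h = dx b" using deg_u[OF w(2) _ w(1)] x_gr[of b] i by auto
      have "f (br u w) = (if a \<le> b then cg.G a b else (- \<epsilon> (dx a) (dx b)) \<odot>\<^bsub>A\<^esub> cg.G b a)"
      proof (cases "a \<le> b")
        case True
        then have "y a b \<in> C i"
          using ux wx unfolding C_def Y_def by (intro UnI2 CollectI exI[of _ a] exI[of _ b]) simp
        then show ?thesis
          using True ux wx f_base Fy[of a b] by (simp add: y_def)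
      next
        case False
        then have yC: "y b a \<in> C i"
          using ux wx unfolding C_def Y_def by (intro UnI2 CollectI exI[of _ a] exI[of _ b]) simp
        have "br u w = scale (- \<epsilon> (dx a) (dx b)) (y b a)"
          using y_swap[of a b] ux wx i by (simp add: y_def)
        then have "f (br u w) = (- \<epsilon> (dx a) (dx b)) \<odot>\<^bsub>A\<^esub> f (y b a)"
          by (simp only: f_scale[OF span_base[OF yC]])
        then show ?thesis
          using False ux wx f_base[OF yC] Fy[of b a] by simp
      qed
      then show ?thesis
        using cg.T_T_diag[of a b] ux wx u w by (simp add: f_base Fx g h dD)
    next
      case wy: (y b c)
      then have h: "h = dx b + dx c" using deg_u[OF w(2) _ w(1)] y_gr[of b c] i by auto
      have "br u w = 0"
        using color_central_right xL ux YLp[OF wy(1-3)] wy(4) by simp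
      moreover have "cg.qcomm (\<epsilon> h g) (cg.G b c) (\<tau> (s_index a a))"
        using cg.G_T_diag[OF wy(1-3) ux(1)] ux wy by (simp add: g h dD)
      then have "cg.qcomm (\<epsilon> g h) (\<tau> (s_index a a)) (cg.G b c)"
        by (rule cg.qcomm_sym) (use ux wy \<epsilon>_swap in auto)
      ultimately show ?thesis
        using ux wy u w by (simp add: f_base Fx Fy f_0 cg.qcomm_def)
    qed
  next
    case uy: (y a c)
    then have g: "g = dx a + dx c" using deg_u[OF u(2) _ u(1)] y_gr[of a c] i by auto
    have wL: "w \<in> L" using w(2) gr_L by blast
    have z: "br u w = 0"
      using color_central YLp[OF uy(1-3)] uy(4) wL by simp
    have "cg.qcomm (\<epsilon> g h) (F u) (F w)"
      using w(1)
    proof (cases rule: C_cases)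
      case wx: (x b)
      then have h: "h = dx b" using deg_u[OF w(2) _ w(1)] x_gr[of b] i by auto
      show ?thesis
        using cg.G_T_diag[OF uy(1-3) wx(1)] uy wx by (simp add: g h dD Fx Fy)
    next
      case wy: (y b e)
      then have h: "h = dx b + dx e" using deg_u[OF w(2) _ w(1)] y_gr[of b e] i by auto
      show ?thesis
        using cg.G_G[OF uy(1-3) wy(1-3)] uy wy by (simp add: g h dD Fy)
    qed
    then show ?thesis
      using z u w F_mem by (simp add: f_base f_0 cg.qcomm_def)
  qed
  have hom: "f u \<otimes>\<^bsub>A\<^esub> f w = \<epsilon> g h \<odot>\<^bsub>A\<^esub> (f w \<otimes>\<^bsub>A\<^esub> f u) \<oplus>\<^bsub>A\<^esub> f (br u w)"
    if u: "u \<in> gr\<^sub>i i g" and w: "w \<in> gr\<^sub>i i h" for u w g h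
  proof -
    let ?P = "\<lambda>u w. f u \<otimes>\<^bsub>A\<^esub> f w = \<epsilon> g h \<odot>\<^bsub>A\<^esub> (f w \<otimes>\<^bsub>A\<^esub> f u) \<oplus>\<^bsub>A\<^esub> f (br u w)"
    have LL: "v \<in> L" if "v \<in> L\<^sub>i i" for v using that span_C_L[OF i] by blast
    have P_right: "subspace {w \<in> L\<^sub>i i. ?P u w}" if u: "u \<in> L\<^sub>i i" for u
    proof (rule subspaceI)
      show "0 \<in> {w \<in> L\<^sub>i i. ?P u w}"
        using u by (simp add: span_zero f_0 br_0_right LL)
    next
      fix v w assume "v \<in> {w \<in> L\<^sub>i i. ?P u w}" "w \<in> {w \<in> L\<^sub>i i. ?P u w}"
      then have vw: "v \<in> L\<^sub>i i" "w \<in> L\<^sub>i i" "?P u v" "?P u w" by auto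
      have "f u \<otimes>\<^bsub>A\<^esub> f (v + w) = f u \<otimes>\<^bsub>A\<^esub> f v \<oplus>\<^bsub>A\<^esub> f u \<otimes>\<^bsub>A\<^esub> f w"
        using vw by (simp add: f_add cg.r_distr)
      also have "\<dots> = \<epsilon> g h \<odot>\<^bsub>A\<^esub> (f (v + w) \<otimes>\<^bsub>A\<^esub> f u) \<oplus>\<^bsub>A\<^esub> f (br u (v + w))"
        using vw u br_C[OF i] by (simp add: f_add br_add_right LL cg.l_distr cg.smult_add_right cg.a_ac)
      finally show "v + w \<in> {w \<in> L\<^sub>i i. ?P u w}" using vw by (simp add: span_add)
    next
      fix c w assume "w \<in> {w \<in> L\<^sub>i i. ?P u w}"
      then have vw: "w \<in> L\<^sub>i i" "?P u w" by auto
      have "f u \<otimes>\<^bsub>A\<^esub> f (scale c w) = c \<odot>\<^bsub>A\<^esub> (f u \<otimes>\<^bsub>A\<^esub> f w)"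
        using vw by (simp add: f_scale cg.smult_mult_right)
      also have "\<dots> = \<epsilon> g h \<odot>\<^bsub>A\<^esub> (f (scale c w) \<otimes>\<^bsub>A\<^esub> f u) \<oplus>\<^bsub>A\<^esub> f (br u (scale c w))"
        using vw u br_C[OF i]
        by (simp add: f_scale br_scale_right LL cg.smult_mult_left cg.smult_add_right cg.smult_smult mult.commute)
      finally show "scale c w \<in> {w \<in> L\<^sub>i i. ?P u w}" using vw by (simp add: span_scale)
    qed
    have P_left: "subspace {u \<in> L\<^sub>i i. ?P u w}" if w: "w \<in> L\<^sub>i i" for w
    proof (rule subspaceI)
      show "0 \<in> {u \<in> L\<^sub>i i. ?P u w}"
        using w by (simp add: span_zero f_0 br_0_left LL)
    next
      fix u v assume "u \<in> {u \<in> L\<^sub>i i. ?P u w}" "v \<in> {u \<in> L\<^sub>i i. ?P u w}"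
      then have vw: "u \<in> L\<^sub>i i" "v \<in> L\<^sub>i i" "?P u w" "?P v w" by auto
      have "f (u + v) \<otimes>\<^bsub>A\<^esub> f w = f u \<otimes>\<^bsub>A\<^esub> f w \<oplus>\<^bsub>A\<^esub> f v \<otimes>\<^bsub>A\<^esub> f w"
        using vw by (simp add: f_add cg.l_distr)
      also have "\<dots> = \<epsilon> g h \<odot>\<^bsub>A\<^esub> (f w \<otimes>\<^bsub>A\<^esub> f (u + v)) \<oplus>\<^bsub>A\<^esub> f (br (u + v) w)"
        using vw w br_C[OF i] by (simp add: f_add br_add_left LL cg.r_distr cg.smult_add_right cg.a_ac)
      finally show "u + v \<in> {u \<in> L\<^sub>i i. ?P u w}" using vw by (simp add: span_add)
    next
      fix c u assume "u \<in> {u \<in> L\<^sub>i i. ?P u w}"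
      then have vw: "u \<in> L\<^sub>i i" "?P u w" by auto
      have "f (scale c u) \<otimes>\<^bsub>A\<^esub> f w = c \<odot>\<^bsub>A\<^esub> (f u \<otimes>\<^bsub>A\<^esub> f w)"
        using vw by (simp add: f_scale cg.smult_mult_left)
      also have "\<dots> = \<epsilon> g h \<odot>\<^bsub>A\<^esub> (f w \<otimes>\<^bsub>A\<^esub> f (scale c u)) \<oplus>\<^bsub>A\<^esub> f (br (scale c u) w)"
        using vw w br_C[OF i]
        by (simp add: f_scale br_scale_left LL cg.smult_mult_right cg.smult_add_right cg.smult_smult mult.commute)
      finally show "scale c u \<in> {u \<in> L\<^sub>i i. ?P u w}" using vw by (simp add: span_scale)
    qed
    \<comment> \<open>Only basis elements of the degrees \<open>g\<close> and \<open>h\<close>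
      occur, so the factor \<open>\<epsilon> g h\<close> stays the same throughout the bilinear
      extension.\<close>
    have us: "u \<in> span (C i \<inter> gr g)" and ws: "w \<in> span (C i \<inter> gr h)"
      using u w by (auto intro!: gr_span_homogeneous C_hom[OF i])
    have CC: "v \<in> L\<^sub>i i" if "v \<in> C i" for v using that by (rule span_base)
    have 1: "?P u' w" if u': "u' \<in> C i \<inter> gr g" for u'
    proof -
      have "span (C i \<inter> gr h) \<subseteq> {w \<in> L\<^sub>i i. ?P u' w}"
        by (rule span_minimal[OF _ P_right]) (use u' base CC in auto)
      then show ?thesis using ws by auto
    qed
    have "span (C i \<inter> gr g) \<subseteq> {u \<in> L\<^sub>i i. ?P u w}"
      by (rule span_minimal[OF _ P_left]) (use 1 w CC in auto)
    then show ?thesis using us by auto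
  qed
  have "\<exists>h\<in>algebra_hom (U\<^sub>i i) A. \<forall>v\<in>L\<^sub>i i. h (uea_incl scale \<epsilon> (L\<^sub>i i) (gr\<^sub>i i) br v) = f v"
    by (rule S.uea_lift[OF cg.assoc_alg_axioms _ f_add f_scale hom]) (simp_all add: Pi_iff)
  then obtain h where h: "h \<in> algebra_hom (U\<^sub>i i) A" "\<And>v. v \<in> L\<^sub>i i \<Longrightarrow> h (uea_incl scale \<epsilon> (L\<^sub>i i) (gr\<^sub>i i) br v) = f v"
    by blast
  have "h (T\<^sub>i i r) = \<tau> r" if r: "r \<in> {1..n i}" for r
  proof -
    have "h (T\<^sub>i i r) = F (t r)"
      using h(2)[OF span_base[OF t_C[OF r i]]] f_base[OF t_C[OF r i]] by simp
    also have "\<dots> = \<tau> r"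
      using r i
    proof (cases rule: t_cases)
      case (diag a)
      then show ?thesis by (simp add: Fx)
    next
      case (off a b)
      then show ?thesis by (simp add: Fy cg.G_def)
    qed
    finally show ?thesis .
  qed
  with h(1) show ?thesis by blast
qed

text \<open>The universal map sends the standard monomials, which span U(X_i), to a basis: a
  combination is therefore determined by its image, and every element of \<open>A\<close> is
  reached.\<close>

lemma uea_iso:
  assumes i: "i \<le> m" and R: "color_relations \<epsilon> (\<lambda>r. d r) A (n i) \<tau>"
    and b: "basis_family A (exponents (n i)) (std_monomial A (n i) \<tau>)"
  shows "U\<^sub>i i \<cong>\<^sub>a A"
proof -
  interpret R: ore_relations "U\<^sub>i i" "n i" "T\<^sub>i i" "color_q \<epsilon> (\<lambda>r. d r)" "color_c \<epsilon> (\<lambda>r. d r)" color_k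
    by (rule uea_relations[OF i])
  interpret A: ore_relations A "n i" \<tau> "color_q \<epsilon> (\<lambda>r. d r)" "color_c \<epsilon> (\<lambda>r. d r)" color_k
    by (rule R)
  obtain h where h: "h \<in> algebra_hom (U\<^sub>i i) A" "\<And>r. r \<in> {1..n i} \<Longrightarrow> h (T\<^sub>i i r) = \<tau> r"
    using uea_lift_relations[OF i R] by blast
  interpret h: alg_hom "U\<^sub>i i" A h
    using R.assoc_alg_axioms A.assoc_alg_axioms h(1) by (rule alg_homI)
  have mon: "h (R.M \<alpha>) = A.M \<alpha>" for \<alpha>
  proof -
    have "std_monomial A (n i) (\<lambda>r. h (T\<^sub>i i r)) \<alpha> = A.M \<alpha>"
      unfolding std_monomial_def by (rule foldr_cong) (auto simp: h(2))
    then show ?thesis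
      using h.std_monomial[of "n i" "T\<^sub>i i" \<alpha>] R.T_closed by simp
  qed
  have hl: "h (lin_comb (U\<^sub>i i) R.M f) = lin_comb A A.M f" for f
    by (subst h.lin_comb) (simp_all add: mon)
  have "inj_on h (carrier (U\<^sub>i i))"
  proof (rule inj_onI)
    fix u v assume uv: "u \<in> carrier (U\<^sub>i i)" "v \<in> carrier (U\<^sub>i i)" "h u = h v"
    obtain f g where f: "u = lin_comb (U\<^sub>i i) R.M f" "keys f \<subseteq> exponents (n i)"
      and g: "v = lin_comb (U\<^sub>i i) R.M g" "keys g \<subseteq> exponents (n i)"
      using uv(1,2) unfolding uea_mon_span[OF i] by blast
    have "f = g"
      using A.basis_family_eqD[OF b f(2) g(2)] uv(3) f g hl by simp
    then show "u = v" using f g by simp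
  qed
  moreover have "h ` carrier (U\<^sub>i i) = carrier A"
  proof
    show "carrier A \<subseteq> h ` carrier (U\<^sub>i i)"
    proof
      fix a assume "a \<in> carrier A"
      then obtain f where f: "keys f \<subseteq> exponents (n i)" "a = lin_comb A A.M f"
        using b unfolding basis_family_def by blast
      then have "a = h (lin_comb (U\<^sub>i i) R.M f)" by (simp add: hl)
      then show "a \<in> h ` carrier (U\<^sub>i i)" by (rule image_eqI) auto
    qed
  qed auto
  ultimately show ?thesis
    by (intro is_algebra_isoI[OF h(1)]) (simp add: bij_betw_def)
qed

text \<open>Spanning is \<open>uea_mon_span\<close>; independence is pulled back along the
  homomorphism to the operator algebra.\<close>

lemma uea_basis: "basis_family (U\<^sub>i m) (exponents (n m)) (std_monomial (U\<^sub>i m) (n m) (T\<^sub>i m))"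
proof -
  interpret R: ore_relations "U\<^sub>i m" "n m" "T\<^sub>i m" "color_q \<epsilon> (\<lambda>r. d r)" "color_c \<epsilon> (\<lambda>r. d r)" color_k
    by (rule uea_relations) simp
  interpret gd: generic_degrees \<epsilon> m "\<lambda>r. d r"
    by (rule generic_degrees) simp
  obtain h where h: "h \<in> algebra_hom (U\<^sub>i m) gd.\<O>" "\<And>r. r \<in> {1..n m} \<Longrightarrow> h (T\<^sub>i m r) = gd.Top r"
    using uea_lift_relations[OF order_refl gd.Top_relations] by blast
  interpret h: alg_hom "U\<^sub>i m" gd.\<O> h
    using R.assoc_alg_axioms op_algebra_assoc_alg h(1) by (rule alg_homI)
  have mon: "h (R.M \<alpha>) = std_monomial gd.\<O> (n m) gd.Top \<alpha>" for \<alpha>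
  proof -
    have "std_monomial gd.\<O> (n m) (\<lambda>r. h (T\<^sub>i m r)) \<alpha> = std_monomial gd.\<O> (n m) gd.Top \<alpha>"
      unfolding std_monomial_def by (rule foldr_cong) (auto simp: h(2) simp del: op_algebra_simps)
    then show ?thesis
      using h.std_monomial[of "n m" "T\<^sub>i m" \<alpha>] R.T_closed by simp
  qed
  show ?thesis
    unfolding basis_family_def
  proof (intro conjI ballI allI impI)
    show "R.M ` exponents (n m) \<subseteq> carrier (U\<^sub>i m)" by auto
    show "\<exists>c. keys c \<subseteq> exponents (n m) \<and> u = lin_comb (U\<^sub>i m) R.M c" if "u \<in> carrier (U\<^sub>i m)" for u
      using that unfolding uea_mon_span[OF order_refl] by blast
    fix c assume c: "keys c \<subseteq> exponents (n m)" "lin_comb (U\<^sub>i m) R.M c = \<zero>\<^bsub>U\<^sub>i m\<^esub>"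
    have "lin_comb gd.\<O> (std_monomial gd.\<O> (n m) gd.Top) c = h (lin_comb (U\<^sub>i m) R.M c)"
      by (subst h.lin_comb) (simp_all add: mon del: op_algebra_simps)
    also have "\<dots> = \<zero>\<^bsub>gd.\<O>\<^esub>" unfolding c(2) by (rule h.zero)
    finally show "c = 0"
      by (rule gd.Top_independent[OF c(1)])
  qed
qed

lemma uea_m: "U\<^sub>i m = uea scale \<epsilon> L gr br" "T\<^sub>i m = (\<lambda>r. uea_incl scale \<epsilon> L gr br (t r))"
proof -
  have "gr\<^sub>i m = gr" unfolding span_C_m using gr_L by blast
  then show "U\<^sub>i m = uea scale \<epsilon> L gr br" "T\<^sub>i m = (\<lambda>r. uea_incl scale \<epsilon> L gr br (t r))"
    by (simp_all add: span_C_m)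
qed

end

section \<open>Ore extensions and standard monomials\<close>

text \<open>Convolution with \<open>xpow r k\<close> raises the exponent of the \<open>r\<close>-th variable by \<open>k\<close>, so it corresponds to
  multiplication by \<open>\<theta>\<^sup>k\<close> on the right.\<close>

abbreviation xpow :: "nat \<Rightarrow> nat \<Rightarrow> ((nat \<Rightarrow>\<^sub>0 nat) \<Rightarrow>\<^sub>0 'k::field)" where
  "xpow r k \<equiv> Poly_Mapping.single (Poly_Mapping.single r k) 1"

lemma lookup_times_single:
  fixes f :: "(nat \<Rightarrow>\<^sub>0 nat) \<Rightarrow>\<^sub>0 'k::field"
  shows "lookup (f * Poly_Mapping.single \<gamma> 1) (\<alpha> + \<gamma>) = lookup f \<alpha>"
  using subset_UNIV
proof (induction f rule: poly_mapping_add_induct)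
  case (add v c f)
  then show ?case
    by (simp add: ring_distribs mult_single lookup_add lookup_single when_def)
qed simp

lemma exponents_Suc_decomp:
  assumes "\<gamma> \<in> exponents (Suc s)"
  obtains \<alpha> k where "\<gamma> = \<alpha> + Poly_Mapping.single (Suc s) k" "\<alpha> \<in> exponents s"
proof
  define \<alpha> where "\<alpha> = \<gamma> - Poly_Mapping.single (Suc s) (lookup \<gamma> (Suc s))"
  show "\<gamma> = \<alpha> + Poly_Mapping.single (Suc s) (lookup \<gamma> (Suc s))"
    by (rule poly_mapping_eqI) (auto simp: \<alpha>_def lookup_add lookup_minus lookup_single when_def)
  show "\<alpha> \<in> exponents s"
    using assms
    by (auto simp: \<alpha>_def exponents_def in_keys_iff lookup_minus lookup_single when_def subset_iff le_Suc_eq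
        split: if_splits)
qed

text \<open>A polynomial in \<open>Suc s\<close> variables is read as one in the last variable with
  coefficients in the others, the shape in which Ore extensions expand. Coefficients outside
  \<open>N\<close> are zero, so that \<open>N\<close> may be enlarged.\<close>

lemma slices:
  assumes "keys c \<subseteq> exponents (Suc s)"
  shows "\<exists>N g. finite N \<and> (\<forall>k. keys (g k) \<subseteq> exponents s) \<and> (\<forall>k. k \<notin> N \<longrightarrow> g k = 0) \<and>
    c = (\<Sum>k\<in>N. g k * xpow (Suc s) k)"
  using assms
proof (induction c rule: poly_mapping_add_induct)
  case zero
  show ?case by (intro exI[of _ "{}"] exI[of _ "\<lambda>_. 0"]) simp
next
  case (add v a c)
  obtain N g where N: "finite N" "\<And>k. keys (g k) \<subseteq> exponents s" "\<And>k. k \<notin> N \<Longrightarrow> g k = 0"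
    "c = (\<Sum>k\<in>N. g k * xpow (Suc s) k)"
    using add.IH by blast
  obtain \<alpha> k where k: "v = \<alpha> + Poly_Mapping.single (Suc s) k" "\<alpha> \<in> exponents s"
    using exponents_Suc_decomp[OF add(1)] by blast
  let ?g = "g(k := Poly_Mapping.single \<alpha> a + g k)"
  have "c = (\<Sum>l\<in>insert k N. g l * xpow (Suc s) l)"
    unfolding N(4) using N(1,3) by (intro sum.mono_neutral_left) auto
  also have "\<dots> = g k * xpow (Suc s) k + (\<Sum>l\<in>insert k N - {k}. g l * xpow (Suc s) l)"
    using N(1) by (intro sum.remove) auto
  finally have "Poly_Mapping.single v a + c = ?g k * xpow (Suc s) k + (\<Sum>l\<in>insert k N - {k}. g l * xpow (Suc s) l)"
    by (simp add: ring_distribs mult_single k)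
  also have "\<dots> = ?g k * xpow (Suc s) k + (\<Sum>l\<in>insert k N - {k}. ?g l * xpow (Suc s) l)"
    by (auto intro!: arg_cong2[where f = "(+)"] sum.cong)
  also have "\<dots> = (\<Sum>l\<in>insert k N. ?g l * xpow (Suc s) l)"
    using N(1) by (intro sum.remove[symmetric]) auto
  finally have "Poly_Mapping.single v a + c = (\<Sum>l\<in>insert k N. ?g l * xpow (Suc s) l)" .
  moreover have "keys (Poly_Mapping.single \<alpha> a + g k) \<subseteq> exponents s"
    using keys_add[of "Poly_Mapping.single \<alpha> a" "g k"] N(2)[of k] k(2) by (auto split: if_splits)
  ultimately show ?case
    using N(1-3) by (intro exI[of _ "insert k N"] exI[of _ ?g]) auto
qed

lemma exponents_Suc_cancel:
  assumes "\<alpha> \<in> exponents s" "\<beta> \<in> exponents s"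
    and eq: "\<alpha> + Poly_Mapping.single (Suc s) k = \<beta> + Poly_Mapping.single (Suc s) l"
  shows "k = l"
proof -
  have "lookup (\<alpha> + Poly_Mapping.single (Suc s) k) (Suc s) = lookup (\<beta> + Poly_Mapping.single (Suc s) l) (Suc s)"
    by (simp only: eq)
  then show ?thesis
    using exponents_lookup[OF assms(1), of "Suc s"] exponents_lookup[OF assms(2), of "Suc s"]
    by (simp add: lookup_add)
qed

lemma slices_unique:
  fixes g :: "nat \<Rightarrow> (nat \<Rightarrow>\<^sub>0 nat) \<Rightarrow>\<^sub>0 'k::field"
  assumes N: "finite N" and g: "\<And>k. keys (g k) \<subseteq> exponents s" and z: "(\<Sum>k\<in>N. g k * xpow (Suc s) k) = 0"
    and k: "k \<in> N"
  shows "g k = 0"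
proof (rule poly_mapping_eqI)
  fix \<alpha>
  show "lookup (g k) \<alpha> = lookup 0 \<alpha>"
  proof (cases "\<alpha> \<in> exponents s")
    case True
    let ?\<beta> = "\<alpha> + Poly_Mapping.single (Suc s) k"
    have "lookup (g l * xpow (Suc s) l) ?\<beta> = 0" if "l \<in> N - {k}" for l
    proof (rule ccontr)
      assume "lookup (g l * xpow (Suc s) l) ?\<beta> \<noteq> 0"
      then have "?\<beta> \<in> keys (g l * xpow (Suc s) l)" by (simp add: in_keys_iff)
      then obtain \<gamma> where "\<gamma> \<in> keys (g l)" "?\<beta> = \<gamma> + Poly_Mapping.single (Suc s) l"
        using keys_mult[of "g l" "xpow (Suc s) l"] by auto
      then have "k = l"
        using exponents_Suc_cancel[OF True, of \<gamma> k l] g[of l] by auto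
      then show False using that by simp
    qed
    then have "lookup (\<Sum>l\<in>N. g l * xpow (Suc s) l) ?\<beta> = lookup (g k * xpow (Suc s) k) ?\<beta>"
      unfolding lookup_sum using N k by (subst sum.remove[of N k]) auto
    then show ?thesis
      using z by (simp add: lookup_times_single)
  next
    case False
    then show ?thesis using g[of k] by (auto simp: in_keys_iff subset_iff)
  qed
qed

lemma keys_slices_sum:
  fixes g :: "nat \<Rightarrow> (nat \<Rightarrow>\<^sub>0 nat) \<Rightarrow>\<^sub>0 'k::field"
  assumes "\<And>k. keys (g k) \<subseteq> exponents s"
  shows "keys (\<Sum>k\<in>N. g k * xpow (Suc s) k) \<subseteq> exponents (Suc s)"
proof
  fix \<beta> assume "\<beta> \<in> keys (\<Sum>k\<in>N. g k * xpow (Suc s) k)"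
  then have "(\<Sum>k\<in>N. lookup (g k * xpow (Suc s) k) \<beta>) \<noteq> 0"
    by (simp add: in_keys_iff lookup_sum)
  then obtain k where "lookup (g k * xpow (Suc s) k) \<beta> \<noteq> 0"
    by (meson sum.neutral)
  then have "\<beta> \<in> keys (g k * xpow (Suc s) k)" by (simp add: in_keys_iff)
  then obtain \<gamma> where "\<gamma> \<in> keys (g k)" "\<beta> = \<gamma> + Poly_Mapping.single (Suc s) k"
    using keys_mult[of "g k" "xpow (Suc s) k"] by auto
  moreover have "Poly_Mapping.single (Suc s) k \<in> exponents (Suc s)"
    by (simp add: exponents_def)
  ultimately show "\<beta> \<in> exponents (Suc s)"
    using assms[of k] exponents_mono[of s "Suc s"] by auto
qed

context assoc_alg
begin

lemma std_monomial_fun: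
  "(\<And>i. i \<in> {1..n} \<Longrightarrow> T i \<in> carrier A) \<Longrightarrow> std_monomial A n T \<in> J \<rightarrow> carrier A"
  by (intro Pi_I std_monomial_closed)

lemma monomial_tail_mult:
  assumes "\<And>i. i \<in> set xs \<Longrightarrow> T i \<in> carrier A" "z \<in> carrier A"
  shows "foldr (\<lambda>i u. (T i [^] (lookup \<alpha> i :: nat)) \<otimes> u) xs z =
    foldr (\<lambda>i u. (T i [^] (lookup \<alpha> i :: nat)) \<otimes> u) xs \<one> \<otimes> z"
  using assms
proof (induction xs)
  case (Cons a xs)
  then show ?case
    using monomial_tail_closed[of xs T \<one> \<alpha>] by (simp add: m_assoc)
qed simp

text \<open>The last variable stands rightmost in a standard monomial, in agreement with the
  coefficients on the left in an Ore extension.\<close>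

lemma std_monomial_Suc:
  assumes T: "\<And>i. i \<in> {1..Suc s} \<Longrightarrow> T i \<in> carrier A" and \<alpha>: "\<alpha> \<in> exponents s"
  shows "std_monomial A (Suc s) T (\<alpha> + Poly_Mapping.single (Suc s) k) = std_monomial A s T \<alpha> \<otimes> (T (Suc s) [^] k)"
proof -
  let ?\<beta> = "\<alpha> + Poly_Mapping.single (Suc s) k"
  have "[1..<Suc (Suc s)] = [1..<Suc s] @ [Suc s]" by simp
  then have "std_monomial A (Suc s) T ?\<beta> =
      foldr (\<lambda>i u. (T i [^] lookup ?\<beta> i) \<otimes> u) [1..<Suc s] ((T (Suc s) [^] lookup ?\<beta> (Suc s)) \<otimes> \<one>)"
    by (simp add: std_monomial_def)
  also have "lookup ?\<beta> (Suc s) = k"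
    using exponents_lookup[OF \<alpha>, of "Suc s"] by (simp add: lookup_add)
  also have "(T (Suc s) [^] k) \<otimes> \<one> = T (Suc s) [^] k"
    using T by simp
  also have "foldr (\<lambda>i u. (T i [^] lookup ?\<beta> i) \<otimes> u) [1..<Suc s] (T (Suc s) [^] k) =
      foldr (\<lambda>i u. (T i [^] lookup \<alpha> i) \<otimes> u) [1..<Suc s] (T (Suc s) [^] k)"
    by (rule monomial_tail_cong) (auto simp: lookup_add lookup_single when_def)
  also have "\<dots> = std_monomial A s T \<alpha> \<otimes> (T (Suc s) [^] k)"
    unfolding std_monomial_def by (rule monomial_tail_mult) (use T in auto)
  finally show ?thesis .
qed

lemma lin_comb_slice:
  assumes T: "\<And>i. i \<in> {1..Suc s} \<Longrightarrow> T i \<in> carrier A" and f: "keys f \<subseteq> exponents s"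
  shows "lin_comb A (std_monomial A (Suc s) T) (f * xpow (Suc s) k) =
    lin_comb A (std_monomial A s T) f \<otimes> (T (Suc s) [^] k)"
  using f
proof (induction f rule: poly_mapping_add_induct)
  case zero
  show ?case using T[of "Suc s"] by simp
next
  case (add v c f)
  note v = add(1) and f = add(2)
  have m1: "std_monomial A (Suc s) T \<in> J \<rightarrow> carrier A" for J
    by (rule std_monomial_fun[OF T])
  have m2: "std_monomial A s T \<in> J \<rightarrow> carrier A" for J
    by (rule std_monomial_fun) (use T in auto)
  note m = funcset_mem[OF m1[of UNIV] UNIV_I] funcset_mem[OF m2[of UNIV] UNIV_I]
  have Sv: "std_monomial A (Suc s) T (v + Poly_Mapping.single (Suc s) k) = std_monomial A s T v \<otimes> (T (Suc s) [^] k)"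
    by (rule std_monomial_Suc[OF _ v]) (rule T)
  have "lin_comb A (std_monomial A (Suc s) T) ((Poly_Mapping.single v c + f) * xpow (Suc s) k) =
    lin_comb A (std_monomial A (Suc s) T) (Poly_Mapping.single (v + Poly_Mapping.single (Suc s) k) c + f * xpow (Suc s) k)"
    by (simp add: ring_distribs mult_single)
  also have "\<dots> = c \<odot> std_monomial A (Suc s) T (v + Poly_Mapping.single (Suc s) k) \<oplus>
      lin_comb A (std_monomial A (Suc s) T) (f * xpow (Suc s) k)"
    using lin_comb_add[OF m1[of UNIV]] m by simp
  also have "\<dots> = (c \<odot> std_monomial A s T v \<oplus> lin_comb A (std_monomial A s T) f) \<otimes> (T (Suc s) [^] k)"
    using T[of "Suc s"] m lin_comb_closed[OF m2] f add.IH
    by (simp add: Sv l_distr smult_mult_left)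
  also have "c \<odot> std_monomial A s T v \<oplus> lin_comb A (std_monomial A s T) f =
      lin_comb A (std_monomial A s T) (Poly_Mapping.single v c + f)"
    using lin_comb_add[OF m2[of UNIV], of "Poly_Mapping.single v c" f] m by simp
  finally show ?case .
qed

lemma lin_comb_sum:
  assumes "finite N" "b \<in> UNIV \<rightarrow> carrier A"
  shows "lin_comb A b (\<Sum>k\<in>N. g k) = (\<Oplus>k\<in>N. lin_comb A b (g k))"
  using assms(1)
proof (induction N)
  case (insert k N)
  have c: "lin_comb A b h \<in> carrier A" for h
    using assms(2) by (intro lin_comb_closed) auto
  show ?case
    using insert c lin_comb_add[OF assms(2)] by (simp add: Pi_iff)
qed simp

lemma lin_comb_slices:
  assumes T: "\<And>i. i \<in> {1..Suc s} \<Longrightarrow> T i \<in> carrier A" and N: "finite N" and g: "\<And>k. keys (g k) \<subseteq> exponents s"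
  shows "lin_comb A (std_monomial A (Suc s) T) (\<Sum>k\<in>N. g k * xpow (Suc s) k) =
    (\<Oplus>k\<in>N. lin_comb A (std_monomial A s T) (g k) \<otimes> (T (Suc s) [^] k))"
proof -
  have "std_monomial A s T \<in> J \<rightarrow> carrier A" for J
    by (rule std_monomial_fun) (use T in auto)
  then have "lin_comb A (std_monomial A s T) (g k) \<in> carrier A" for k
    by (rule lin_comb_closed)
  moreover have "std_monomial A (Suc s) T \<in> UNIV \<rightarrow> carrier A"
    by (rule std_monomial_fun[OF T])
  ultimately show ?thesis
    using T[of "Suc s"] lin_comb_slice[OF T g] by (subst lin_comb_sum[OF N]) (auto intro!: finsum_cong')
qed

end

lemma subalgebra_hom:
  assumes "assoc_alg A" "assoc_alg B" "subalgebra_of A B" shows "alg_hom A B (\<lambda>x. x)"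
  using assms by (intro alg_homI algebra_homI) (auto simp: subalgebra_of_def)

text \<open>Expanding the coefficients of the powers of the new variable in the basis of
  \<open>A\<close> gives spanning. Independence is the uniqueness of the expansion of zero, combined
  with independence in \<open>A\<close>.\<close>

lemma ore_extension_basis:
  fixes A :: "('k::field, 'a) module"
  assumes ore: "ore_extension A (T (Suc s)) \<sigma> \<delta> B" and T: "\<And>i. i \<in> {1..s} \<Longrightarrow> T i \<in> carrier A"
    and b: "basis_family A (exponents s) (std_monomial A s T)"
  shows "basis_family B (exponents (Suc s)) (std_monomial B (Suc s) T)"
proof -
  have A: "assoc_alg A" and B: "assoc_alg B" and sub: "subalgebra_of A B" and \<theta>: "T (Suc s) \<in> carrier B"
    using ore by (auto simp: ore_extension_def assoc_algebra_iff)
  interpret h: alg_hom A B "\<lambda>x. x" by (rule subalgebra_hom[OF A B sub])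
  have TB: "T i \<in> carrier B" if "i \<in> {1..Suc s}" for i
    using that T \<theta> h.closed by (cases "i = Suc s") auto
  have mAB: "std_monomial B s T = std_monomial A s T"
    using h.std_monomial[of s T] T by auto
  have mA: "std_monomial A s T \<in> J \<rightarrow> carrier A" for J
    by (rule h.A.std_monomial_fun[OF T])
  have lAB: "lin_comb B (std_monomial B s T) c = lin_comb A (std_monomial A s T) c" for c
    unfolding mAB using h.lin_comb[OF mA] by simp
  have lA: "lin_comb A (std_monomial A s T) c \<in> carrier A" for c
    by (rule h.A.lin_comb_closed[OF mA])
  define Q where "Q u f \<longleftrightarrow> range f \<subseteq> carrier A \<and> finite {n. f n \<noteq> \<zero>\<^bsub>A\<^esub>} \<and>
        u = (\<Oplus>\<^bsub>B\<^esub>n\<in>{n. f n \<noteq> \<zero>\<^bsub>A\<^esub>}. f n \<otimes>\<^bsub>B\<^esub> (T (Suc s) [^]\<^bsub>B\<^esub> n))" for u and f :: "nat \<Rightarrow> 'a"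
  have rep: "\<exists>!f. Q u f" if "u \<in> carrier B" for u
    using ore that unfolding ore_extension_def Q_def by blast
  show ?thesis
    unfolding basis_family_def
  proof (intro conjI ballI allI impI)
    show "std_monomial B (Suc s) T ` exponents (Suc s) \<subseteq> carrier B"
      by (rule funcset_image[OF h.B.std_monomial_fun[OF TB]])
  next
    fix u assume u: "u \<in> carrier B"
    obtain f :: "nat \<Rightarrow> 'a" where f: "range f \<subseteq> carrier A" "finite {n. f n \<noteq> \<zero>\<^bsub>A\<^esub>}"
      "u = (\<Oplus>\<^bsub>B\<^esub>n\<in>{n. f n \<noteq> \<zero>\<^bsub>A\<^esub>}. f n \<otimes>\<^bsub>B\<^esub> (T (Suc s) [^]\<^bsub>B\<^esub> n))"
      using ex1_implies_ex[OF rep[OF u]] unfolding Q_def by (elim exE conjE) (rule that)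
    have "f n \<in> carrier A" for n
      using f(1) by blast
    moreover have "\<forall>u\<in>carrier A. \<exists>c. keys c \<subseteq> exponents s \<and> u = lin_comb A (std_monomial A s T) c"
      using b unfolding basis_family_def by (elim conjE)
    ultimately have "\<exists>g. \<forall>n. keys (g n) \<subseteq> exponents s \<and> f n = lin_comb A (std_monomial A s T) (g n)"
      by (intro choice allI) (erule bspec)
    then obtain g where g: "\<And>n. keys (g n) \<subseteq> exponents s" "\<And>n. f n = lin_comb A (std_monomial A s T) (g n)"
      by (elim exE) (rule that, simp_all)
    let ?N = "{n. f n \<noteq> \<zero>\<^bsub>A\<^esub>}"
    have "u = (\<Oplus>\<^bsub>B\<^esub>n\<in>?N. lin_comb B (std_monomial B s T) (g n) \<otimes>\<^bsub>B\<^esub> (T (Suc s) [^]\<^bsub>B\<^esub> n))"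
      unfolding f(3) lAB g(2)[symmetric] ..
    also have "\<dots> = lin_comb B (std_monomial B (Suc s) T) (\<Sum>n\<in>?N. g n * xpow (Suc s) n)"
      by (rule h.B.lin_comb_slices[OF TB f(2) g(1), symmetric])
    finally show "\<exists>c. keys c \<subseteq> exponents (Suc s) \<and> u = lin_comb B (std_monomial B (Suc s) T) c"
      using keys_slices_sum[OF g(1)] by (intro exI conjI)
  next
    fix c assume c: "keys c \<subseteq> exponents (Suc s)" "lin_comb B (std_monomial B (Suc s) T) c = \<zero>\<^bsub>B\<^esub>"
    obtain N g where N: "finite N" "\<And>k. keys (g k) \<subseteq> exponents s" "\<And>k. k \<notin> N \<Longrightarrow> g k = 0"
      "c = (\<Sum>k\<in>N. g k * xpow (Suc s) k)"
      using slices[OF c(1)] by (elim exE conjE) (rule that, simp_all)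
    define f where "f k = lin_comb A (std_monomial A s T) (g k)" for k
    have "f n = \<zero>\<^bsub>A\<^esub>" if "n \<notin> N" for n
      unfolding f_def N(3)[OF that] by (rule h.A.lin_comb_0)
    then have fN: "{n. f n \<noteq> \<zero>\<^bsub>A\<^esub>} \<subseteq> N"
      by blast
    have fB: "f n \<in> carrier B" for n
      using lA h.closed by (simp add: f_def)
    have "\<zero>\<^bsub>B\<^esub> = (\<Oplus>\<^bsub>B\<^esub>n\<in>N. f n \<otimes>\<^bsub>B\<^esub> (T (Suc s) [^]\<^bsub>B\<^esub> n))"
      using h.B.lin_comb_slices[OF TB N(1,2)] c(2) by (simp add: N(4) lAB f_def)
    also have "\<dots> = (\<Oplus>\<^bsub>B\<^esub>n\<in>{n. f n \<noteq> \<zero>\<^bsub>A\<^esub>}. f n \<otimes>\<^bsub>B\<^esub> (T (Suc s) [^]\<^bsub>B\<^esub> n))"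
      by (rule h.B.add.finprod_mono_neutral_cong_right[OF N(1) fN])
        (use fB \<theta> in auto)
    finally have 0: "\<zero>\<^bsub>B\<^esub> = \<dots>" .
    have "range f \<subseteq> carrier A"
      unfolding f_def using lA by blast
    then have Pf: "Q \<zero>\<^bsub>B\<^esub> f"
      unfolding Q_def using finite_subset[OF fN N(1)] 0 by (intro conjI)
    have "range (\<lambda>_::nat. \<zero>\<^bsub>A\<^esub>) \<subseteq> carrier A"
      using h.A.zero_closed by blast
    then have P0: "Q \<zero>\<^bsub>B\<^esub> (\<lambda>_. \<zero>\<^bsub>A\<^esub>)"
      unfolding Q_def by simp
    have "f = (\<lambda>_. \<zero>\<^bsub>A\<^esub>)"
      using rep[OF h.B.zero_closed] Pf P0 by blast
    then have "lin_comb A (std_monomial A s T) (g k) = \<zero>\<^bsub>A\<^esub>" for k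
      unfolding f_def by (rule fun_cong)
    then have "g k = 0" for k
      using b N(2)[of k] unfolding basis_family_def by (elim conjE allE[of _ "g k"] impE)
    then show "c = 0" by (simp add: N(4))
  qed
qed

text \<open>The commutation rule of the extension, applied to the older variables, supplies the new
  relations; the older ones persist in the larger algebra.\<close>

lemma ore_extension_relations:
  assumes ore: "ore_extension A (T (Suc s)) \<sigma> \<delta> B" and R: "color_relations \<epsilon> d A s T"
    and nz: "\<And>a b. \<epsilon> a b \<noteq> 0"
    and \<sigma>: "\<And>l. l \<in> {1..s} \<Longrightarrow> \<sigma> (T l) = \<epsilon> (d (Suc s)) (d l) \<odot>\<^bsub>A\<^esub> T l"
    and \<delta>: "\<And>l. l \<in> {1..s} \<Longrightarrow> \<delta> (T l) = color_c \<epsilon> d (Suc s) l \<odot>\<^bsub>A\<^esub> T (color_k (Suc s) l)"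
  shows "color_relations \<epsilon> d B (Suc s) T"
proof -
  interpret R: ore_relations A s T "color_q \<epsilon> d" "color_c \<epsilon> d" color_k by (rule R)
  have B: "assoc_alg B" and sub: "subalgebra_of A B" and \<theta>: "T (Suc s) \<in> carrier B"
    using ore by (auto simp: ore_extension_def assoc_algebra_iff)
  interpret h: alg_hom A B "\<lambda>x. x" by (rule subalgebra_hom[OF R.assoc_alg_axioms B sub])
  show ?thesis
  proof (intro ore_relations.intro B ore_relations_axioms.intro nz color_k_range; assumption?)
    show "T i \<in> carrier B" if "i \<in> {1..Suc s}" for i
      using that R.T_closed[of i] \<theta> h.closed by (cases "i = Suc s") auto
    fix l r assume lr: "1 \<le> l" "l < r" "r \<le> Suc s"
    have "T l \<in> carrier A" "T (color_k r l) \<in> carrier A"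
      using lr color_k_range[OF lr(1,2)] by (auto intro!: R.T_closed)
    note c = this and cB = this[THEN h.closed]
    show "T r \<otimes>\<^bsub>B\<^esub> T l = \<epsilon> (d r) (d l) \<odot>\<^bsub>B\<^esub> (T l \<otimes>\<^bsub>B\<^esub> T r) \<oplus>\<^bsub>B\<^esub> color_c \<epsilon> d r l \<odot>\<^bsub>B\<^esub> T (color_k r l)"
    proof (cases "r = Suc s")
      case True
      have "T (Suc s) \<otimes>\<^bsub>B\<^esub> T l = (\<sigma> (T l) \<otimes>\<^bsub>B\<^esub> T (Suc s)) \<oplus>\<^bsub>B\<^esub> \<delta> (T l)"
        using ore c by (simp add: ore_extension_def)
      then show ?thesis
        using \<sigma>[of l] \<delta>[of l] lr c cB \<theta> True by (simp add: h.smult h.B.smult_mult_left)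
    next
      case False
      then have "r \<le> s" and "T r \<in> carrier A"
        using lr by (auto intro!: R.T_closed)
      then show ?thesis
        using R.rel[OF lr(1,2)] c
        by (simp only: h.mult[symmetric] h.add[symmetric] h.smult[symmetric] R.smult_cl R.m_closed)
    qed
  qed
qed

theorem ore_tower_basis:
  assumes nz: "\<And>a b. \<epsilon> a b \<noteq> 0" and tower: "ore_tower \<epsilon> d \<tau> r A"
  shows "color_relations \<epsilon> d A r \<tau> \<and> basis_family A (exponents r) (std_monomial A r \<tau>)"
  using tower
proof (induction rule: ore_tower.induct)
  case (base A)
  then interpret assoc_alg A by (simp add: assoc_algebra_iff)
  have e: "exponents 0 = {0}" by (auto simp: exponents_def)
  have m: "std_monomial A 0 \<tau> = (\<lambda>_. \<one>\<^bsub>A\<^esub>)" by (auto simp: std_monomial_def)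
  have k: "c = Poly_Mapping.single 0 (lookup c 0)" if "keys c \<subseteq> {0}" for c :: "(nat \<Rightarrow>\<^sub>0 nat) \<Rightarrow>\<^sub>0 'b"
    using that by (intro poly_mapping_eqI) (auto simp: lookup_single when_def in_keys_iff)
  have "basis_family A (exponents 0) (std_monomial A 0 \<tau>)"
    unfolding basis_family_def e m
  proof (intro conjI ballI allI impI)
    fix u assume "u \<in> carrier A"
    then obtain c where "u = c \<odot>\<^bsub>A\<^esub> \<one>\<^bsub>A\<^esub>" using base by blast
    then show "\<exists>c. keys c \<subseteq> {0} \<and> u = lin_comb A (\<lambda>_. \<one>\<^bsub>A\<^esub>) c"
      by (intro exI[of _ "Poly_Mapping.single 0 c"]) simp
  next
    fix c :: "(nat \<Rightarrow>\<^sub>0 nat) \<Rightarrow>\<^sub>0 'b"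
    assume c: "keys c \<subseteq> {0}" "lin_comb A (\<lambda>_. \<one>\<^bsub>A\<^esub>) c = \<zero>\<^bsub>A\<^esub>"
    have "lookup c 0 \<odot>\<^bsub>A\<^esub> \<one>\<^bsub>A\<^esub> = \<zero>\<^bsub>A\<^esub>"
      using c(2) by (subst (asm) k[OF c(1)]) simp
    then have "lookup c 0 = 0"
      using base(2) smult_eq_0_iff[of "\<one>\<^bsub>A\<^esub>"] by simp
    then show "c = 0"
      using k[OF c(1)] by simp
  qed auto
  moreover have "color_relations \<epsilon> d A 0 \<tau>"
  proof (rule color_relationsI)
    fix b j :: nat assume "1 \<le> b" "b < j" "s_index j j \<le> 0"
    then have False using s_index_ge_1[of j j] by simp
    then show "\<tau> (s_index j j) \<otimes>\<^bsub>A\<^esub> \<tau> (s_index b b) = \<epsilon> (d (s_index j j)) (d (s_index b b)) \<odot>\<^bsub>A\<^esub> (\<tau> (s_index b b) \<otimes>\<^bsub>A\<^esub> \<tau> (s_index j j))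
        \<oplus>\<^bsub>A\<^esub> (- \<epsilon> (d (s_index j j)) (d (s_index b b))) \<odot>\<^bsub>A\<^esub> \<tau> (s_index b j)" ..
  qed (auto simp: assoc_alg_axioms nz)
  ultimately show ?case by blast
next
  case (off_diagonal i j r A \<sigma> B)
  have "r \<noteq> 0"
    using off_diagonal(1,3) s_index_ge_1[of i j] by simp
  then obtain s where s: "r = Suc s"
    by (cases r) auto
  have ore: "ore_extension A (\<tau> (Suc s)) \<sigma> (\<lambda>_. \<zero>\<^bsub>A\<^esub>) B" using off_diagonal(5) s by simp
  have IH: "color_relations \<epsilon> d A s \<tau>" "basis_family A (exponents s) (std_monomial A s \<tau>)"
    using off_diagonal.IH s by auto
  interpret IH: ore_relations A s \<tau> "color_q \<epsilon> d" "color_c \<epsilon> d" color_k by (rule IH(1))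
  have "color_relations \<epsilon> d B (Suc s) \<tau>"
  proof (rule ore_extension_relations[OF ore IH(1) nz])
    fix l assume l: "l \<in> {1..s}"
    show "\<sigma> (\<tau> l) = \<epsilon> (d (Suc s)) (d l) \<odot>\<^bsub>A\<^esub> \<tau> l"
      using off_diagonal(6)[of l] l s by simp
    have "\<tau> (color_k (Suc s) l) \<in> carrier A"
      using color_k_range[of l "Suc s"] l by (intro IH.T_closed) auto
    then show "\<zero>\<^bsub>A\<^esub> = color_c \<epsilon> d (Suc s) l \<odot>\<^bsub>A\<^esub> \<tau> (color_k (Suc s) l)"
      using color_c_off(1)[OF off_diagonal(1,2), of \<epsilon> d l] off_diagonal(3) s by simp
  qed
  then show ?case
    unfolding s using ore_extension_basis[OF ore IH.T_closed IH(2)] by blast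
next
  case (diagonal j r A \<sigma> \<delta> B)
  have "r \<noteq> 0"
    using diagonal(1,2) s_index_ge_1[of j j] by simp
  then obtain s where s: "r = Suc s"
    by (cases r) auto
  have ore: "ore_extension A (\<tau> (Suc s)) \<sigma> \<delta> B" using diagonal(4) s by simp
  have IH: "color_relations \<epsilon> d A s \<tau>" "basis_family A (exponents s) (std_monomial A s \<tau>)"
    using diagonal.IH s by auto
  interpret IH: ore_relations A s \<tau> "color_q \<epsilon> d" "color_c \<epsilon> d" color_k by (rule IH(1))
  have "color_relations \<epsilon> d B (Suc s) \<tau>"
  proof (rule ore_extension_relations[OF ore IH(1) nz])
    fix l assume l: "l \<in> {1..s}"
    show "\<sigma> (\<tau> l) = \<epsilon> (d (Suc s)) (d l) \<odot>\<^bsub>A\<^esub> \<tau> l"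
      using diagonal(5)[of l] l s by simp
    have k: "\<tau> (color_k (Suc s) l) \<in> carrier A"
      using color_k_range[of l "Suc s"] l by (intro IH.T_closed) auto
    obtain a b where ab: "1 \<le> a" "a \<le> b" "b \<le> j" "l = s_index a b"
      using s_index_surj[of l j] l s diagonal(2) by auto
    show "\<delta> (\<tau> l) = color_c \<epsilon> d (Suc s) l \<odot>\<^bsub>A\<^esub> \<tau> (color_k (Suc s) l)"
    proof (cases "a < b")
      case True
      then show ?thesis
        using diagonal(6)[of a b] ab k color_c_off(2)[of a b \<epsilon> d "Suc s"] by simp
    next
      case False
      \<comment> \<open>The variable with index \<open>l\<close> precedes the new one, which
        excludes \<open>a = j\<close>.\<close>
      then have "a < j"
        using ab l s diagonal(2) by (cases "a = j") auto
      then show ?thesis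
        using diagonal(7)[of a] False ab s diagonal(2) color_c_diag[of a j \<epsilon> d] color_k_diag[of a j] by simp
    qed
  qed
  then show ?case
    unfolding s using ore_extension_basis[OF ore IH.T_closed IH(2)] by blast
qed

section \<open>Existence of the tower\<close>

lemma subalgebra_assoc_alg:
  assumes A: "assoc_alg A" and S: "S \<subseteq> carrier A" "\<one>\<^bsub>A\<^esub> \<in> S"
    "\<And>x y. \<lbrakk>x \<in> S; y \<in> S\<rbrakk> \<Longrightarrow> x \<oplus>\<^bsub>A\<^esub> y \<in> S" "\<And>x y. \<lbrakk>x \<in> S; y \<in> S\<rbrakk> \<Longrightarrow> x \<otimes>\<^bsub>A\<^esub> y \<in> S"
    "\<And>a x. x \<in> S \<Longrightarrow> a \<odot>\<^bsub>A\<^esub> x \<in> S"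
  shows "assoc_alg (A\<lparr>carrier := S\<rparr>)"
proof -
  interpret assoc_alg A by (rule A)
  note c = subsetD[OF S(1)]
  show ?thesis
  proof (rule assoc_algI)
    show "abelian_group (A\<lparr>carrier := S\<rparr>)"
    proof (rule abelian_groupI)
      show "\<zero>\<^bsub>A\<lparr>carrier := S\<rparr>\<^esub> \<in> carrier (A\<lparr>carrier := S\<rparr>)"
        using S(5)[OF S(2), of 0] by simp
      show "\<exists>y\<in>carrier (A\<lparr>carrier := S\<rparr>). y \<oplus>\<^bsub>A\<lparr>carrier := S\<rparr>\<^esub> x = \<zero>\<^bsub>A\<lparr>carrier := S\<rparr>\<^esub>"
        if "x \<in> carrier (A\<lparr>carrier := S\<rparr>)" for x
        by (rule bexI[of _ "(- 1) \<odot>\<^bsub>A\<^esub> x"]) (use that S(5)[of x "- 1"] c in \<open>auto simp: smult_minus_left l_neg\<close>)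
    qed (use S c in \<open>auto simp: a_ac\<close>)
    show "Group.monoid (A\<lparr>carrier := S\<rparr>)"
      by (rule Group.monoidI) (use S c in \<open>auto simp: m_assoc\<close>)
  qed (use S c in \<open>auto simp: l_distr r_distr smult_add_left smult_add_right smult_smult
      smult_mult_left smult_mult_right\<close>)
qed

context ore_relations
begin

text \<open>Monomials are products of variables, so a property stable under the algebra operations
  has to be checked on the \<open>T l\<close> only. Membership in \<open>mon_span\<close> is passed
  along to provide the closure conditions.\<close>

lemma mon_span_induct:
  assumes u: "u \<in> mon_span" and D1: "\<one> \<in> D" and DT: "\<And>l. l \<in> {1..n} \<Longrightarrow> T l \<in> D"
    and Da: "\<And>x y. \<lbrakk>x \<in> D; y \<in> D; x \<in> mon_span; y \<in> mon_span\<rbrakk> \<Longrightarrow> x \<oplus> y \<in> D"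
    and Dm: "\<And>x y. \<lbrakk>x \<in> D; y \<in> D; x \<in> mon_span; y \<in> mon_span\<rbrakk> \<Longrightarrow> x \<otimes> y \<in> D"
    and Ds: "\<And>a x. \<lbrakk>x \<in> D; x \<in> mon_span\<rbrakk> \<Longrightarrow> a \<odot> x \<in> D"
  shows "u \<in> D"
proof -
  let ?E = "D \<inter> mon_span"
  have one: "\<one> \<in> ?E" using D1 mon_span_one by blast
  have TE: "T l \<in> ?E" if "l \<in> {1..n}" for l using DT mon_span_T that by blast
  have mult: "x \<otimes> y \<in> ?E" if "x \<in> ?E" "y \<in> ?E" for x y using that Dm mon_span_mult by blast
  have pow: "x [^] (k::nat) \<in> ?E" if "x \<in> ?E" for x k
    by (induction k) (use one mult that in auto)
  have "foldr (\<lambda>i u. (T i [^] (lookup \<alpha> i :: nat)) \<otimes> u) xs \<one> \<in> ?E" if "set xs \<subseteq> {1..n}" for xs \<alpha>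
    using that by (induction xs) (use one mult pow[OF TE] in auto)
  then have M: "M \<alpha> \<in> ?E" for \<alpha>
    unfolding std_monomial_def by (rule) auto
  obtain f where f: "u = lin_comb A M f" using u by (auto simp: mon_span_def)
  have "u \<in> ?E"
    unfolding f
  proof (rule lin_comb_mem)
    show "M \<in> keys f \<rightarrow> ?E" using M by blast
    show "?E \<subseteq> carrier A" using mon_span_closed by blast
    show "\<zero> \<in> ?E" using Ds[OF D1 mon_span_one, of 0] mon_span_smult[OF mon_span_one, of 0] by simp
  qed (use Da Ds mon_span_add mon_span_smult in auto)
  then show ?thesis by blast
qed

end

lemma std_monomial_mono:
  assumes A: "assoc_alg A" and T: "\<And>i. i \<in> {1..n} \<Longrightarrow> T i \<in> carrier A" and r: "r \<le> n" and \<alpha>: "\<alpha> \<in> exponents r"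
  shows "std_monomial A n T \<alpha> = std_monomial A r T \<alpha>"
proof -
  interpret assoc_alg A by (rule A)
  have "[1..<Suc n] = [1..<Suc r] @ [Suc r..<Suc n]"
    using r upt_add_eq_append[of 1 "Suc r" "n - r"] by simp
  then have "std_monomial A n T \<alpha> = foldr (\<lambda>i u. (T i [^]\<^bsub>A\<^esub> lookup \<alpha> i) \<otimes>\<^bsub>A\<^esub> u) [1..<Suc r]
      (foldr (\<lambda>i u. (T i [^]\<^bsub>A\<^esub> lookup \<alpha> i) \<otimes>\<^bsub>A\<^esub> u) [Suc r..<Suc n] \<one>\<^bsub>A\<^esub>)"
    by (simp only: std_monomial_def foldr_append comp_apply)
  also have "foldr (\<lambda>i u. (T i [^]\<^bsub>A\<^esub> lookup \<alpha> i) \<otimes>\<^bsub>A\<^esub> u) [Suc r..<Suc n] \<one>\<^bsub>A\<^esub> = \<one>\<^bsub>A\<^esub>"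
    by (rule monomial_tail_zero) (use exponents_lookup[OF \<alpha>] in auto)
  finally show ?thesis by (simp add: std_monomial_def)
qed

text \<open>The grading of \<open>A\<close> is encoded through its characters: for each degree
  \<open>g\<close> an endomorphism multiplies every variable by \<epsilon>(g, its degree). The map
  \<sigma> of step r is the one for \<open>d r\<close>.\<close>

locale tower_setup = color_gens \<epsilon> m d A T
  for \<epsilon> :: "'g::ab_group_add \<Rightarrow> 'g \<Rightarrow> 'k::field" and m d and A :: "('k, 'a) module" (structure) and T +
  assumes basis: "basis_family A (exponents (s_index m m)) (std_monomial A (s_index m m) T)"
    and grading: "\<exists>h\<in>algebra_hom A A. \<forall>l\<in>{1..s_index m m}. h (T l) = \<epsilon> g (d l) \<odot> T l"
begin

definition S :: "nat \<Rightarrow> 'a set" where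
  "S r = {lin_comb A (std_monomial A r T) f | f. keys f \<subseteq> exponents r}"

definition P :: "nat \<Rightarrow> ('k, 'a) module" where "P r = A\<lparr>carrier := S r\<rparr>"

definition \<sigma> :: "'g \<Rightarrow> 'a \<Rightarrow> 'a" where
  "\<sigma> g = (SOME h. h \<in> algebra_hom A A \<and> (\<forall>l\<in>{1..n}. h (T l) = \<epsilon> g (d l) \<odot> T l))"

lemma \<sigma>: "\<sigma> g \<in> algebra_hom A A" "l \<in> {1..n} \<Longrightarrow> \<sigma> g (T l) = \<epsilon> g (d l) \<odot> T l"
proof -
  have "\<exists>h. h \<in> algebra_hom A A \<and> (\<forall>l\<in>{1..n}. h (T l) = \<epsilon> g (d l) \<odot> T l)"
    using grading by blast
  from someI_ex[OF this] show "\<sigma> g \<in> algebra_hom A A" "l \<in> {1..n} \<Longrightarrow> \<sigma> g (T l) = \<epsilon> g (d l) \<odot> T l"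
    unfolding \<sigma>_def by blast+
qed

lemma relations_r: "r \<le> n \<Longrightarrow> color_relations \<epsilon> d A r T"
  by (rule color_relations_subset[OF ore_relations_axioms])

lemma S_eq: "r \<le> n \<Longrightarrow> S r = ore_relations.mon_span A r T"
  unfolding S_def using ore_relations.mon_span_def[OF relations_r] by simp

lemma assoc_P: assumes "r \<le> n" shows "assoc_alg (P r)"
proof -
  interpret R: ore_relations A r T "color_q \<epsilon> d" "color_c \<epsilon> d" color_k by (rule relations_r[OF assms])
  show ?thesis
    unfolding P_def S_eq[OF assms]
    by (rule subalgebra_assoc_alg[OF assoc_alg_axioms])
      (use R.mon_span_closed R.mon_span_one R.mon_span_add R.mon_span_mult R.mon_span_smult in auto)
qed

lemma P_simps [simp]: "carrier (P r) = S r" "x \<otimes>\<^bsub>P r\<^esub> y = x \<otimes> y" "x \<oplus>\<^bsub>P r\<^esub> y = x \<oplus> y" "\<one>\<^bsub>P r\<^esub> = \<one>"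
  "\<zero>\<^bsub>P r\<^esub> = \<zero>" "c \<odot>\<^bsub>P r\<^esub> x = c \<odot> x"
  by (simp_all add: P_def)

lemma S_carrier: "r \<le> n \<Longrightarrow> S r \<subseteq> carrier A"
  using ore_relations.mon_span_closed[OF relations_r] by (simp add: S_eq)

lemma S_T: assumes "l \<in> {1..r}" "r \<le> n" shows "T l \<in> S r"
  using ore_relations.mon_span_T[OF relations_r[OF assms(2)] assms(1)] assms by (simp add: S_eq)

lemma S_mono: assumes "r \<le> k" "k \<le> n" shows "S r \<subseteq> S k"
proof
  fix u assume "u \<in> S r"
  then obtain f where f: "u = lin_comb A (std_monomial A r T) f" "keys f \<subseteq> exponents r"
    by (auto simp: S_def)
  have "u = lin_comb A (std_monomial A k T) f"
    unfolding f(1)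
  proof (rule lin_comb_cong)
    show "std_monomial A r T \<alpha> = std_monomial A k T \<alpha>" if "\<alpha> \<in> keys f" for \<alpha>
      by (rule std_monomial_mono[OF assoc_alg_axioms _ assms(1), symmetric])
        (use that f assms T_closed in auto)
    show "std_monomial A k T \<in> keys f \<rightarrow> carrier A"
      by (rule std_monomial_fun) (use assms T_closed in auto)
  qed
  then show "u \<in> S k"
    using f(2) exponents_mono[OF assms(1)] by (auto simp: S_def)
qed

lemma subalgebra_P: assumes "r \<le> k" "k \<le> n" shows "subalgebra_of (P r) (P k)"
  using S_mono[OF assms] by (simp add: subalgebra_of_def)

lemma hom_P: assumes "r \<le> n" shows "alg_hom (P r) A (\<lambda>x. x)"
  by (rule subalgebra_hom[OF assoc_P[OF assms] assoc_alg_axioms])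
    (use S_carrier[OF assms] in \<open>simp add: subalgebra_of_def\<close>)

lemma \<sigma>_S: assumes r: "r \<le> n" and u: "u \<in> S r" shows "\<sigma> g u \<in> S r"
proof -
  interpret R: ore_relations A r T "color_q \<epsilon> d" "color_c \<epsilon> d" color_k by (rule relations_r[OF r])
  note h = algebra_homD[OF \<sigma>(1)[of g]]
  have c: "x \<in> carrier A" if "x \<in> R.mon_span" for x using that R.mon_span_closed by blast
  have "u \<in> {x. \<sigma> g x \<in> R.mon_span}"
  proof (rule R.mon_span_induct)
    show "u \<in> R.mon_span" using u by (simp add: S_eq[OF r])
    show "T l \<in> {x. \<sigma> g x \<in> R.mon_span}" if "l \<in> {1..r}" for l
      using that r by (simp add: \<sigma>(2) R.mon_span_smult R.mon_span_T)
  qed (simp_all add: h c R.mon_span_one R.mon_span_add R.mon_span_mult R.mon_span_smult)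
  then show ?thesis by (simp add: S_eq[OF r])
qed

text \<open>Because \<open>\<epsilon> g a * \<epsilon> (- g) a = 1\<close>, opposite degrees give
  mutually inverse maps on the variables; this makes \<sigma> an automorphism of each stage.\<close>

lemma \<sigma>_inverse: assumes r: "r \<le> n" and u: "u \<in> S r" shows "\<sigma> (- g) (\<sigma> g u) = u"
proof -
  interpret R: ore_relations A r T "color_q \<epsilon> d" "color_c \<epsilon> d" color_k by (rule relations_r[OF r])
  note h = algebra_homD[OF \<sigma>(1)[of g]] and h' = algebra_homD[OF \<sigma>(1)[of "- g"]]
  have c: "x \<in> carrier A" if "x \<in> R.mon_span" for x using that R.mon_span_closed by blast
  have e: "\<epsilon> g a * \<epsilon> (- g) a = 1" for a
    using \<epsilon>_add_left[of g "- g" a] \<epsilon>_add_left[of 0 0 a] by simp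
  have "u \<in> {x. \<sigma> (- g) (\<sigma> g x) = x}"
  proof (rule R.mon_span_induct)
    show "u \<in> R.mon_span" using u by (simp add: S_eq[OF r])
    show "T l \<in> {x. \<sigma> (- g) (\<sigma> g x) = x}" if "l \<in> {1..r}" for l
      using that r T_closed[of l] by (simp add: \<sigma>(2) h'(5) smult_smult e)
  qed (simp_all add: h h' c)
  then show ?thesis by simp
qed

lemma \<sigma>_iso: assumes r: "r \<le> n" shows "\<sigma> g \<in> algebra_iso (P r) (P r)"
proof -
  have c: "x \<in> carrier A" if "x \<in> S r" for x using that S_carrier[OF r] by blast
  note h = algebra_homD[OF \<sigma>(1)[of g]]
  have "bij_betw (\<sigma> g) (S r) (S r)"
    by (rule bij_betw_byWitness[where f' = "\<sigma> (- g)"])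
      (use \<sigma>_inverse[OF r] \<sigma>_inverse[OF r, of _ "- g"] \<sigma>_S[OF r] in auto)
  moreover have "\<sigma> g \<in> ring_hom (P r) (P r)"
    by (rule ring_hom_memI) (simp_all add: h c \<sigma>_S[OF r])
  ultimately show ?thesis
    by (simp add: algebra_iso_def ring_iso_def h(5) c)
qed

definition \<delta> :: "nat \<Rightarrow> 'a \<Rightarrow> 'a" where
  "\<delta> r u = T r \<otimes> u \<ominus> \<sigma> (d r) u \<otimes> T r"

text \<open>A skew commutator obeys the twisted product rule whatever the relations are; only
  multiplicativity of \<sigma> enters.\<close>

lemma \<delta>_prod:
  assumes "T r \<in> carrier A" "a \<in> carrier A" "b \<in> carrier A"
  shows "\<delta> r (a \<otimes> b) = \<sigma> (d r) a \<otimes> \<delta> r b \<oplus> \<delta> r a \<otimes> b"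
proof -
  note h = algebra_homD[OF \<sigma>(1)[of "d r"]]
  have [simp]: "\<sigma> (d r) a \<in> carrier A" "\<sigma> (d r) b \<in> carrier A" using assms h by auto
  \<comment> \<open>The mixed term, inserted with both signs.\<close>
  define p where "p = \<sigma> (d r) a \<otimes> (T r \<otimes> b)"
  have p: "p \<in> carrier A" using assms by (simp add: p_def)
  have "\<sigma> (d r) a \<otimes> \<delta> r b \<oplus> \<delta> r a \<otimes> b =
      (p \<ominus> \<sigma> (d r) a \<otimes> (\<sigma> (d r) b \<otimes> T r)) \<oplus> (T r \<otimes> (a \<otimes> b) \<ominus> p)"
    using assms by (simp add: \<delta>_def p_def r_distr l_distr minus_eq r_minus l_minus m_assoc)
  also have "\<dots> = T r \<otimes> (a \<otimes> b) \<ominus> \<sigma> (d r) a \<otimes> (\<sigma> (d r) b \<otimes> T r)"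
    using assms p by (simp add: minus_eq a_ac r_neg2)
  also have "\<dots> = \<delta> r (a \<otimes> b)"
    using assms by (simp add: \<delta>_def h m_assoc)
  finally show ?thesis by (rule sym)
qed

lemma \<delta>_add:
  assumes "T r \<in> carrier A" "a \<in> carrier A" "b \<in> carrier A"
  shows "\<delta> r (a \<oplus> b) = \<delta> r a \<oplus> \<delta> r b"
proof -
  note h = algebra_homD[OF \<sigma>(1)[of "d r"]]
  show ?thesis
    using assms by (simp add: \<delta>_def h l_distr r_distr minus_eq minus_add a_ac)
qed

lemma \<delta>_smult:
  assumes "T r \<in> carrier A" "a \<in> carrier A" shows "\<delta> r (c \<odot> a) = c \<odot> \<delta> r a"
proof -
  note h = algebra_homD[OF \<sigma>(1)[of "d r"]]
  show ?thesis
    using assms by (simp add: \<delta>_def h smult_mult_left smult_mult_right minus_eq smult_add_right smult_minus_right)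
qed

lemma \<delta>_T:
  assumes l: "1 \<le> l" "l < r" "r \<le> n" shows "\<delta> r (T l) = color_c \<epsilon> d r l \<odot> T (color_k r l)"
proof -
  have c: "T r \<in> carrier A" "T l \<in> carrier A" "T (color_k r l) \<in> carrier A"
    using l \<kappa>[OF l] by (auto intro!: T_closed)
  have "\<delta> r (T l) = (\<epsilon> (d r) (d l) \<odot> (T l \<otimes> T r) \<oplus> color_c \<epsilon> d r l \<odot> T (color_k r l)) \<ominus> \<epsilon> (d r) (d l) \<odot> (T l \<otimes> T r)"
    using l c by (simp add: \<delta>_def \<sigma>(2) rel[OF l] smult_mult_left)
  also have "\<dots> = color_c \<epsilon> d r l \<odot> T (color_k r l)"
    using c by (simp add: minus_eq a_ac r_neg r_neg2 r_neg1)
  finally show ?thesis .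
qed

text \<open>By the product rule it suffices to know \<delta> on the variables. With
  \<open>V = S s\<close> this shows that \<delta> preserves the stage; with
  \<open>V = {\<zero>}\<close> it shows that \<delta> vanishes at the off-diagonal steps.\<close>

lemma \<delta>_mem:
  assumes r: "Suc s \<le> n" and u: "u \<in> S s" and V: "V \<subseteq> carrier A" "\<zero> \<in> V"
    and VT: "\<And>l. l \<in> {1..s} \<Longrightarrow> \<delta> (Suc s) (T l) \<in> V"
    and Va: "\<And>x y. \<lbrakk>x \<in> V; y \<in> V\<rbrakk> \<Longrightarrow> x \<oplus> y \<in> V" and Vs: "\<And>a x. x \<in> V \<Longrightarrow> a \<odot> x \<in> V"
    and Vl: "\<And>a x. \<lbrakk>a \<in> S s; x \<in> V\<rbrakk> \<Longrightarrow> a \<otimes> x \<in> V" and Vr: "\<And>a x. \<lbrakk>a \<in> S s; x \<in> V\<rbrakk> \<Longrightarrow> x \<otimes> a \<in> V"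
  shows "\<delta> (Suc s) u \<in> V"
proof -
  have s: "s \<le> n" using r by simp
  interpret R: ore_relations A s T "color_q \<epsilon> d" "color_c \<epsilon> d" color_k by (rule relations_r[OF s])
  have T: "T (Suc s) \<in> carrier A" using r by (intro T_closed) simp
  have c: "x \<in> carrier A" if "x \<in> R.mon_span" for x using that R.mon_span_closed by blast
  have "u \<in> {x. \<delta> (Suc s) x \<in> V}"
  proof (rule R.mon_span_induct)
    show "u \<in> R.mon_span" using u by (simp add: S_eq[OF s])
    show "\<one> \<in> {x. \<delta> (Suc s) x \<in> V}"
      using T V algebra_homD(4)[OF \<sigma>(1)[of "d (Suc s)"]] by (simp add: \<delta>_def minus_eq r_neg)
    fix x y assume xy: "x \<in> {x. \<delta> (Suc s) x \<in> V}" "y \<in> {x. \<delta> (Suc s) x \<in> V}" "x \<in> R.mon_span" "y \<in> R.mon_span"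
    have "\<sigma> (d (Suc s)) x \<in> S s" using \<sigma>_S[OF s] xy by (simp add: S_eq[OF s])
    then show "x \<otimes> y \<in> {x. \<delta> (Suc s) x \<in> V}"
      using xy T c Va Vl Vr by (simp add: \<delta>_prod S_eq[OF s])
  qed (use T c Va Vs VT in \<open>auto simp: \<delta>_add \<delta>_smult\<close>)
  then show ?thesis by simp
qed

lemma \<delta>_S: assumes r: "Suc s \<le> n" and u: "u \<in> S s" shows "\<delta> (Suc s) u \<in> S s"
proof -
  have s: "s \<le> n" using r by simp
  interpret R: ore_relations A s T "color_q \<epsilon> d" "color_c \<epsilon> d" color_k by (rule relations_r[OF s])
  have "\<delta> (Suc s) (T l) \<in> S s" if l: "l \<in> {1..s}" for l
  proof -
    have "color_k (Suc s) l \<in> {1..s}" using \<kappa>[of l "Suc s"] l r by auto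
    then show ?thesis
      using \<delta>_T[of l "Suc s"] l r by (simp add: S_eq[OF s] R.mon_span_smult R.mon_span_T)
  qed
  then show ?thesis
    using R.mon_span_closed R.mon_span_smult[OF R.mon_span_one, of 0] R.mon_span_add R.mon_span_smult R.mon_span_mult
    by (intro \<delta>_mem[OF r u]) (simp_all add: S_eq[OF s])
qed

lemma \<delta>_zero:
  assumes r: "Suc s \<le> n" and u: "u \<in> S s" and z: "\<And>l. l \<in> {1..s} \<Longrightarrow> color_c \<epsilon> d (Suc s) l = 0"
  shows "\<delta> (Suc s) u = \<zero>"
proof -
  have s: "s \<le> n" using r by simp
  have "\<delta> (Suc s) u \<in> {\<zero>}"
  proof (rule \<delta>_mem[OF r u])
    fix l assume l: "l \<in> {1..s}"
    have "T (color_k (Suc s) l) \<in> carrier A"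
      using \<kappa>[of l "Suc s"] l r by (intro T_closed) auto
    then show "\<delta> (Suc s) (T l) \<in> {\<zero>}"
      using \<delta>_T[of l "Suc s"] l r z[OF l] by simp
  qed (use S_carrier[OF s] in auto)
  then show ?thesis by simp
qed

lemma basis_r: assumes r: "r \<le> n" and f: "keys f \<subseteq> exponents r" "keys g \<subseteq> exponents r"
  and eq: "lin_comb A (std_monomial A r T) f = lin_comb A (std_monomial A r T) g"
  shows "f = g"
proof -
  have e: "lin_comb A (std_monomial A r T) h = lin_comb A (std_monomial A n T) h" if "keys h \<subseteq> exponents r" for h
  proof (rule lin_comb_cong)
    show "std_monomial A r T \<alpha> = std_monomial A n T \<alpha>" if "\<alpha> \<in> keys h" for \<alpha>
      by (rule std_monomial_mono[OF assoc_alg_axioms T_closed r, symmetric]) (use that \<open>keys h \<subseteq> _\<close> in auto)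
    show "std_monomial A n T \<in> keys h \<rightarrow> carrier A" by (rule std_monomial_fun) (rule T_closed)
  qed
  show ?thesis
    by (rule basis_family_eqD[OF basis]) (use f eq e exponents_mono[OF r] in auto)
qed

text \<open>Slicing a combination by the exponent of the last variable gives the expansion; two
  expansions have equal slices, because the monomials of \<open>A\<close> are independent.\<close>

lemma unique_expansion:
  assumes r: "Suc s \<le> n" and u: "u \<in> S (Suc s)"
  defines "Q \<equiv> \<lambda>f. range f \<subseteq> S s \<and> finite {k. f k \<noteq> \<zero>} \<and> u = (\<Oplus>k\<in>{k. f k \<noteq> \<zero>}. f k \<otimes> (T (Suc s) [^] (k::nat)))"
  shows "\<exists>!f. Q f"
proof -
  have s: "s \<le> n" using r by simp
  let ?l = "lin_comb A (std_monomial A s T)" and ?L = "lin_comb A (std_monomial A (Suc s) T)"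
  have T: "T i \<in> carrier A" if "i \<in> {1..Suc s}" for i using that r by (intro T_closed) auto
  have lc: "?l f \<in> carrier A" for f
    by (rule lin_comb_closed, rule std_monomial_fun) (use T in auto)
  have sum: "(\<Oplus>k\<in>{k. f k \<noteq> \<zero>}. f k \<otimes> (T (Suc s) [^] k)) = ?L (\<Sum>k\<in>N. g k * xpow (Suc s) k)"
    if N: "finite N" "{k. f k \<noteq> \<zero>} \<subseteq> N" and g: "\<And>k. keys (g k) \<subseteq> exponents s" "\<And>k. f k = ?l (g k)" for f g N
  proof -
    have fc: "f k \<in> carrier A" for k unfolding g(2) by (rule lc)
    have "(\<Oplus>k\<in>{k. f k \<noteq> \<zero>}. f k \<otimes> (T (Suc s) [^] k)) = (\<Oplus>k\<in>N. f k \<otimes> (T (Suc s) [^] k))"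
      by (rule add.finprod_mono_neutral_cong_left[OF N]) (use fc T in auto)
    also have "\<dots> = (\<Oplus>k\<in>N. ?l (g k) \<otimes> (T (Suc s) [^] k))"
      by (simp only: g(2))
    also have "\<dots> = ?L (\<Sum>k\<in>N. g k * xpow (Suc s) k)"
      by (rule lin_comb_slices[OF T N(1) g(1), symmetric])
    finally show ?thesis .
  qed
  have coeffs: "\<exists>g. \<forall>k. keys (g k) \<subseteq> exponents s \<and> f k = ?l (g k)" if "range f \<subseteq> S s" for f :: "nat \<Rightarrow> 'a"
  proof (intro choice allI)
    fix k
    have "f k \<in> S s" using that by blast
    then show "\<exists>g. keys g \<subseteq> exponents s \<and> f k = ?l g" unfolding S_def by blast
  qed
  obtain c where c: "u = ?L c" "keys c \<subseteq> exponents (Suc s)"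
    using u unfolding S_def by blast
  obtain N g where N: "finite N" "\<And>k. keys (g k) \<subseteq> exponents s" "\<And>k. k \<notin> N \<Longrightarrow> g k = 0"
      "c = (\<Sum>k\<in>N. g k * xpow (Suc s) k)"
    using slices[OF c(2)] by (elim exE conjE) (rule that, simp_all)
  have sN: "{k. ?l (g k) \<noteq> \<zero>} \<subseteq> N"
  proof
    fix k assume "k \<in> {k. ?l (g k) \<noteq> \<zero>}"
    then show "k \<in> N" using N(3)[of k] lin_comb_0 by (cases "k \<in> N") auto
  qed
  have "Q (\<lambda>k. ?l (g k))"
    unfolding Q_def
  proof (intro conjI)
    show "range (\<lambda>k. ?l (g k)) \<subseteq> S s" unfolding S_def using N(2) by blast
    show "finite {k. ?l (g k) \<noteq> \<zero>}" by (rule finite_subset[OF sN N(1)])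
    show "u = (\<Oplus>k\<in>{k. ?l (g k) \<noteq> \<zero>}. ?l (g k) \<otimes> (T (Suc s) [^] k))"
      unfolding c(1) N(4) by (rule sum[OF N(1) sN N(2) refl, symmetric])
  qed
  moreover have "f = f'" if "Q f" "Q f'" for f f'
  proof -
    obtain a where a: "\<And>k. keys (a k) \<subseteq> exponents s" "\<And>k. f k = ?l (a k)"
      using coeffs[of f] \<open>Q f\<close> unfolding Q_def by (elim conjE) (erule (1) meta_impE, elim exE, rule that, simp_all)
    obtain b where b: "\<And>k. keys (b k) \<subseteq> exponents s" "\<And>k. f' k = ?l (b k)"
      using coeffs[of f'] \<open>Q f'\<close> unfolding Q_def by (elim conjE) (erule (1) meta_impE, elim exE, rule that, simp_all)
    \<comment> \<open>A common finite support, over which both expansions are compared slice by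
      slice.\<close>
    let ?N = "{k. f k \<noteq> \<zero>} \<union> {k. f' k \<noteq> \<zero>}"
    have fin: "finite ?N" using \<open>Q f\<close> \<open>Q f'\<close> unfolding Q_def by blast
    have "?L (\<Sum>k\<in>?N. a k * xpow (Suc s) k) = u"
      using \<open>Q f\<close> sum[OF fin _ a] unfolding Q_def by (elim conjE) simp
    moreover have "?L (\<Sum>k\<in>?N. b k * xpow (Suc s) k) = u"
      using \<open>Q f'\<close> sum[OF fin _ b] unfolding Q_def by (elim conjE) simp
    ultimately have "(\<Sum>k\<in>?N. a k * xpow (Suc s) k) = (\<Sum>k\<in>?N. b k * xpow (Suc s) k)"
      by (intro basis_r[OF r] keys_slices_sum a b) simp
    then have z: "(\<Sum>k\<in>?N. (a k - b k) * xpow (Suc s) k) = 0"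
      by (simp add: left_diff_distrib sum_subtractf)
    have k: "keys (a k - b k) \<subseteq> exponents s" for k
      using keys_diff[of "a k" "b k"] a(1)[of k] b(1)[of k] by blast
    show "f = f'"
    proof
      fix k
      show "f k = f' k"
      proof (cases "k \<in> ?N")
        case True
        then have "a k - b k = 0" by (rule slices_unique[OF fin k z])
        then show ?thesis using a(2)[of k] b(2)[of k] by simp
      next
        case False
        then show ?thesis by auto
      qed
    qed
  qed
  ultimately show ?thesis by (intro ex1I) blast+
qed

text \<open>\<open>\<Delta>\<close> is kept separate from \<open>\<delta> (Suc s)\<close>, because
  an off-diagonal step asks for the constant zero function, with which \<delta> is known to agree
  only on \<open>S s\<close>.\<close>

lemma ore_P:
  assumes r: "Suc s \<le> n" and \<Delta>: "\<And>u. u \<in> S s \<Longrightarrow> \<Delta> u = \<delta> (Suc s) u"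
  shows "ore_extension (P s) (T (Suc s)) (\<sigma> (d (Suc s))) \<Delta> (P (Suc s))"
  unfolding ore_extension_def assoc_algebra_iff
proof (intro conjI ballI)
  have s: "s \<le> n" using r by simp
  have T: "T (Suc s) \<in> carrier A" using r by (intro T_closed) simp
  have c: "x \<in> carrier A" if "x \<in> S s" for x using S_carrier[OF s] that by blast
  interpret Ps: assoc_alg "P s" by (rule assoc_P[OF s])
  interpret hP: alg_hom "P (Suc s)" A "\<lambda>x. x" by (rule hom_P[OF r])
  note cl = Ps.add.m_closed[simplified] Ps.m_closed[simplified] Ps.smult_cl[simplified]
  show "assoc_alg (P s)" "assoc_alg (P (Suc s))" using assoc_P s r by blast+
  show "\<sigma> (d (Suc s)) \<in> algebra_iso (P s) (P s)" by (rule \<sigma>_iso[OF s])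
  show "subalgebra_of (P s) (P (Suc s))" by (rule subalgebra_P) (use r in auto)
  show TS: "T (Suc s) \<in> carrier (P (Suc s))" using S_T[of "Suc s" "Suc s"] r by simp
  show "algebra_derivation (P s) (\<sigma> (d (Suc s))) \<Delta>"
    unfolding algebra_derivation_def
    using T c cl \<delta>_S[OF r] by (simp add: \<Delta> \<delta>_smult \<delta>_add \<delta>_prod Pi_iff)
  show "T (Suc s) \<otimes>\<^bsub>P (Suc s)\<^esub> a = (\<sigma> (d (Suc s)) a \<otimes>\<^bsub>P (Suc s)\<^esub> T (Suc s)) \<oplus>\<^bsub>P (Suc s)\<^esub> \<Delta> a"
    if "a \<in> carrier (P s)" for a
  proof -
    have a: "a \<in> S s" using that by simp
    have "\<sigma> (d (Suc s)) a \<in> carrier A" using \<sigma>_S[OF s a] c by blast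
    then show ?thesis
      using T c[OF a] by (simp add: \<Delta>[OF a] \<delta>_def minus_eq a_ac r_neg r_neg2 r_neg1)
  qed
  fix u assume u: "u \<in> carrier (P (Suc s))"
  \<comment> \<open>Finite sums and powers formed in the subalgebra are those of \<open>A\<close>;
    with this the claim becomes \<open>unique_expansion\<close>.\<close>
  have sums: "(\<Oplus>\<^bsub>P (Suc s)\<^esub>k\<in>{k. f k \<noteq> \<zero>}. f k \<otimes>\<^bsub>P (Suc s)\<^esub> (T (Suc s) [^]\<^bsub>P (Suc s)\<^esub> k)) =
      (\<Oplus>k\<in>{k. f k \<noteq> \<zero>}. f k \<otimes> (T (Suc s) [^] k))"
    if "range f \<subseteq> S s" "finite {k. f k \<noteq> \<zero>}" for f :: "nat \<Rightarrow> 'a"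
  proof -
    have "f k \<in> carrier (P (Suc s))" for k
      using that(1) S_mono[of s "Suc s"] r by auto
    then have "f k \<otimes>\<^bsub>P (Suc s)\<^esub> (T (Suc s) [^]\<^bsub>P (Suc s)\<^esub> k) \<in> carrier (P (Suc s))" for k
      using TS by (intro hP.A.m_closed hP.A.nat_pow_closed)
    then have "(\<Oplus>\<^bsub>P (Suc s)\<^esub>k\<in>{k. f k \<noteq> \<zero>}. f k \<otimes>\<^bsub>P (Suc s)\<^esub> (T (Suc s) [^]\<^bsub>P (Suc s)\<^esub> k)) =
       (\<Oplus>k\<in>{k. f k \<noteq> \<zero>}. f k \<otimes>\<^bsub>P (Suc s)\<^esub> (T (Suc s) [^]\<^bsub>P (Suc s)\<^esub> k))"
      by (intro hP.finsum that) blast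
    then show ?thesis
      using hP.pow[OF TS] by simp
  qed
  define Q where "Q f \<longleftrightarrow> range f \<subseteq> S s \<and> finite {k. f k \<noteq> \<zero>} \<and> u = (\<Oplus>k\<in>{k. f k \<noteq> \<zero>}. f k \<otimes> (T (Suc s) [^] (k::nat)))" for f
  have "\<exists>!f. Q f"
    unfolding Q_def by (rule unique_expansion[OF r]) (use u in simp)
  moreover have "(range f \<subseteq> carrier (P s) \<and> finite {k. f k \<noteq> \<zero>\<^bsub>P s\<^esub>} \<and>
      u = (\<Oplus>\<^bsub>P (Suc s)\<^esub>k\<in>{k. f k \<noteq> \<zero>\<^bsub>P s\<^esub>}. f k \<otimes>\<^bsub>P (Suc s)\<^esub> (T (Suc s) [^]\<^bsub>P (Suc s)\<^esub> k))) = Q f" for f :: "nat \<Rightarrow> 'a"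
    unfolding Q_def P_simps(1,5) using sums[of f] by (intro conj_cong refl) simp
  ultimately show "\<exists>!f::nat \<Rightarrow> 'a. range f \<subseteq> carrier (P s) \<and> finite {k. f k \<noteq> \<zero>\<^bsub>P s\<^esub>} \<and>
      u = (\<Oplus>\<^bsub>P (Suc s)\<^esub>k\<in>{k. f k \<noteq> \<zero>\<^bsub>P s\<^esub>}. f k \<otimes>\<^bsub>P (Suc s)\<^esub> (T (Suc s) [^]\<^bsub>P (Suc s)\<^esub> k))"
    by (simp only:)
qed

theorem tower: "r \<le> n \<Longrightarrow> ore_tower \<epsilon> d T r (P r)"
proof (induction r)
  case 0
  have e: "exponents 0 = {0}" by (auto simp: exponents_def)
  have m: "std_monomial A 0 T = (\<lambda>_. \<one>)" by (auto simp: std_monomial_def)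
  \<comment> \<open>The empty monomial belongs to a basis.\<close>
  have "\<one> \<noteq> \<zero>"
  proof
    assume one: "\<one> = \<zero>"
    let ?f = "Poly_Mapping.single 0 1 :: (nat \<Rightarrow>\<^sub>0 nat) \<Rightarrow>\<^sub>0 'k"
    have "lin_comb A (\<lambda>_. \<one>) ?f = \<zero>"
      by (subst lin_comb_single) (simp_all add: one)
    then have "?f = 0"
      by (intro basis_r[of 0]) (simp_all add: e m del: single_one)
    then show False by simp
  qed
  moreover have "S 0 = range (\<lambda>c. c \<odot> \<one>)"
  proof
    show "S 0 \<subseteq> range (\<lambda>c. c \<odot> \<one>)"
    proof
      fix u assume "u \<in> S 0"
      then obtain f :: "(nat \<Rightarrow>\<^sub>0 nat) \<Rightarrow>\<^sub>0 'k" where f: "u = lin_comb A (\<lambda>_. \<one>) f" "keys f \<subseteq> {0}"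
        unfolding S_def e m by blast
      have "f = Poly_Mapping.single 0 (lookup f 0)"
        using f(2) by (intro poly_mapping_eqI) (auto simp: lookup_single when_def in_keys_iff)
      then have "u = lookup f 0 \<odot> \<one>"
        unfolding f(1) by (metis lin_comb_single one_closed)
      then show "u \<in> range (\<lambda>c. c \<odot> \<one>)" by blast
    qed
    show "range (\<lambda>c. c \<odot> \<one>) \<subseteq> S 0"
    proof clarify
      fix c
      have "c \<odot> \<one> = lin_comb A (\<lambda>_. \<one>) (Poly_Mapping.single (0 :: nat \<Rightarrow>\<^sub>0 nat) c)" by simp
      then show "c \<odot> \<one> \<in> S 0"
        unfolding S_def e m by (intro CollectI exI[of _ "Poly_Mapping.single 0 c"]) simp
    qed
  qed
  ultimately show ?case
    by (intro ore_tower.base) (simp_all add: assoc_algebra_iff assoc_P)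
next
  case (Suc s)
  then have IH: "ore_tower \<epsilon> d T (Suc s - 1) (P s)" and r: "Suc s \<le> n" and s: "s \<le> n" by auto
  obtain i j where ij: "1 \<le> i" "i \<le> j" "j \<le> m" "Suc s = s_index i j"
    using s_index_surj[of "Suc s" m] r by auto
  have \<sigma>T: "\<sigma> (d (Suc s)) (T l) = \<epsilon> (d (Suc s)) (d l) \<odot>\<^bsub>P s\<^esub> T l" if "1 \<le> l" "l < Suc s" for l
    using \<sigma>(2)[of l] that r by simp
  show ?case
  proof (cases "i < j")
    case True
    have z: "color_c \<epsilon> d (Suc s) l = 0" for l
      using color_c_off(1)[OF ij(1) True] ij(4) by simp
    have "ore_extension (P s) (T (Suc s)) (\<sigma> (d (Suc s))) (\<lambda>_. \<zero>\<^bsub>P s\<^esub>) (P (Suc s))"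
      by (rule ore_P[OF r]) (simp add: \<delta>_zero[OF r _ z])
    then show ?thesis
      by (rule ore_tower.off_diagonal[OF ij(1) True ij(4) IH _ \<sigma>T])
  next
    case False
    then have j: "1 \<le> j" "Suc s = s_index j j" using ij by auto
    have lt: "1 \<le> s_index a b" "s_index a b < Suc s" if "1 \<le> a" "a \<le> b" "b \<le> j" "b = j \<longrightarrow> a < j" for a b
      using that j s_index_less_iff[of a b j j] s_index_ge_1[of a b] by auto
    have ore: "ore_extension (P s) (T (Suc s)) (\<sigma> (d (Suc s))) (\<delta> (Suc s)) (P (Suc s))"
      by (rule ore_P[OF r]) simp
    show ?thesis
    proof (rule ore_tower.diagonal[OF j IH ore \<sigma>T])
      fix a b assume ab: "1 \<le> a" "a < b" "b \<le> j"
      have z: "color_c \<epsilon> d (Suc s) (s_index a b) = 0"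
        using color_c_off(2)[OF ab(1,2)] .
      have "T (color_k (Suc s) (s_index a b)) \<in> carrier A"
        using \<kappa>[of "s_index a b" "Suc s"] lt[of a b] ab r by (intro T_closed) auto
      then show "\<delta> (Suc s) (T (s_index a b)) = \<zero>\<^bsub>P s\<^esub>"
        using \<delta>_T[of "s_index a b" "Suc s"] lt[of a b] ab r z by simp
    next
      fix b assume b: "1 \<le> b" "b < j"
      have "\<delta> (Suc s) (T (s_index b b)) = color_c \<epsilon> d (Suc s) (s_index b b) \<odot> T (color_k (Suc s) (s_index b b))"
        using lt[of b b] b r by (intro \<delta>_T) auto
      then show "\<delta> (Suc s) (T (s_index b b)) = (- \<epsilon> (d (Suc s)) (d (s_index b b))) \<odot>\<^bsub>P s\<^esub> T (s_index b j)"
        using color_c_diag[OF b, of \<epsilon> d] color_k_diag[OF b] j(2) by simp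
    qed
  qed
qed

end

section \<open>Transport to coordinates and existence of the tower\<close>

lemma color_relations_hom:
  assumes h: "alg_hom A B h" and R: "color_relations \<epsilon> d A n T" and nz: "\<And>a b. \<epsilon> a b \<noteq> 0"
  shows "color_relations \<epsilon> d B n (\<lambda>r. h (T r))"
proof -
  interpret h: alg_hom A B h by (rule h)
  interpret R: ore_relations A n T "color_q \<epsilon> d" "color_c \<epsilon> d" color_k by (rule R)
  show ?thesis
  proof (intro ore_relations.intro h.B.assoc_alg_axioms ore_relations_axioms.intro nz color_k_range h.closed R.T_closed;
      assumption?)
    fix l r assume lr: "1 \<le> l" "l < r" "r \<le> n"
    have "T l \<in> carrier A" "T r \<in> carrier A" "T (color_k r l) \<in> carrier A"
      using lr color_k_range[OF lr(1,2)] by (auto intro!: R.T_closed)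
    then show "h (T r) \<otimes>\<^bsub>B\<^esub> h (T l) = \<epsilon> (d r) (d l) \<odot>\<^bsub>B\<^esub> (h (T l) \<otimes>\<^bsub>B\<^esub> h (T r))
        \<oplus>\<^bsub>B\<^esub> color_c \<epsilon> d r l \<odot>\<^bsub>B\<^esub> h (T (color_k r l))"
      using R.rel[OF lr]
      by (simp only: h.mult[symmetric] h.add[symmetric] h.smult[symmetric] h.A.smult_cl h.A.m_closed)
  qed
qed

text \<open>The algebra \<open>A\<close> rewritten on its coordinate vectors. The towers are sought
  on the type of finitely supported coefficient functions on exponents, which depends only on the
  field, and not among the cosets of the enveloping algebra.\<close>

definition coord_algebra :: "('k::field, 'a) module \<Rightarrow> 'i set \<Rightarrow> ('i \<Rightarrow> 'a) \<Rightarrow> ('k, 'i \<Rightarrow>\<^sub>0 'k) module" where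
  "coord_algebra A J b =
     \<lparr>carrier = {f. keys f \<subseteq> J},
      monoid.mult = (\<lambda>f g. coordinates A J b (lin_comb A b f \<otimes>\<^bsub>A\<^esub> lin_comb A b g)),
      one = coordinates A J b \<one>\<^bsub>A\<^esub>, zero = 0, add = (+), smult = (\<lambda>c. pm_smult c)\<rparr>"

context assoc_alg
begin

context
  fixes J :: "'i set" and b :: "'i \<Rightarrow> 'a"
  assumes basis: "basis_family A J b"
begin

lemma W_simps [simp]:
  "carrier (coord_algebra A J b) = {f. keys f \<subseteq> J}" "f \<otimes>\<^bsub>coord_algebra A J b\<^esub> g = coordinates A J b (lin_comb A b f \<otimes> lin_comb A b g)"
  "\<one>\<^bsub>coord_algebra A J b\<^esub> = coordinates A J b \<one>" "\<zero>\<^bsub>coord_algebra A J b\<^esub> = 0" "f \<oplus>\<^bsub>coord_algebra A J b\<^esub> g = f + g" "c \<odot>\<^bsub>coord_algebra A J b\<^esub> f = pm_smult c f"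
  by (simp_all add: coord_algebra_def)

lemma basis_carrier: "b \<in> J \<rightarrow> carrier A"
  using basis unfolding basis_family_def by blast

lemma lin_comb_basis_closed [simp]: "keys f \<subseteq> J \<Longrightarrow> lin_comb A b f \<in> carrier A"
  using basis_carrier by (intro lin_comb_closed) auto

lemma coordinates:
  assumes "u \<in> carrier A"
  shows "keys (coordinates A J b u) \<subseteq> J" "lin_comb A b (coordinates A J b u) = u"
proof -
  obtain f where "keys f \<subseteq> J" "u = lin_comb A b f"
    using basis assms unfolding basis_family_def by blast
  then show "keys (coordinates A J b u) \<subseteq> J" "lin_comb A b (coordinates A J b u) = u"
    using coordinates_lin_comb[OF basis, of f] by simp_all
qed

lemma coordinates_add:
  assumes "u \<in> carrier A" "v \<in> carrier A"
  shows "coordinates A J b (u \<oplus> v) = coordinates A J b u + coordinates A J b v"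
proof -
  note c = coordinates[OF assms(1)] coordinates[OF assms(2)]
  have k: "keys (coordinates A J b u + coordinates A J b v) \<subseteq> J"
    using keys_add[of "coordinates A J b u" "coordinates A J b v"] c by blast
  have "u \<oplus> v = lin_comb A b (coordinates A J b u + coordinates A J b v)"
    using lin_comb_add[OF basis_carrier c(1,3)] c by simp
  then show ?thesis
    using coordinates_lin_comb[OF basis k] by simp
qed

lemma coordinates_smult:
  assumes "u \<in> carrier A" shows "coordinates A J b (a \<odot> u) = pm_smult a (coordinates A J b u)"
proof -
  note c = coordinates[OF assms(1)]
  have k: "keys (pm_smult a (coordinates A J b u)) \<subseteq> J"
    using keys_pm_smult[of a "coordinates A J b u"] c by blast
  have "b \<in> keys (coordinates A J b u) \<rightarrow> carrier A"
    using basis_carrier c by auto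
  then have "a \<odot> u = lin_comb A b (pm_smult a (coordinates A J b u))"
    using c by (simp add: lin_comb_smult)
  then show ?thesis
    using coordinates_lin_comb[OF basis k] by simp
qed

lemma lin_comb_basis_smult: "keys f \<subseteq> J \<Longrightarrow> lin_comb A b (pm_smult a f) = a \<odot> lin_comb A b f"
  using basis_carrier by (intro lin_comb_smult) auto

lemmas W_rules = coordinates coordinates_add coordinates_smult coordinates_lin_comb[OF basis]
  lin_comb_add[OF basis_carrier] lin_comb_basis_smult

lemma keys_W_add: "\<lbrakk>keys f \<subseteq> J; keys g \<subseteq> J\<rbrakk> \<Longrightarrow> keys (f + g) \<subseteq> J"
  using keys_add[of f g] by blast

lemma keys_W_smult: "keys f \<subseteq> J \<Longrightarrow> keys (pm_smult c f) \<subseteq> J"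
  using keys_pm_smult[of c f] by blast

lemma coord_assoc_alg: "assoc_alg (coord_algebra A J b)"
proof (rule assoc_algI)
  show "abelian_group (coord_algebra A J b)"
  proof (rule abelian_groupI)
    show "\<exists>y\<in>carrier (coord_algebra A J b). y \<oplus>\<^bsub>coord_algebra A J b\<^esub> x = \<zero>\<^bsub>coord_algebra A J b\<^esub>" if "x \<in> carrier (coord_algebra A J b)" for x
      by (rule bexI[of _ "- x"]) (use that in \<open>auto simp: keys_minus\<close>)
  qed (simp_all add: keys_W_add ac_simps)
  show "Group.monoid (coord_algebra A J b)"
    by (rule Group.monoidI) (simp_all add: W_rules m_assoc)
qed (simp_all add: W_rules keys_W_add keys_W_smult l_distr r_distr smult_mult_left smult_mult_right
  poly_mapping_eq_iff fun_eq_iff lookup_add ring_distribs)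

lemma coord_hom: "coordinates A J b \<in> algebra_hom A (coord_algebra A J b)"
  by (rule algebra_homI) (simp_all add: W_rules)

lemma lin_comb_hom: "lin_comb A b \<in> algebra_hom (coord_algebra A J b) A"
  by (rule algebra_homI) (simp_all add: W_rules)

end

end

text \<open>All hypotheses of \<open>tower_setup\<close> are carried over by the two mutually
  inverse coordinate maps; the grading endomorphisms are conjugated by them.\<close>

lemma color_tower_exists:
  fixes A :: "('k::field, 'a) module" and \<epsilon> :: "'g::ab_group_add \<Rightarrow> 'g \<Rightarrow> 'k"
  assumes gens: "color_gens \<epsilon> m d A T"
    and basis: "basis_family A (exponents (s_index m m)) (std_monomial A (s_index m m) T)"
    and grading: "\<And>g. \<exists>h\<in>algebra_hom A A. \<forall>l\<in>{1..s_index m m}. h (T l) = \<epsilon> g (d l) \<odot>\<^bsub>A\<^esub> T l"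
    and r: "r \<le> s_index m m"
  shows "\<exists>\<tau> (B :: ('k, (nat \<Rightarrow>\<^sub>0 nat) \<Rightarrow>\<^sub>0 'k) module). ore_tower \<epsilon> d \<tau> r B"
proof -
  interpret color_gens \<epsilon> m d A T by (rule gens)
  let ?J = "exponents n"
  let ?W = "coord_algebra A ?J M" and ?\<psi> = "coordinates A ?J M" and ?\<phi> = "lin_comb A M"
  interpret W: assoc_alg ?W by (rule coord_assoc_alg[OF basis])
  interpret \<psi>: alg_hom A ?W ?\<psi>
    by (rule alg_homI[OF assoc_alg_axioms W.assoc_alg_axioms coord_hom[OF basis]])
  interpret \<phi>: alg_hom ?W A ?\<phi>
    by (rule alg_homI[OF W.assoc_alg_axioms assoc_alg_axioms lin_comb_hom[OF basis]])
  let ?T = "\<lambda>r. ?\<psi> (T r)"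
  have R: "color_relations \<epsilon> d ?W n ?T"
    by (rule color_relations_hom[OF \<psi>.alg_hom_axioms ore_relations_axioms \<epsilon>_nz])
  have mon: "?\<psi> (M \<alpha>) = std_monomial ?W n ?T \<alpha>" for \<alpha>
    by (rule \<psi>.std_monomial) (rule T_closed)
  \<comment> \<open>In coordinates the monomial of \<open>\<alpha>\<close> is the unit vector at
    \<open>\<alpha>\<close>, so forming combinations is the identity and the basis property becomes
    immediate.\<close>
  have lin: "lin_comb ?W (std_monomial ?W n ?T) f = f" if "keys f \<subseteq> ?J" for f
  proof -
    have "f = ?\<psi> (lin_comb A M f)"
      by (rule coordinates_lin_comb[OF basis that, symmetric])
    also have "\<dots> = lin_comb ?W (\<lambda>\<alpha>. ?\<psi> (M \<alpha>)) f"
      by (rule \<psi>.lin_comb) simp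
    finally show ?thesis by (simp only: mon)
  qed
  have "tower_setup \<epsilon> m d ?W ?T"
  proof (intro tower_setup.intro color_gens.intro tower_setup_axioms.intro R)
    show "generic_degrees \<epsilon> m d" by (rule generic_degrees_axioms)
    show "basis_family ?W ?J (std_monomial ?W n ?T)"
      unfolding basis_family_def
    proof (intro conjI ballI allI impI)
      show "std_monomial ?W n ?T ` ?J \<subseteq> carrier ?W"
        using \<psi>.closed[OF M_closed] unfolding mon by blast
      show "\<exists>c. keys c \<subseteq> ?J \<and> u = lin_comb ?W (std_monomial ?W n ?T) c" if "u \<in> carrier ?W" for u
        using that lin[of u] W_simps(1)[OF basis] by (intro exI[of _ u]) simp
      show "c = 0" if "keys c \<subseteq> ?J" "lin_comb ?W (std_monomial ?W n ?T) c = \<zero>\<^bsub>?W\<^esub>" for c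
        using that lin[of c] W_simps(4)[OF basis] by simp
    qed
    fix g
    obtain h where h: "h \<in> algebra_hom A A" "\<And>l. l \<in> {1..n} \<Longrightarrow> h (T l) = \<epsilon> g (d l) \<odot>\<^bsub>A\<^esub> T l"
      using grading[of g] by blast
    have "(\<lambda>f. ?\<psi> (h (?\<phi> f))) \<in> algebra_hom ?W ?W"
      by (rule algebra_hom_comp[OF algebra_hom_comp[OF \<phi>.hom h(1)] \<psi>.hom])
    moreover have "?\<psi> (h (?\<phi> (?T l))) = \<epsilon> g (d l) \<odot>\<^bsub>?W\<^esub> ?T l" if "l \<in> {1..n}" for l
      using h(2)[OF that] coordinates(2)[OF basis T_closed[OF that]] \<psi>.smult[OF T_closed[OF that]] by simp
    ultimately show "\<exists>h\<in>algebra_hom ?W ?W. \<forall>l\<in>{1..n}. h (?T l) = \<epsilon> g (d l) \<odot>\<^bsub>?W\<^esub> ?T l"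
      by (intro bexI[of _ "\<lambda>f. ?\<psi> (h (?\<phi> f))"]) simp_all
  qed
  from tower_setup.tower[OF this r] show ?thesis by blast
qed

context generic_setup
begin

lemma gens_m: "color_gens \<epsilon> m (\<lambda>r. d r) (U\<^sub>i m) (T\<^sub>i m)"
  using generic_degrees[OF order_refl] uea_relations[OF order_refl] by (rule color_gens.intro)

text \<open>Multiplying each variable by \<epsilon>(g, its degree) respects the color relations,
  because the degree of a bracket is the sum of the degrees of its arguments; the universal property
  then yields the endomorphism.\<close>

lemma uea_grading:
  "\<exists>h\<in>algebra_hom (U\<^sub>i m) (U\<^sub>i m). \<forall>l\<in>{1..n m}. h (T\<^sub>i m l) = \<epsilon> g (d l) \<odot>\<^bsub>U\<^sub>i m\<^esub> T\<^sub>i m l"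
proof (rule uea_lift_relations[OF order_refl])
  note R = uea_relations[OF order_refl]
  interpret R: ore_relations "U\<^sub>i m" "n m" "T\<^sub>i m" "color_q \<epsilon> (\<lambda>r. d r)" "color_c \<epsilon> (\<lambda>r. d r)" color_k
    by (rule R)
  show "color_relations \<epsilon> (\<lambda>r. d r) (U\<^sub>i m) (n m) (\<lambda>l. \<epsilon> g (d l) \<odot>\<^bsub>U\<^sub>i m\<^esub> T\<^sub>i m l)"
  proof (intro ore_relations.intro R.assoc_alg_axioms ore_relations_axioms.intro \<epsilon>_nz color_k_range
      R.smult_cl R.T_closed; assumption?)
    fix l r assume lr: "1 \<le> l" "l < r" "r \<le> n m"
    let ?U = "U\<^sub>i m" and ?c = "color_c \<epsilon> (\<lambda>r. d r) r l" and ?k = "color_k r l"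
    have c: "T\<^sub>i m l \<in> carrier ?U" "T\<^sub>i m r \<in> carrier ?U" "T\<^sub>i m ?k \<in> carrier ?U"
      using lr color_k_range[OF lr(1,2)] by (auto intro!: R.T_closed)
    \<comment> \<open>Where the coefficient vanishes, the index \<open>?k\<close> is a placeholder
      of unrelated degree; keeping \<open>?c\<close> as a factor covers this case.\<close>
    have "?c * \<epsilon> g (d ?k) = ?c * (\<epsilon> g (d r) * \<epsilon> g (d l))"
    proof (cases "\<exists>b j. diag_pair r l b j")
      case True
      then obtain b j where b: "1 \<le> b" "b < j" "r = s_index j j" "l = s_index b b"
        by (auto simp: diag_pair_def)
      then have "j \<le> m"
        using lr s_index_less[of m m j j] by (cases "m < j") auto
      then show ?thesis
        using b d_off[of b j] d_diag[of j] d_diag[of b] color_k_diag[of b j] by (simp add: \<epsilon>_add_right)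
    qed (simp add: color_c_def)
    then have e: "\<epsilon> g (d l) * (\<epsilon> g (d r) * ?c) = \<epsilon> g (d ?k) * ?c"
      by (auto simp: ac_simps)
    then show "(\<epsilon> g (d r) \<odot>\<^bsub>?U\<^esub> T\<^sub>i m r) \<otimes>\<^bsub>?U\<^esub> (\<epsilon> g (d l) \<odot>\<^bsub>?U\<^esub> T\<^sub>i m l) =
      \<epsilon> (d r) (d l) \<odot>\<^bsub>?U\<^esub> ((\<epsilon> g (d l) \<odot>\<^bsub>?U\<^esub> T\<^sub>i m l) \<otimes>\<^bsub>?U\<^esub> (\<epsilon> g (d r) \<odot>\<^bsub>?U\<^esub> T\<^sub>i m r))
        \<oplus>\<^bsub>?U\<^esub> ?c \<odot>\<^bsub>?U\<^esub> (\<epsilon> g (d ?k) \<odot>\<^bsub>?U\<^esub> T\<^sub>i m ?k)"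
      using c R.rel[OF lr]
      by (simp add: R.smult_mult_left R.smult_mult_right R.smult_smult R.smult_add_right ac_simps e)
  qed
qed

text \<open>Every U_i is a stage of the single tower built inside U(X), so the basis theorem for the
  full X serves all \<open>i\<close>. The case \<open>i = 0\<close> is split off because
  \<open>s_index_le\<close> starts at 1.\<close>

lemma tower_exists:
  "i \<le> m \<Longrightarrow> \<exists>\<tau> (B :: ('k, (nat \<Rightarrow>\<^sub>0 nat) \<Rightarrow>\<^sub>0 'k) module). ore_tower \<epsilon> (\<lambda>r. d r) \<tau> (s_index i i) B"
  using s_index_le[of i i m]
  by (cases "i = 0") (auto intro!: color_tower_exists[OF gens_m uea_basis uea_grading] simp: s_index_def)

lemma tower_iso:
  assumes "i \<le> m" "ore_tower \<epsilon> (\<lambda>r. d r) \<tau> (s_index i i) A" shows "U\<^sub>i i \<cong>\<^sub>a A"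
  using uea_iso[OF assms(1)] ore_tower_basis[OF \<epsilon>_nz assms(2)] by blast

end

theorem lemma4p1:
  fixes scale :: "'k::field \<Rightarrow> 'v::ab_group_add \<Rightarrow> 'v"
    and \<epsilon> :: "'g::ab_group_add \<Rightarrow> 'g \<Rightarrow> 'k"
    and X :: "'v set" and gr :: "'g \<Rightarrow> 'v set" and br :: "'v \<Rightarrow> 'v \<Rightarrow> 'v"
    and m p :: nat and x t :: "nat \<Rightarrow> 'v"
  defines "p \<equiv> m * (m + 1) div 2"
  assumes "CHAR('k) \<noteq> 2"
    and "generic_lie_color_algebra scale \<epsilon> X gr br"
    and "\<And>i. i \<in> {1..m} \<Longrightarrow> \<exists>g. x i \<in> gr g"
    and "inj_on x {1..m}"
    and "\<not> module.dependent scale (x ` {1..m})"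
    and "module.span scale (x ` {1..m}) = sign_part scale \<epsilon> gr (-1)"
    and "\<And>j. j \<in> {1..m} \<Longrightarrow> t (s_index j j) = x j"
    and "\<And>i j. \<lbrakk>1 \<le> i; i < j; j \<le> m\<rbrakk> \<Longrightarrow> t (s_index i j) = br (x i) (x j)"
  shows
    "let U = uea scale \<epsilon> X gr br; T = (\<lambda>r. uea_incl scale \<epsilon> X gr br (t r)) in
       basis_family U (exponents p) (std_monomial U p T) \<and>
       (\<forall>i\<in>{1..m}.
          let Xi = sub_generated scale br (x ` {1..i});
              Ui = uea scale \<epsilon> Xi (\<lambda>g. gr g \<inter> Xi) br
          in (\<exists>\<tau> (A :: ('k, (nat \<Rightarrow>\<^sub>0 nat) \<Rightarrow>\<^sub>0 'k) module).
                ore_tower \<epsilon> (\<lambda>r. deg gr (t r)) \<tau> (s_index i i) A) \<and>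
             (\<forall>\<tau> (A :: ('k, (nat \<Rightarrow>\<^sub>0 nat) \<Rightarrow>\<^sub>0 'k) module).
                ore_tower \<epsilon> (\<lambda>r. deg gr (t r)) \<tau> (s_index i i) A \<longrightarrow> Ui \<cong>\<^sub>a A)) \<and>
       (\<exists>R. admissible_order U p T R \<and>
          (\<forall>i\<in>{1..p}. \<forall>j\<in>{1..p}. i < j \<longrightarrow> lead_less U p T R (T i) (T j)))"
proof -
  interpret generic_setup scale \<epsilon> X gr br m x t
    using assms(2-9) by (intro generic_setup.intro generic_setup_axioms.intro)
  have p: "p = s_index m m"
    by (simp add: p_def s_index_triangle)
  interpret R: ore_relations "uea scale \<epsilon> X gr br" p "\<lambda>r. uea_incl scale \<epsilon> X gr br (t r)"
      "color_q \<epsilon> (\<lambda>r. deg gr (t r))" "color_c \<epsilon> (\<lambda>r. deg gr (t r))" color_k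
    using uea_relations[OF order_refl] unfolding uea_m p .
  have basis: "basis_family (uea scale \<epsilon> X gr br) (exponents p)
      (std_monomial (uea scale \<epsilon> X gr br) p (\<lambda>r. uea_incl scale \<epsilon> X gr br (t r)))"
    using uea_basis unfolding uea_m p .
  show ?thesis
    unfolding Let_def
  proof (intro conjI ballI allI impI exI[of _ "deglex_rel p"])
    fix i assume "i \<in> {1..m}"
    then have i: "i \<le> m" by simp
    show "\<exists>\<tau> (A :: ('k, (nat \<Rightarrow>\<^sub>0 nat) \<Rightarrow>\<^sub>0 'k) module). ore_tower \<epsilon> (\<lambda>r. deg gr (t r)) \<tau> (s_index i i) A"
      by (rule tower_exists[OF i])
    show "uea scale \<epsilon> (sub_generated scale br (x ` {1..i})) (\<lambda>g. gr g \<inter> sub_generated scale br (x ` {1..i})) br \<cong>\<^sub>a A"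
      if "ore_tower \<epsilon> (\<lambda>r. deg gr (t r)) \<tau> (s_index i i) A" for \<tau> and A :: "('k, (nat \<Rightarrow>\<^sub>0 nat) \<Rightarrow>\<^sub>0 'k) module"
      unfolding sub_generated_eq[OF i] by (rule tower_iso[OF i that])
  qed (use basis R.admissible_deglex R.lead_less_T in simp_all)
qed

end
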